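(* Let $V$ be a set of $n$ vertices with weights $w:V\to\mathbb{R}_{\ge 1}$, let $W=\max_v w(v)$, and let $\varepsilon\in(0,1)$. There is a data structure for an undirected vertex-weighted graph $G$ on $V$, dynamically updated by edge insertions and deletions starting from the empty graph, that maintains (i) explicitly, an orientation of the edges of $G$ whose maximum load satisfies $\max_v \ell(v)\le(1+\varepsilon)\mathsf{OPT}_{\mathsf{LP}}+O(\log(nW)/\varepsilon)$, and (ii) implicitly, a subgraph of $G$ with density at least $(1-\varepsilon)\mathsf{OPT}_{\mathsf{LP}}-O(\log(nW)/\varepsilon)$, in $O\left(\log^2(nW)\log(\log(nW)/\varepsilon)/\varepsilon^2\right)$ amortized time per update and $O\left(\log^3(nW)\log(\log(nW)/\varepsilon)/\varepsilon^4\right)$ worst-case time per update.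
   Context: For a vertex-weighted undirected graph $G=(V,E,w)$ and nonempty $S\subseteq V$, let $E(S)$ be the set of edges with both endpoints in $S$ and $w(S)=\sum_{v\in S}w(v)$; the density of $S$ is $\rho_G(S)=|E(S)|/w(S)$. $\mathsf{OPT}_{\mathsf{LP}}$ is the optimum value, for the current graph, of the linear program: maximize $\sum_{(u,v)\in E}\min(x_u,x_v)$ over $x\in\mathbb{R}_{\ge0}^V$ subject to $\sum_v w(v)x_v\le 1$ (it equals $\max_S\rho_G(S)$). An orientation directs each undirected edge towards one of its endpoints; with $d^-(v)$ the in-degree of $v$ in the orientation, the load (weighted in-degree) of $v$ is $\ell(v)=d^-(v)/w(v)$. A subgraph is maintained implicitly if the data structure can, after any update, list the vertices of the subgraph in $O(1)$ time per vertex. Parallel edges may be allowed provided that all loads remain bounded by a polynomial in $nW$. Constants hidden in $O(\cdot)$ are absolute. *)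

theory Defs
  imports Complex_Main "HOL-Library.Multiset"
begin

section \<open>Vertex-weighted graphs, orientations and densities\<close>

text \<open>
  The vertex set is \<open>{..<n}\<close>. A graph is a finite multiset of edges \<open>{u, v}\<close> with \<open>u \<noteq> v\<close>;
  multiplicities are parallel edges.
\<close>

type_synonym graph = "nat set multiset"

definition max_weight :: "nat \<Rightarrow> (nat \<Rightarrow> real) \<Rightarrow> real" where
  "max_weight n w = Max (w ` {..<n})"

definition density :: "(nat \<Rightarrow> real) \<Rightarrow> graph \<Rightarrow> nat set \<Rightarrow> real" where
  "density w G S = real (size (filter_mset (\<lambda>e. e \<subseteq> S) G)) / (\<Sum>v\<in>S. w v)"

text \<open>For an edge \<open>e = {u, v}\<close> the term \<open>Min (x ` e)\<close> is \<open>min (x u) (x v)\<close>.\<close>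

definition lp_feasible :: "nat \<Rightarrow> (nat \<Rightarrow> real) \<Rightarrow> (nat \<Rightarrow> real) \<Rightarrow> bool" where
  "lp_feasible n w x \<longleftrightarrow> (\<forall>v<n. 0 \<le> x v) \<and> (\<Sum>v<n. w v * x v) \<le> 1"

definition opt_lp :: "nat \<Rightarrow> (nat \<Rightarrow> real) \<Rightarrow> graph \<Rightarrow> real" where
  "opt_lp n w G = Sup {(\<Sum>e\<in>#G. Min (x ` e)) | x. lp_feasible n w x}"

text \<open>The supremum is over a nonempty bounded set, and it is attained by compactness.\<close>

lemma opt_lp_bounded:
  assumes w: "\<forall>v<n. 1 \<le> w v" and G: "\<forall>e\<in>#G. e \<noteq> {} \<and> e \<subseteq> {..<n}"
  shows "{(\<Sum>e\<in>#G. Min (x ` e)) | x. lp_feasible n w x} \<noteq> {}"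
    and "bdd_above {(\<Sum>e\<in>#G. Min (x ` e)) | x. lp_feasible n w x}"
proof -
  have "lp_feasible n w (\<lambda>_. 0)"
    by (simp add: lp_feasible_def)
  then show "{(\<Sum>e\<in>#G. Min (x ` e)) | x. lp_feasible n w x} \<noteq> {}"
    by blast
  have "(\<Sum>e\<in>#G. Min (x ` e)) \<le> real (size G)" if x: "lp_feasible n w x" for x
  proof -
    have x_le: "x v \<le> 1" if v: "v < n" for v
    proof -
      have nonneg: "0 \<le> w u * x u" if "u < n" for u
        using w x that unfolding lp_feasible_def by (intro mult_nonneg_nonneg) force+
      have "1 * x v \<le> w v * x v"
        using w x v unfolding lp_feasible_def by (intro mult_right_mono) auto
      also have "\<dots> \<le> (\<Sum>u<n. w u * x u)"
        using v nonneg by (intro member_le_sum) auto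
      also have "\<dots> \<le> 1"
        using x unfolding lp_feasible_def by blast
      finally show ?thesis by simp
    qed
    have "Min (x ` e) \<le> 1" if "e \<in># G" for e
    proof -
      from G that obtain v where v: "v \<in> e" "v < n" and fin: "finite e"
        using finite_subset[of e "{..<n}"] by blast
      then have "Min (x ` e) \<le> x v" by simp
      with x_le[OF v(2)] show ?thesis by linarith
    qed
    then have "(\<Sum>e\<in>#G. Min (x ` e)) \<le> (\<Sum>e\<in>#G. 1)"
      by (intro sum_mset_mono)
    then show ?thesis by simp
  qed
  then show "bdd_above {(\<Sum>e\<in>#G. Min (x ` e)) | x. lp_feasible n w x}"
    by (intro bdd_aboveI[of _ "real (size G)"]) blast
qed

text \<open>\<open>R u v\<close> is the number of copies of the edge \<open>{u, v}\<close> that are directed towards \<open>v\<close>.\<close>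

definition orientation :: "nat \<Rightarrow> graph \<Rightarrow> (nat \<Rightarrow> nat \<Rightarrow> nat) \<Rightarrow> bool" where
  "orientation n G R \<longleftrightarrow>
     (\<forall>u<n. R u u = 0) \<and> (\<forall>u<n. \<forall>v<n. u \<noteq> v \<longrightarrow> R u v + R v u = count G {u, v})"

definition in_degree :: "nat \<Rightarrow> (nat \<Rightarrow> nat \<Rightarrow> nat) \<Rightarrow> nat \<Rightarrow> nat" where
  "in_degree n R v = (\<Sum>u<n. R u v)"

definition load :: "nat \<Rightarrow> (nat \<Rightarrow> real) \<Rightarrow> (nat \<Rightarrow> nat \<Rightarrow> nat) \<Rightarrow> nat \<Rightarrow> real" where
  "load n w R v = real (in_degree n R v) / w v"

definition max_load :: "nat \<Rightarrow> (nat \<Rightarrow> real) \<Rightarrow> (nat \<Rightarrow> nat \<Rightarrow> nat) \<Rightarrow> real" where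
  "max_load n w R = Max (load n w R ` {..<n})"

text \<open>
  Logarithms inside \<open>O(\<cdot>)\<close>, with the usual convention that they are at least \<open>1\<close>. It only matters for
  \<open>log (n W)\<close> with \<open>n = 1\<close> and for the iterated \<open>log (log (n W) / \<epsilon>)\<close>, whose argument can be close to \<open>1\<close>.
\<close>

definition lg :: "real \<Rightarrow> real" where
  "lg x = max 1 (log 2 x)"


section \<open>The machine model\<close>

text \<open>
  A random access machine with structured programs. It has named arrays of natural numbers
  (machine words) and named arrays of reals; the scalar \<open>x\<close> is cell \<open>0\<close> of the array \<open>x\<close>. A program
  mentions finitely many arrays, so they can be interleaved into a single memory with constant
  overhead. Reals support exact field operations and comparison, but there is no rounding and no
  conversion of reals to words. Subtraction of words is truncated at \<open>0\<close>.
\<close>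

datatype nexp =
    NLit nat
  | NGet string nexp
  | NAdd nexp nexp
  | NSub nexp nexp
  | NMul nexp nexp
  | NDiv nexp nexp

datatype rexp =
    ROfNat nexp
  | RGet string nexp
  | RAdd rexp rexp
  | RSub rexp rexp
  | RMul rexp rexp
  | RDiv rexp rexp

datatype bexp =
    NLess nexp nexp
  | RLess rexp rexp
  | Neg bexp
  | Conj bexp bexp

datatype com =
    Skip
  | NPut string nexp nexp  \<comment> \<open>array, index, new value\<close>
  | RPut string nexp rexp
  | Emit nexp  \<comment> \<open>append a word to the output\<close>
  | Sequ com com
  | IfThen bexp com com
  | WhileDo bexp com

record state =
  nmem :: "string \<Rightarrow> nat \<Rightarrow> nat"
  rmem :: "string \<Rightarrow> nat \<Rightarrow> real"
  written :: "nat list"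

fun nval :: "nexp \<Rightarrow> state \<Rightarrow> nat" where
  "nval (NLit a) s = a"
| "nval (NGet x i) s = nmem s x (nval i s)"
| "nval (NAdd a b) s = nval a s + nval b s"
| "nval (NSub a b) s = nval a s - nval b s"
| "nval (NMul a b) s = nval a s * nval b s"
| "nval (NDiv a b) s = nval a s div nval b s"

fun rval :: "rexp \<Rightarrow> state \<Rightarrow> real" where
  "rval (ROfNat a) s = real (nval a s)"
| "rval (RGet x i) s = rmem s x (nval i s)"
| "rval (RAdd a b) s = rval a s + rval b s"
| "rval (RSub a b) s = rval a s - rval b s"
| "rval (RMul a b) s = rval a s * rval b s"
| "rval (RDiv a b) s = rval a s / rval b s"

fun bval :: "bexp \<Rightarrow> state \<Rightarrow> bool" where
  "bval (NLess a b) s \<longleftrightarrow> nval a s < nval b s"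
| "bval (RLess a b) s \<longleftrightarrow> rval a s < rval b s"
| "bval (Neg b) s \<longleftrightarrow> \<not> bval b s"
| "bval (Conj a b) s \<longleftrightarrow> bval a s \<and> bval b s"

definition nput :: "string \<Rightarrow> nat \<Rightarrow> nat \<Rightarrow> state \<Rightarrow> state" where
  "nput x i a s = s\<lparr>nmem := (nmem s)(x := (nmem s x)(i := a))\<rparr>"

definition rput :: "string \<Rightarrow> nat \<Rightarrow> real \<Rightarrow> state \<Rightarrow> state" where
  "rput x i a s = s\<lparr>rmem := (rmem s)(x := (rmem s x)(i := a))\<rparr>"

text \<open>
  \<open>exec B c s t s'\<close>: started in \<open>s\<close>, the program \<open>c\<close> terminates in \<open>s'\<close> after \<open>t\<close> steps. \<open>B\<close> bounds the
  words and addresses that may be written (a word has \<open>log\<^sub>2 B\<close> bits); exceeding it makes the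
  execution fail. A step is an assignment, an output or a test. The expressions in a fixed program
  have bounded size, so evaluating one takes a constant number of elementary operations.
\<close>

inductive exec :: "real \<Rightarrow> com \<Rightarrow> state \<Rightarrow> nat \<Rightarrow> state \<Rightarrow> bool" for B :: real where
  exec_Skip: "exec B Skip s 1 s"
| exec_NPut: "real (nval i s) \<le> B \<Longrightarrow> real (nval e s) \<le> B
    \<Longrightarrow> exec B (NPut x i e) s 1 (nput x (nval i s) (nval e s) s)"
| exec_RPut: "real (nval i s) \<le> B
    \<Longrightarrow> exec B (RPut x i a) s 1 (rput x (nval i s) (rval a s) s)"
| exec_Emit: "real (nval e s) \<le> B
    \<Longrightarrow> exec B (Emit e) s 1 (s\<lparr>written := written s @ [nval e s]\<rparr>)"
| exec_Sequ: "exec B c1 s t1 s1 \<Longrightarrow> exec B c2 s1 t2 s2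
    \<Longrightarrow> exec B (Sequ c1 c2) s (t1 + t2) s2"
| exec_IfTrue: "bval b s \<Longrightarrow> exec B c1 s t s1 \<Longrightarrow> exec B (IfThen b c1 c2) s (1 + t) s1"
| exec_IfFalse: "\<not> bval b s \<Longrightarrow> exec B c2 s t s1 \<Longrightarrow> exec B (IfThen b c1 c2) s (1 + t) s1"
| exec_WhileFalse: "\<not> bval b s \<Longrightarrow> exec B (WhileDo b c) s 1 s"
| exec_WhileTrue: "bval b s \<Longrightarrow> exec B c s t1 s1 \<Longrightarrow> exec B (WhileDo b c) s1 t2 s2
    \<Longrightarrow> exec B (WhileDo b c) s (1 + t1 + t2) s2"

inductive_cases exec_SkipE: "exec B Skip s t s'"
inductive_cases exec_NPutE: "exec B (NPut x i e) s t s'"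
inductive_cases exec_RPutE: "exec B (RPut x i a) s t s'"
inductive_cases exec_EmitE: "exec B (Emit e) s t s'"
inductive_cases exec_SequE: "exec B (Sequ c1 c2) s t s'"
inductive_cases exec_IfThenE: "exec B (IfThen b c1 c2) s t s'"
inductive_cases exec_WhileDoE: "exec B (WhileDo b c) s t s'"

lemma exec_deterministic:
  "exec B c s t s' \<Longrightarrow> exec B c s u s'' \<Longrightarrow> u = t \<and> s'' = s'"
proof (induction arbitrary: u s'' rule: exec.induct)
  case (exec_Sequ c1 s t1 s1 c2 t2 s2)
  from exec_Sequ.prems show ?case
    by (rule exec_SequE) (metis exec_Sequ.IH)
next
  case (exec_IfTrue b s c1 t s1 c2)
  from exec_IfTrue.prems show ?case
    by (rule exec_IfThenE) (use exec_IfTrue.IH exec_IfTrue.hyps(1) in auto)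
next
  case (exec_IfFalse b s c2 t s1 c1)
  from exec_IfFalse.prems show ?case
    by (rule exec_IfThenE) (use exec_IfFalse.IH exec_IfFalse.hyps(1) in auto)
next
  case (exec_WhileFalse b s c)
  from exec_WhileFalse.prems show ?case
    by (rule exec_WhileDoE) (use exec_WhileFalse.hyps in auto)
next
  case (exec_WhileTrue b s c t1 s1 t2 s2)
  from exec_WhileTrue.prems show ?case
  proof (rule exec_WhileDoE)
    assume "\<not> bval b s"
    with exec_WhileTrue.hyps(1) show ?thesis by simp
  next
    fix t1' s1' t2'
    assume u: "u = Suc (t1' + t2')" and body: "exec B c s t1' s1'"
      and rest: "exec B (WhileDo b c) s1' t2' s''"
    from exec_WhileTrue.IH(1)[OF body] have "t1' = t1" "s1' = s1" by auto
    moreover from this exec_WhileTrue.IH(2) rest have "t2' = t2 \<and> s'' = s2" by blast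
    ultimately show ?thesis using u by simp
  qed
qed (erule exec_SkipE exec_NPutE exec_RPutE exec_EmitE, simp)+


section \<open>Dynamic graph data structures\<close>

record data_structure =
  init_code :: com
  insert_code :: com
  delete_code :: com
  report_code :: com

text \<open>
  \<open>Report\<close> lists the vertices of the implicitly maintained subgraph. It may occur anywhere in
  a sequence of operations, so listing must leave the data structure usable.
\<close>

datatype operation =
    Insert nat nat
  | Delete nat nat
  | Report

fun code_of :: "data_structure \<Rightarrow> operation \<Rightarrow> com" where
  "code_of D (Insert u v) = insert_code D"
| "code_of D (Delete u v) = delete_code D"
| "code_of D Report = report_code D"

text \<open>Cells without input are initially \<open>0\<close>.\<close>

definition input_state :: "nat \<Rightarrow> (nat \<Rightarrow> real) \<Rightarrow> real \<Rightarrow> state" where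
  "input_state n w \<epsilon> =
     \<lparr>nmem = (\<lambda>x i. if x = ''n'' \<and> i = 0 then n else 0),
      rmem = (\<lambda>x i. if x = ''eps'' \<and> i = 0 then \<epsilon> else if x = ''w'' \<and> i < n then w i else 0),
      written = []\<rparr>"

fun call_state :: "operation \<Rightarrow> state \<Rightarrow> state" where
  "call_state (Insert u v) s = nput ''u'' 0 u (nput ''v'' 0 v (s\<lparr>written := []\<rparr>))"
| "call_state (Delete u v) s = nput ''u'' 0 u (nput ''v'' 0 v (s\<lparr>written := []\<rparr>))"
| "call_state Report s = s\<lparr>written := []\<rparr>"

text \<open>The list \<open>ts\<close> collects the running times of the individual operations.\<close>

fun executes ::
  "real \<Rightarrow> data_structure \<Rightarrow> state \<Rightarrow> operation list \<Rightarrow> nat list \<Rightarrow> state \<Rightarrow> bool" where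
  "executes B D s [] ts s' \<longleftrightarrow> ts = [] \<and> s' = s"
| "executes B D s (p # ps) ts s' \<longleftrightarrow>
     (\<exists>t ts' s1. ts = t # ts' \<and> exec B (code_of D p) (call_state p s) t s1 \<and>
        executes B D s1 ps ts' s')"

text \<open>
  An orientation is maintained explicitly if it is stored in memory after every operation:
  the number of edges directed from \<open>u\<close> to \<open>v\<close> is in cell \<open>u * n + v\<close> of the array \<open>orient\<close>.
\<close>

definition stored_orientation :: "nat \<Rightarrow> state \<Rightarrow> nat \<Rightarrow> nat \<Rightarrow> nat" where
  "stored_orientation n s u v = nmem s ''orient'' (u * n + v)"

fun apply_operation :: "graph \<Rightarrow> operation \<Rightarrow> graph" where
  "apply_operation G (Insert u v) = add_mset {u, v} G"
| "apply_operation G (Delete u v) = G - {#{u, v}#}"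
| "apply_operation G Report = G"

definition graph_after :: "operation list \<Rightarrow> graph" where
  "graph_after ps = foldl apply_operation {#} ps"

fun operation_ok :: "nat \<Rightarrow> graph \<Rightarrow> operation \<Rightarrow> bool" where
  "operation_ok n G (Insert u v) \<longleftrightarrow> u < n \<and> v < n \<and> u \<noteq> v"
| "operation_ok n G (Delete u v) \<longleftrightarrow> {u, v} \<in># G"
| "operation_ok n G Report \<longleftrightarrow> True"

text \<open>
  Parallel edges are allowed as long as all possible loads are at most \<open>(n W)\<^sup>k\<close> at all times.
  Simple graphs satisfy this with \<open>k = 1\<close>, see \<open>simple_graph_loads\<close> below.
\<close>

definition loads_bounded :: "nat \<Rightarrow> (nat \<Rightarrow> real) \<Rightarrow> nat \<Rightarrow> graph \<Rightarrow> bool" where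
  "loads_bounded n w k G \<longleftrightarrow>
     (\<forall>R. orientation n G R \<longrightarrow> max_load n w R \<le> (real n * max_weight n w) ^ k)"

definition admissible :: "nat \<Rightarrow> (nat \<Rightarrow> real) \<Rightarrow> nat \<Rightarrow> operation list \<Rightarrow> bool" where
  "admissible n w k ps \<longleftrightarrow>
     (\<forall>i<length ps. operation_ok n (graph_after (take i ps)) (ps ! i)) \<and>
     (\<forall>i\<le>length ps. loads_bounded n w k (graph_after (take i ps)))"

lemma simple_graph_loads:
  assumes "n \<ge> 1" and w: "\<forall>v<n. 1 \<le> w v" and simple: "\<forall>e. count G e \<le> 1"
  shows "loads_bounded n w 1 G"
  unfolding loads_bounded_def
proof (intro allI impI)
  fix R assume R: "orientation n G R"
  have W: "1 \<le> max_weight n w"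
    unfolding max_weight_def using w \<open>n \<ge> 1\<close>
    by (intro order_trans[OF _ Max_ge[of _ "w 0"]]) auto
  have "load n w R v \<le> real n * max_weight n w" if v: "v < n" for v
  proof -
    have "R u v \<le> 1" if u: "u < n" for u
    proof (cases "u = v")
      case True
      then show ?thesis using R v unfolding orientation_def by simp
    next
      case False
      then have "R u v + R v u = count G {u, v}"
        using R u v unfolding orientation_def by blast
      then show ?thesis using simple[rule_format, of "{u, v}"] by linarith
    qed
    then have "in_degree n R v \<le> n"
      unfolding in_degree_def using sum_mono[of "{..<n}" "\<lambda>u. R u v" "\<lambda>_. 1"] by simp
    moreover have wv: "1 \<le> w v"
      using w v by blast
    ultimately have "load n w R v \<le> real n / w v"
      unfolding load_def by (intro divide_right_mono) auto
    also have "\<dots> \<le> real n / 1"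
      using wv by (intro divide_left_mono) auto
    also have "\<dots> = real n * 1"
      by simp
    also have "\<dots> \<le> real n * max_weight n w"
      using W by (intro mult_left_mono) auto
    finally show ?thesis .
  qed
  then show "max_load n w R \<le> (real n * max_weight n w) ^ 1"
    unfolding max_load_def using \<open>n \<ge> 1\<close>
    by (intro iffD2[OF Max_le_iff]) (auto simp: lessThan_empty_iff)
qed

end

theory Submission
  imports Defs
begin

text \<open>
  Let \<open>L = log (n W)\<close>, \<open>s \<approx> 1000 L / \<epsilon>\<^sup>2\<close> and \<open>\<tau> 0 = 0\<close>, \<open>\<tau> (i + 1) = (1 + 2 / s) \<tau> i + 2\<close>. A vertex has level
  \<open>i\<close> if its load lies in \<open>[\<tau> i, \<tau> (i + 1))\<close>. Every directed edge stores a level of its head that is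
  at most \<open>2\<close> off and at most \<open>3\<close> above the level of its tail. Hence an edge directed into
  \<open>S t = {v. t \<le> level v}\<close> has both ends in \<open>S (t - 5)\<close>, and the density of \<open>S (t - 5)\<close> is at least
  \<open>\<tau> t w (S t) / w (S (t - 5))\<close>. Descend from the top level in steps of \<open>5\<close> while the weight grows by
  a factor above \<open>1 + \<epsilon> / 4\<close>. This ends after \<open>O(L / \<epsilon>)\<close> steps, at a level whose \<open>\<tau>\<close> has
  dropped only by a factor \<open>1 - O(\<epsilon>)\<close> and \<open>O(L / \<epsilon>)\<close>. Since densities are at most
  \<open>OPT\<close> and, by weak duality, \<open>OPT\<close> is at most the maximum load, both guarantees follow.

  An inserted edge is directed to its end of lower level. If some edge into the vertex \<open>c\<close> whose degree
  is to grow has a tail that is too low, it is flipped and the growth is passed on to that tail;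
  otherwise the stored level is refreshed, at the expense of an allowance of \<open>c\<close> that is reset to \<open>s\<close>
  only when the degree of \<open>c\<close> grows. A deletion is passed on along edges whose head is too high,
  and finally refreshes \<open>s\<close> edges. Levels are strictly monotone along such a chain, and there are
  \<open>M = O(s L)\<close> levels. An update thus costs \<open>O(M s)\<close>, and \<open>O(M + s)\<close> amortized, with the sum of the
  allowances as potential.
\<close>



subsection \<open>Total correctness with running times\<close>

text \<open>The obstacle is that a vertex whose level changes would have to refile all its incoming
  edges at once. Hence stored levels may lag behind, and the thresholds are spaced so that the lag
  is repaired in time: to cross level i, a vertex of weight w must change its degree by 2 w (tau i /
  s + 1), and refiling s edges per unit then reaches all edges that enter it. Oscillation around one
  threshold is harmless because stored levels may err by 2. The spacing costs a factor 1 + 2 / s per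
  level, so over the O(L / \<epsilon>) levels crossed by the descent a loss of O(\<epsilon>) forces
  s to be of order L / \<epsilon>^2.

  The two updates are not symmetric. An insertion learns whether a tail is too low only by
  inspecting a stale edge, so it may inspect up to s edges at every vertex of its chain; allowances
  charge these inspections to earlier insertions. A deletion finds the edge to flip directly, as one
  filed exactly three levels above its tail, and inspects stale edges only where its chain
  ends.\<close>

definition runs :: "nat \<Rightarrow> com \<Rightarrow> state \<Rightarrow> (nat \<Rightarrow> state \<Rightarrow> bool) \<Rightarrow> bool" where
  "runs b c s Q \<longleftrightarrow> (\<exists>t s'. exec (real b) c s t s' \<and> Q t s')"

lemma runsI: "exec (real b) c s t s' \<Longrightarrow> Q t s' \<Longrightarrow> runs b c s Q"
  by (auto simp: runs_def)

lemma runs_mono: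
  assumes "runs b c s Q" and "\<And>t s'. Q t s' \<Longrightarrow> Q' t s'"
  shows "runs b c s Q'"
  using assms by (auto simp: runs_def)

text \<open>Execution is deterministic, so the existential in \<open>runs\<close> loses nothing and
  these rules can be equivalences. As rewrite rules they turn straight-line code into its weakest
  precondition, the running time being the first argument of the postcondition.\<close>

lemma runs_Skip: "runs b Skip s Q \<longleftrightarrow> Q 1 s"
  unfolding runs_def by (metis exec_Skip exec_deterministic)

lemma runs_NPut: "runs b (NPut x i e) s Q \<longleftrightarrow>
    nval i s \<le> b \<and> nval e s \<le> b \<and> Q 1 (nput x (nval i s) (nval e s) s)"
  unfolding runs_def by (force elim: exec_NPutE intro: exec_NPut)

lemma runs_RPut: "runs b (RPut x i a) s Q \<longleftrightarrow>
    nval i s \<le> b \<and> Q 1 (rput x (nval i s) (rval a s) s)"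
  unfolding runs_def by (force elim: exec_RPutE intro: exec_RPut)

lemma runs_Emit: "runs b (Emit e) s Q \<longleftrightarrow>
    nval e s \<le> b \<and> Q 1 (s\<lparr>written := written s @ [nval e s]\<rparr>)"
  unfolding runs_def by (force elim: exec_EmitE intro: exec_Emit)

lemma runs_Sequ: "runs b (Sequ c1 c2) s Q \<longleftrightarrow>
    runs b c1 s (\<lambda>t1 s1. runs b c2 s1 (\<lambda>t2. Q (t1 + t2)))"
proof
  assume "runs b (Sequ c1 c2) s Q"
  then obtain t s' where "exec (real b) (Sequ c1 c2) s t s'" "Q t s'"
    by (auto simp: runs_def)
  then show "runs b c1 s (\<lambda>t1 s1. runs b c2 s1 (\<lambda>t2. Q (t1 + t2)))"
    by (auto elim!: exec_SequE simp: runs_def)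
next
  assume "runs b c1 s (\<lambda>t1 s1. runs b c2 s1 (\<lambda>t2. Q (t1 + t2)))"
  then show "runs b (Sequ c1 c2) s Q"
    unfolding runs_def by (auto intro: exec_Sequ)
qed

lemma runs_IfThen: "runs b (IfThen g c1 c2) s Q \<longleftrightarrow>
    (if bval g s then runs b c1 s (\<lambda>t. Q (1 + t)) else runs b c2 s (\<lambda>t. Q (1 + t)))"
proof
  assume "runs b (IfThen g c1 c2) s Q"
  then obtain t s' where "exec (real b) (IfThen g c1 c2) s t s'" "Q t s'"
    by (auto simp: runs_def)
  then show "if bval g s then runs b c1 s (\<lambda>t. Q (1 + t)) else runs b c2 s (\<lambda>t. Q (1 + t))"
    by (auto elim!: exec_IfThenE simp: runs_def)
next
  assume "if bval g s then runs b c1 s (\<lambda>t. Q (1 + t)) else runs b c2 s (\<lambda>t. Q (1 + t))"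
  then show "runs b (IfThen g c1 c2) s Q"
    unfolding runs_def by (auto split: if_splits intro: exec_IfTrue[simplified] exec_IfFalse[simplified])
qed

text \<open>Keeps the simplifier from evaluating continuations on symbolic states.\<close>

lemma runs_cong [cong]: "c = c' \<Longrightarrow> s = s' \<Longrightarrow> runs b c s Q = runs b c' s' Q"
  by simp

lemmas runs_simps = runs_Skip runs_NPut runs_RPut runs_Emit runs_Sequ runs_IfThen

text \<open>The invariant \<open>I\<close> sees the time spent so far, which allows several time bounds at once.\<close>

lemma runs_While:
  fixes f :: "state \<Rightarrow> nat"
  assumes "I t s"
    and step: "\<And>t s. I t s \<Longrightarrow> bval g s \<Longrightarrow>
      runs b c s (\<lambda>t' s'. I (1 + t + t') s' \<and> f s' < f s)"
    and exit: "\<And>t s. I t s \<Longrightarrow> \<not> bval g s \<Longrightarrow> Q (t + 1) s"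
  shows "runs b (WhileDo g c) s (\<lambda>t'. Q (t + t'))"
  using assms(1)
proof (induction "f s" arbitrary: s t rule: less_induct)
  case less
  show ?case
  proof (cases "bval g s")
    case False
    then show ?thesis
      using exit[OF less.prems] exec_WhileFalse by (auto intro!: runsI)
  next
    case True
    then obtain t1 s1 where 1: "exec (real b) c s t1 s1" "I (1 + t + t1) s1" "f s1 < f s"
      using step[OF less.prems True] by (auto simp: runs_def)
    then obtain t2 s2 where 2: "exec (real b) (WhileDo g c) s1 t2 s2" "Q (1 + t + t1 + t2) s2"
      using less.hyps[OF 1(3,2)] by (auto simp: runs_def)
    show ?thesis
      by (rule runsI[OF exec_WhileTrue[OF True 1(1) 2(1)]]) (use 2(2) in \<open>simp add: ac_simps\<close>)
  qed
qed

text \<open>The constructions use a natural number \<open>b\<close> as word bound; this transfers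
  their runs to the real bound of the theorem.\<close>

lemma exec_mono: "exec B c s t s' \<Longrightarrow> B \<le> B' \<Longrightarrow> exec B' c s t s'"
  by (induction rule: exec.induct) (auto intro: exec.intros[simplified])

lemma nput_simps [simp]:
  "nmem (nput x i a s) y = (if y = x then (nmem s x)(i := a) else nmem s y)"
  "rmem (nput x i a s) = rmem s" "written (nput x i a s) = written s"
  by (simp_all add: nput_def)

lemma rput_simps [simp]:
  "rmem (rput x i a s) y = (if y = x then (rmem s x)(i := a) else rmem s y)"
  "nmem (rput x i a s) = nmem s" "written (rput x i a s) = written s"
  by (simp_all add: rput_def)

text \<open>\<open>X\<close> and \<open>Y\<close> are the word and real arrays that may have
  changed. The output must stay the same, so \<open>report\<close> is not covered by
  \<open>frame\<close>.\<close>

definition frame :: "string set \<Rightarrow> string set \<Rightarrow> state \<Rightarrow> state \<Rightarrow> bool" where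
  "frame X Y s s' \<longleftrightarrow> (\<forall>x. x \<notin> X \<longrightarrow> nmem s' x = nmem s x) \<and>
     (\<forall>x. x \<notin> Y \<longrightarrow> rmem s' x = rmem s x) \<and> written s' = written s"

lemma frame_nmem: "frame X Y s s' \<Longrightarrow> x \<notin> X \<Longrightarrow> nmem s' x = nmem s x"
  and frame_rmem: "frame X Y s s' \<Longrightarrow> y \<notin> Y \<Longrightarrow> rmem s' y = rmem s y"
  by (simp_all add: frame_def)

lemma frame_refl: "frame X Y s s"
  by (simp add: frame_def)

lemma frame_nput: "x \<in> X \<Longrightarrow> frame X Y s s' \<Longrightarrow> frame X Y s (nput x i a s')"
  and frame_rput: "y \<in> Y \<Longrightarrow> frame X Y s s' \<Longrightarrow> frame X Y s (rput y i z s')"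
  by (auto simp: frame_def)

lemma frame_trans: "frame X Y s s' \<Longrightarrow> frame X' Y' s' s'' \<Longrightarrow> X \<subseteq> Z \<Longrightarrow> X' \<subseteq> Z
    \<Longrightarrow> Y \<subseteq> Z' \<Longrightarrow> Y' \<subseteq> Z' \<Longrightarrow> frame Z Z' s s''"
  unfolding frame_def by (metis subsetD)

abbreviation V :: "string \<Rightarrow> nexp" where
  "V x \<equiv> NGet x (NLit 0)"

abbreviation assign :: "string \<Rightarrow> nexp \<Rightarrow> com" where
  "assign x e \<equiv> NPut x (NLit 0) e"

fun block :: "com list \<Rightarrow> com" where
  "block [] = Skip"
| "block [c] = c"
| "block (c # cs) = Sequ c (block cs)"


subsection \<open>Buckets of directed edges\<close>

text \<open>
  Bucket \<open>k\<close> consists of the cells \<open>k * n, \<dots>, k * n + cnt k - 1\<close> of \<open>arr\<close>; removing an item moves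
  the last item of its bucket into the gap.
\<close>

definition bucket_rep ::
  "nat \<Rightarrow> (nat \<Rightarrow> nat) \<Rightarrow> (nat \<Rightarrow> nat) \<Rightarrow> (nat \<Rightarrow> nat) \<Rightarrow> nat set \<Rightarrow> (nat \<Rightarrow> nat) \<Rightarrow> bool" where
  "bucket_rep n cnt arr pos A key \<longleftrightarrow>
     (\<forall>e\<in>A. pos e < cnt (key e) \<and> arr (key e * n + pos e) = e) \<and>
     (\<forall>k. cnt k \<le> n) \<and>
     (\<forall>k i. i < cnt k \<longrightarrow>
        arr (k * n + i) \<in> A \<and> key (arr (k * n + i)) = k \<and> pos (arr (k * n + i)) = i)"

lemma bucket_address_inj:
  fixes n :: nat
  assumes "k * n + i = k' * n + i'" "i < n" "i' < n"
  shows "k = k'" "i = i'"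
proof -
  have "(k * n + i) div n = k" "(k' * n + i') div n = k'" using assms(2,3) by auto
  with assms(1) show "k = k'" by simp
  with assms(1) show "i = i'" by simp
qed

text \<open>\<open>arr\<close> and \<open>pos\<close> are mutually inverse on a bucket. Together
  with \<open>bucket_room\<close> this shows that no bucket overflows into the next one.\<close>

lemma bucket_rep_card:
  assumes "bucket_rep n cnt arr pos A key"
  shows "cnt k = card {e \<in> A. key e = k}"
proof -
  have "bij_betw (\<lambda>i. arr (k * n + i)) {..<cnt k} {e \<in> A. key e = k}"
    using assms unfolding bucket_rep_def
    by (intro bij_betw_byWitness[where f' = pos]) auto
  then show ?thesis
    using bij_betw_same_card by fastforce
qed

lemma bucket_rep_push:
  assumes rep: "bucket_rep n cnt arr pos A key" and e: "e \<notin> A" and room: "cnt k < n"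
  shows "bucket_rep n (cnt(k := Suc (cnt k))) (arr(k * n + cnt k := e)) (pos(e := cnt k))
    (insert e A) (key(e := k))"
proof -
  have le: "cnt k' \<le> n" for k' using rep by (auto simp: bucket_rep_def)
  have ne: "k' * n + i \<noteq> k * n + cnt k" if "i < cnt k'" for i k'
    using bucket_address_inj[of k' n i k "cnt k"] that room le[of k'] by fastforce
  show ?thesis
    unfolding bucket_rep_def
  proof (intro conjI allI impI ballI)
    fix k' i assume i: "i < (cnt(k := Suc (cnt k))) k'"
    consider "i < cnt k'" | "k' = k" "i = cnt k"
      using i by (auto simp: less_Suc_eq split: if_splits)
    then show "(arr(k * n + cnt k := e)) (k' * n + i) \<in> insert e A"
      "(key(e := k)) ((arr(k * n + cnt k := e)) (k' * n + i)) = k'"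
      "(pos(e := cnt k)) ((arr(k * n + cnt k := e)) (k' * n + i)) = i"
      by (cases; use rep e ne in \<open>auto simp: bucket_rep_def\<close>)+
  next
    fix k' show "(cnt(k := Suc (cnt k))) k' \<le> n" using le room by auto
  next
    fix x assume x: "x \<in> insert e A"
    show "(pos(e := cnt k)) x < (cnt(k := Suc (cnt k))) ((key(e := k)) x)"
      using x rep by (auto simp: bucket_rep_def less_SucI)
    show "(arr(k * n + cnt k := e)) ((key(e := k)) x * n + (pos(e := cnt k)) x) = x"
      using x rep ne by (auto simp: bucket_rep_def)
  qed
qed

text \<open>The case \<open>l = e\<close>, in which \<open>e\<close> is itself the last item, is
  included: both writes are then void and only the counter changes.\<close>

lemma bucket_rep_remove:
  assumes rep: "bucket_rep n cnt arr pos A key" and e: "e \<in> A" and k: "k = key e"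
    and l: "l = arr (k * n + (cnt k - 1))"
  shows "bucket_rep n (cnt(k := cnt k - 1)) (arr(k * n + pos e := l)) (pos(l := pos e))
    (A - {e}) key"
proof -
  have le: "cnt k' \<le> n" for k' using rep by (auto simp: bucket_rep_def)
  have pe: "pos e < cnt k" "arr (k * n + pos e) = e" using rep e k by (auto simp: bucket_rep_def)
  have items: "arr (k' * n + i) \<in> A" "key (arr (k' * n + i)) = k'" "pos (arr (k' * n + i)) = i"
    if "i < cnt k'" for k' i using rep that by (auto simp: bucket_rep_def)
  have last: "l \<in> A" "key l = k" "pos l = cnt k - 1"
    using items[of "cnt k - 1" k] l pe(1) by simp_all
  have item_pos: "pos x < cnt (key x)" "arr (key x * n + pos x) = x" if "x \<in> A" for x
    using rep that by (auto simp: bucket_rep_def)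
  have inj: "k' = k \<and> i = pos e" if "i < cnt k'" "k' * n + i = k * n + pos e" for i k'
    using bucket_address_inj[OF that(2)] that(1) pe(1) le[of k'] le[of k] by fastforce
  show ?thesis
    unfolding bucket_rep_def
  proof (intro conjI allI impI ballI)
    fix k' show "(cnt(k := cnt k - 1)) k' \<le> n" using le[of k'] le[of k] by auto
  next
    fix x assume x: "x \<in> A - {e}"
    show "(pos(l := pos e)) x < (cnt(k := cnt k - 1)) (key x)"
    proof (cases "x = l")
      case True
      then have "pos e \<noteq> cnt k - 1" using x last pe by (metis Diff_iff insertI1 item_pos(2))
      then show ?thesis using True pe last by auto
    next
      case False
      have "pos x \<noteq> cnt k - 1" if "key x = k"
        using that False item_pos[of x] l x by auto
      then show ?thesis
        using False x item_pos[of x] by (cases "key x = k") auto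
    qed
    show "(arr(k * n + pos e := l)) (key x * n + (pos(l := pos e)) x) = x"
      using x item_pos[of x] last inj[of "pos x" "key x"] pe by (auto)
  next
    fix k' i assume i: "i < (cnt(k := cnt k - 1)) k'"
    then have i': "i < cnt k'" by (auto split: if_splits)
    \<comment> \<open>\<open>pos\<close> recovers the slot of an item, and the last slot has been
      cut off. Hence \<open>l\<close> is met only in the refilled slot, where its new position is
      correct.\<close>
    have nl: "arr (k' * n + i) \<noteq> l"
      using i items[OF i'] last by (auto split: if_splits)
    show "(arr(k * n + pos e := l)) (k' * n + i) \<in> A - {e}"
      using k items[OF i'] last i pe inj[OF i'] by (auto split: if_splits)
    show "key ((arr(k * n + pos e := l)) (k' * n + i)) = k'"
      using items[OF i'] last inj[OF i'] by auto
    show "(pos(l := pos e)) ((arr(k * n + pos e := l)) (k' * n + i)) = i"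
      using items[OF i'] last inj[OF i'] nl by auto
  qed
qed

section \<open>Constant-time programs on the two families of buckets\<close>

definition mod_exp :: "nexp \<Rightarrow> nexp \<Rightarrow> nexp" where
  "mod_exp a m = NSub a (NMul (NDiv a m) m)"

lemma nval_mod_exp [simp]: "nval (mod_exp a m) s = nval a s mod nval m s"
  by (simp add: mod_exp_def minus_div_mult_eq_mod)

definition bucket_push :: "string \<Rightarrow> string \<Rightarrow> string \<Rightarrow> nexp \<Rightarrow> com" where
  "bucket_push cnt arr pos k = block
    [NPut pos (V ''e'') (NGet cnt k),
     NPut arr (NAdd (NMul k (V ''n'')) (NGet cnt k)) (V ''e''),
     NPut cnt k (NAdd (NGet cnt k) (NLit 1))]"

definition bucket_remove :: "string \<Rightarrow> string \<Rightarrow> string \<Rightarrow> nexp \<Rightarrow> com" where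
  "bucket_remove cnt arr pos k = block
    [assign ''l'' (NGet arr (NAdd (NMul k (V ''n'')) (NSub (NGet cnt k) (NLit 1)))),
     NPut arr (NAdd (NMul k (V ''n'')) (NGet pos (V ''e''))) (V ''l''),
     NPut pos (V ''l'') (NGet pos (V ''e'')),
     NPut cnt k (NSub (NGet cnt k) (NLit 1))]"

text \<open>A bucket number encodes a pair of stored level and vertex as
  \<open>level * n + vertex\<close>. Every edge lies in two buckets, one for its tail and one for
  its head, so the edges at a vertex with a given stored level are found in constant time.\<close>

definition out_key :: nexp where
  "out_key = NAdd (NMul (NGet ''K'' (V ''e'')) (V ''n'')) (NDiv (V ''e'') (V ''n''))"

definition in_key :: nexp where
  "in_key = NAdd (NMul (NGet ''K'' (V ''e'')) (V ''n'')) (mod_exp (V ''e'') (V ''n''))"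

definition link :: com where
  "link = Sequ (bucket_push ''oc'' ''oa'' ''op'' out_key) (bucket_push ''ic'' ''ia'' ''ip'' in_key)"

definition unlink :: com where
  "unlink = Sequ (bucket_remove ''oc'' ''oa'' ''op'' out_key) (bucket_remove ''ic'' ''ia'' ''ip'' in_key)"

text \<open>Parallel copies of a directed edge share one bucket item and one stored level; this
  keeps every bucket within \<open>n\<close> cells however large the multiplicities are.\<close>

definition active :: "nat \<Rightarrow> (nat \<Rightarrow> nat) \<Rightarrow> nat set" where
  "active n R = {e. e < n * n \<and> 0 < R e}"

definition linked :: "nat \<Rightarrow> nat set \<Rightarrow> state \<Rightarrow> bool" where
  "linked n A s \<longleftrightarrow>
     bucket_rep n (nmem s ''oc'') (nmem s ''oa'') (nmem s ''op'') A (\<lambda>e. nmem s ''K'' e * n + e div n) \<and>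
     bucket_rep n (nmem s ''ic'') (nmem s ''ia'') (nmem s ''ip'') A (\<lambda>e. nmem s ''K'' e * n + e mod n)"

abbreviation link_arrays :: "string set" where
  "link_arrays \<equiv> {''oc'', ''oa'', ''op'', ''ic'', ''ia'', ''ip'', ''l''}"

lemma card_less_of_missing:
  assumes "finite X" "card X \<le> n" "Y \<subseteq> X" "e \<in> X" "e \<notin> Y"
  shows "card Y < (n::nat)"
  using assms psubset_card_mono[of X Y] by fastforce

text \<open>The items of a bucket agree in one end and thus differ in the other, for which there are
  \<open>n\<close> choices. The absent edge \<open>e\<close> leaves one of them free.\<close>

lemma bucket_room:
  assumes A: "A \<subseteq> {..<n * n}" and e: "e < n * n" "e \<notin> A"
  shows "card {x \<in> A. K x * n + x div n = k * n + e div n} < n"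
    and "card {x \<in> A. K x * n + x mod n = k * n + e mod n} < n"
proof -
  have n: "0 < n" using e by (cases n) auto
  have d: "x div n < n" if "x < n * n" for x using that by (simp add: less_mult_imp_div_less)
  have m: "x mod n < n" for x using n by simp
  show "card {x \<in> A. K x * n + x div n = k * n + e div n} < n"
  proof (rule card_less_of_missing)
    show "{x \<in> A. K x * n + x div n = k * n + e div n} \<subseteq> {x. x < n * n \<and> x div n = e div n}"
      using A d e(1) bucket_address_inj(2)[OF _ d d] by fastforce
    have "inj_on (\<lambda>x. x mod n) {x. x < n * n \<and> x div n = e div n}"
      by (rule inj_onI) (metis (mono_tags, lifting) div_mult_mod_eq mem_Collect_eq)
    then have "card {x. x < n * n \<and> x div n = e div n} \<le> card {..<n}"
      by (rule card_inj_on_le) (use m in auto)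
    then show "card {x. x < n * n \<and> x div n = e div n} \<le> n" by simp
  qed (use e in auto)
  show "card {x \<in> A. K x * n + x mod n = k * n + e mod n} < n"
  proof (rule card_less_of_missing)
    show "{x \<in> A. K x * n + x mod n = k * n + e mod n} \<subseteq> {x. x < n * n \<and> x mod n = e mod n}"
      using A m bucket_address_inj(2)[OF _ m m] by fastforce
    have "inj_on (\<lambda>x. x div n) {x. x < n * n \<and> x mod n = e mod n}"
      by (rule inj_onI) (metis (mono_tags, lifting) div_mult_mod_eq mem_Collect_eq)
    then have "card {x. x < n * n \<and> x mod n = e mod n} \<le> card {..<n}"
      by (rule card_inj_on_le) (use d in auto)
    then show "card {x. x < n * n \<and> x mod n = e mod n} \<le> n" by simp
  qed (use e in auto)
qed

lemma bucket_bound: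
  fixes n :: nat
  assumes "k \<le> M" "u < n" "i < n"
  shows "(k * n + u) * n + i < (M + 1) * n * n" "k * n + u < (M + 1) * n * n"
    "k * n + u < (M + 1) * n"
proof -
  have "k * n + u < (k + 1) * n" using assms by simp
  also have "\<dots> \<le> (M + 1) * n" using assms(1) by (intro mult_right_mono) auto
  finally show 1: "k * n + u < (M + 1) * n" .
  then have "(k * n + u + 1) * n \<le> (M + 1) * n * n"
    by (intro mult_right_mono) auto
  then show 2: "(k * n + u) * n + i < (M + 1) * n * n"
    using assms(3) by (simp only: distrib_right mult_1_left)
  have "k * n + u \<le> (k * n + u) * n"
    using assms(2) by (cases n) auto
  then show "k * n + u < (M + 1) * n * n"
    using 2 by linarith
qed

text \<open>\<open>link\<close> starts after \<open>K e\<close> has been overwritten.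
  \<open>s0\<close> is a state from before that write; since \<open>e\<close> lies in no bucket, its
  new stored level leaves the representation of \<open>A\<close> intact.\<close>

lemma runs_link:
  assumes n: "nmem s ''n'' 0 = n" and e: "nmem s ''e'' 0 = e" "e < n * n" "e \<notin> A"
    and A: "A \<subseteq> {..<n * n}" and K: "nmem s ''K'' e \<le> M" and b: "(M + 1) * n * n \<le> b"
    and s0: "linked n A s0" "frame {''K''} {} s0 s" "\<And>x. x \<noteq> e \<Longrightarrow> nmem s ''K'' x = nmem s0 ''K'' x"
  shows "runs b link s (\<lambda>t s'. t = 6 \<and> linked n (insert e A) s' \<and> frame link_arrays {} s s')"
proof -
  let ?K = "nmem s ''K''" and ?L = "nmem s0 ''K''"
  define u v where "u = e div n" and "v = e mod n"
  have n0: "0 < n" using e by (cases n) auto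
  have u: "u < n" using e by (simp add: u_def less_mult_imp_div_less)
  have v: "v < n" using n0 by (simp add: v_def)
  have out0: "bucket_rep n (nmem s ''oc'') (nmem s ''oa'') (nmem s ''op'') A (\<lambda>e. ?L e * n + e div n)"
    and in0: "bucket_rep n (nmem s ''ic'') (nmem s ''ia'') (nmem s ''ip'') A (\<lambda>e. ?L e * n + e mod n)"
    using s0(1,2) by (simp_all add: linked_def frame_def)
  have room: "nmem s ''oc'' (?K e * n + u) < n" "nmem s ''ic'' (?K e * n + v) < n"
    using bucket_room[OF A e(2,3), of ?L "?K e"] by (simp_all add: u_def v_def bucket_rep_card[OF out0] bucket_rep_card[OF in0])
  have K': "(\<lambda>e. ?L e * n + e div n)(e := ?K e * n + u) = (\<lambda>e. ?K e * n + e div n)"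
    "(\<lambda>e. ?L e * n + e mod n)(e := ?K e * n + v) = (\<lambda>e. ?K e * n + e mod n)"
    using s0(3) by (auto simp: fun_eq_iff u_def v_def)
  note out1 = bucket_rep_push[OF out0 e(3) room(1), unfolded K']
  note in1 = bucket_rep_push[OF in0 e(3) room(2), unfolded K']
  have sq: "n * n \<le> b" using b by (simp add: algebra_simps)
  then have nb: "n \<le> b" using n0 by (metis le_square le_trans)
  have eb: "e \<le> b" using e(2) sq by simp
  have bb: "(?K e * n + u) * n + nmem s ''oc'' (?K e * n + u) \<le> b" "?K e * n + u \<le> b"
    "(?K e * n + v) * n + nmem s ''ic'' (?K e * n + v) \<le> b" "?K e * n + v \<le> b"
    using bucket_bound(1)[OF K u room(1)] bucket_bound(2)[OF K u room(1)]
      bucket_bound(1)[OF K v room(2)] bucket_bound(2)[OF K v room(2)] b by linarith+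
  show ?thesis
    unfolding link_def bucket_push_def
    apply (simp add: runs_simps out_key_def in_key_def n e u_def[symmetric] v_def[symmetric])
    apply (simp add: linked_def frame_def)
    using out1 in1 eb bb room nb
    by - (intro conjI; (assumption | linarith))
qed

text \<open>The key expression is evaluated again by later assignments of the program, so it must
  keep its value under the writes made in between.\<close>

lemma runs_bucket_remove:
  assumes dist: "distinct [cnt, arr, pos, ''l'', ''n'', ''e'']"
    and key: "\<And>s'. frame {arr, pos, ''l''} {} s s' \<Longrightarrow> nval k s' = \<kappa>"
    and n: "nmem s ''n'' 0 = n" and e: "nmem s ''e'' 0 = e" "e \<in> A" "f e = \<kappa>"
    and rep: "bucket_rep n (nmem s cnt) (nmem s arr) (nmem s pos) A f"
    and b: "\<And>x. x \<in> A \<Longrightarrow> x \<le> b" "\<kappa> \<le> b" "\<And>i. i < n \<Longrightarrow> \<kappa> * n + i \<le> b" "n \<le> b"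
  shows "runs b (bucket_remove cnt arr pos k) s (\<lambda>t s'. t = 4 \<and>
    bucket_rep n (nmem s' cnt) (nmem s' arr) (nmem s' pos) (A - {e}) f \<and>
    frame {cnt, arr, pos, ''l''} {} s s')"
proof -
  define l where "l = nmem s arr (\<kappa> * n + (nmem s cnt \<kappa> - 1))"
  note rep' = bucket_rep_remove[OF rep e(2) e(3)[symmetric] l_def]
  have pos: "nmem s pos e < nmem s cnt \<kappa>" "nmem s cnt \<kappa> \<le> n"
    using rep e unfolding bucket_rep_def by auto
  have last: "l \<in> A"
    using rep pos unfolding bucket_rep_def l_def by (metis One_nat_def Suc_pred gr_zeroI lessI not_less0)
  have ne: "cnt \<noteq> arr" "cnt \<noteq> pos" "arr \<noteq> cnt" "arr \<noteq> pos" "pos \<noteq> cnt" "pos \<noteq> arr"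
    "cnt \<noteq> ''l''" "arr \<noteq> ''l''" "pos \<noteq> ''l''" "''l'' \<noteq> cnt" "''l'' \<noteq> arr" "''l'' \<noteq> pos"
    "''n'' \<noteq> cnt" "''n'' \<noteq> arr" "''n'' \<noteq> pos" "''e'' \<noteq> cnt" "''e'' \<noteq> arr" "''e'' \<noteq> pos"
    using dist by auto
  have bb: "l \<le> b" "\<kappa> * n + nmem s pos e \<le> b" "nmem s pos e \<le> b" "nmem s cnt \<kappa> - 1 \<le> b"
    using b(1)[OF last] b(3)[of "nmem s pos e"] b(4) pos by linarith+
  show ?thesis
    apply (simp add: bucket_remove_def runs_simps n e(1) key frame_nput frame_refl ne)
    apply (fold One_nat_def, fold l_def)
    using rep' b(2) bb
    by - (intro conjI; assumption)
qed

lemma runs_unlink: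
  assumes n: "nmem s ''n'' 0 = n" and e: "nmem s ''e'' 0 = e" "e \<in> A"
    and A: "A \<subseteq> {..<n * n}" and K: "nmem s ''K'' e \<le> M" and b: "(M + 1) * n * n \<le> b"
    and s0: "linked n A s"
  shows "runs b unlink s (\<lambda>t s'. t = 8 \<and> linked n (A - {e}) s' \<and> frame link_arrays {} s s')"
proof -
  let ?K = "nmem s ''K''"
  define u v where "u = e div n" and "v = e mod n"
  have e': "e < n * n" using e A by auto
  have n0: "0 < n" using e' by (cases n) auto
  have u: "u < n" using e' by (simp add: u_def less_mult_imp_div_less)
  have v: "v < n" using n0 by (simp add: v_def)
  have out0: "bucket_rep n (nmem s ''oc'') (nmem s ''oa'') (nmem s ''op'') A (\<lambda>e. ?K e * n + e div n)"
    and in0: "bucket_rep n (nmem s ''ic'') (nmem s ''ia'') (nmem s ''ip'') A (\<lambda>e. ?K e * n + e mod n)"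
    using s0 by (simp_all add: linked_def)
  have sq: "n * n \<le> b" using b by (simp add: algebra_simps)
  then have nb: "n \<le> b" using n0 by (metis le_square le_trans)
  have eb: "x \<le> b" if "x \<in> A" for x using that A sq by auto
  have bb: "?K e * n + u \<le> b" "?K e * n + v \<le> b"
    "(?K e * n + u) * n + i \<le> b" "(?K e * n + v) * n + i \<le> b" if "i < n" for i
    using bucket_bound(1,2)[OF K u that] bucket_bound(1,2)[OF K v that] b by linarith+
  have keys: "nval out_key s' = ?K e * n + u" "nval in_key s' = ?K e * n + v"
    if "frame link_arrays {} s s'" for s'
    using that by (simp_all add: frame_def out_key_def in_key_def n e u_def v_def)
  have "runs b (bucket_remove ''oc'' ''oa'' ''op'' out_key) s (\<lambda>t s1. t = 4 \<and>
      bucket_rep n (nmem s1 ''oc'') (nmem s1 ''oa'') (nmem s1 ''op'') (A - {e}) (\<lambda>e. ?K e * n + e div n) \<and>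
      frame {''oc'', ''oa'', ''op'', ''l''} {} s s1)"
    by (rule runs_bucket_remove[OF _ keys(1) n e _ out0])
      (use n0 nb eb bb in \<open>auto simp: frame_def u_def\<close>)
  then show ?thesis
    unfolding unlink_def runs_Sequ
  proof (rule runs_mono, elim conjE)
    fix t s1
    assume t: "t = (4::nat)" and out1: "bucket_rep n (nmem s1 ''oc'') (nmem s1 ''oa'') (nmem s1 ''op'')
        (A - {e}) (\<lambda>e. ?K e * n + e div n)"
      and fr: "frame {''oc'', ''oa'', ''op'', ''l''} {} s s1"
    have eqs: "nmem s1 ''n'' 0 = n" "nmem s1 ''e'' 0 = e" "nmem s1 ''K'' = ?K"
      "nmem s1 ''ic'' = nmem s ''ic''" "nmem s1 ''ia'' = nmem s ''ia''" "nmem s1 ''ip'' = nmem s ''ip''"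
      using fr n e by (simp_all add: frame_def)
    have "runs b (bucket_remove ''ic'' ''ia'' ''ip'' in_key) s1 (\<lambda>t s2. t = 4 \<and>
      bucket_rep n (nmem s2 ''ic'') (nmem s2 ''ia'') (nmem s2 ''ip'') (A - {e}) (\<lambda>e. ?K e * n + e mod n) \<and>
      frame {''ic'', ''ia'', ''ip'', ''l''} {} s1 s2)"
      by (rule runs_bucket_remove[OF _ _ eqs(1,2) e(2), where \<kappa> = "?K e * n + v"])
        (use n0 nb eb bb in0 eqs keys(2) fr in \<open>auto simp: frame_def v_def\<close>)
    then show "runs b (bucket_remove ''ic'' ''ia'' ''ip'' in_key) s1
      (\<lambda>t2 s'. t + t2 = 8 \<and> linked n (A - {e}) s' \<and> frame link_arrays {} s s')"
      by (rule runs_mono) (use t out1 fr in \<open>auto simp: linked_def frame_def\<close>)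
  qed
qed

lemma runs_SequI:
  assumes "runs b c1 s Q1" and "\<And>t1 s1. Q1 t1 s1 \<Longrightarrow> runs b c2 s1 (\<lambda>t2. Q (t1 + t2))"
  shows "runs b (Sequ c1 c2) s Q"
  unfolding runs_Sequ using assms by (rule runs_mono)

section \<open>Adding, removing and refiling directed edges\<close>

definition add_edge :: "string \<Rightarrow> string \<Rightarrow> com" where
  "add_edge p q = block
    [assign ''e'' (NAdd (NMul (V p) (V ''n'')) (V q)),
     IfThen (NLess (NLit 0) (NGet ''orient'' (V ''e''))) Skip
       (Sequ (NPut ''K'' (V ''e'') (NGet ''lev'' (V q))) link),
     NPut ''orient'' (V ''e'') (NAdd (NGet ''orient'' (V ''e'')) (NLit 1))]"

definition del_edge :: com where
  "del_edge = block
    [NPut ''orient'' (V ''e'') (NSub (NGet ''orient'' (V ''e'')) (NLit 1)),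
     IfThen (NLess (NLit 0) (NGet ''orient'' (V ''e''))) Skip unlink]"

text \<open>The bucket numbers depend on \<open>K e\<close>, so the edge has to leave its buckets
  before \<open>K e\<close> changes.\<close>

definition relevel :: com where
  "relevel = block [unlink, NPut ''K'' (V ''e'') (V ''j''), link]"

lemma linked_frame:
  assumes "linked n A s" "frame X Y s s'" "X \<inter> ({''K''} \<union> link_arrays) \<subseteq> {''l''}"
  shows "linked n A s'"
proof -
  have "nmem s' x = nmem s x" if "x \<in> {''K'', ''oc'', ''oa'', ''op'', ''ic'', ''ia'', ''ip''}" for x
    using assms(2,3) that by (intro frame_nmem[OF assms(2)]) auto
  then show ?thesis using assms(1) by (simp add: linked_def)
qed

lemma active_subset: "active n R \<subseteq> {..<n * n}"
  by (auto simp: active_def)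

lemma edge_less: "u < n \<Longrightarrow> v < n \<Longrightarrow> u * n + v < n * (n :: nat)"
proof -
  assume "u < n" "v < n"
  then have "u * n + v < (u + 1) * n" by simp
  also have "\<dots> \<le> n * n" using \<open>u < n\<close> by (intro mult_right_mono) auto
  finally show ?thesis .
qed

lemma square_le_bound:
  assumes "(M + 1) * n * n \<le> (b :: nat)"
  shows "n * n \<le> b" "n \<le> b"
proof -
  show 1: "n * n \<le> b" using assms by (simp add: algebra_simps)
  show "n \<le> b" using 1 by (cases "n = 0") (metis le_square le_trans)+
qed

lemma runs_add_edge:
  assumes n: "nmem s ''n'' 0 = n" and pq: "p \<in> {''x'', ''c''}" "q \<in> {''x'', ''c''}"
    and xy: "nmem s p 0 = x" "nmem s q 0 = y" "x < n" "y < n"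
    and R: "R = nmem s ''orient''" and lk: "linked n (active n R) s"
    and lev: "nmem s ''lev'' y \<le> M" and b: "(M + 1) * n * n \<le> b" "Suc (R (x * n + y)) \<le> b" "M \<le> b"
  shows "runs b (add_edge p q) s (\<lambda>t s'. t \<le> 10 \<and>
    nmem s' ''orient'' = R(x * n + y := Suc (R (x * n + y))) \<and>
    nmem s' ''K'' = (if R (x * n + y) = 0 then (nmem s ''K'')(x * n + y := nmem s ''lev'' y) else nmem s ''K'') \<and>
    linked n (active n (nmem s' ''orient'')) s' \<and>
    frame ({''orient'', ''K'', ''e''} \<union> link_arrays) {} s s')"
proof -
  define e where "e = x * n + y"
  have e: "e < n * n" using edge_less[OF xy(3,4)] by (simp add: e_def)
  have eb: "e \<le> b" "0 \<le> b" using e square_le_bound[OF b(1)] by auto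
  define s1 where "s1 = nput ''e'' 0 e s"
  have s1: "nmem s1 ''n'' 0 = n" "nmem s1 ''orient'' = R" "nmem s1 ''e'' 0 = e"
    "nmem s1 ''lev'' = nmem s ''lev''" "nmem s1 q 0 = y" "linked n (active n R) s1"
    "nmem s1 ''K'' = nmem s ''K''" "frame {''e''} {} s s1"
    using pq n R lk xy by (auto simp: s1_def linked_def frame_def)
  let ?mid = "\<lambda>t s'. t \<le> 8 \<and> nmem s' ''orient'' = R \<and> nmem s' ''e'' 0 = e \<and>
     nmem s' ''K'' = (if R e = 0 then (nmem s ''K'')(e := nmem s ''lev'' y) else nmem s ''K'') \<and>
     linked n (insert e (active n R)) s' \<and> frame ({''K''} \<union> link_arrays) {} s1 s'"
  have mid: "runs b (IfThen (NLess (NLit 0) (NGet ''orient'' (V ''e''))) Skip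
       (Sequ (NPut ''K'' (V ''e'') (NGet ''lev'' (V q))) link)) s1 ?mid"
  proof (cases "R e = 0")
    case False
    then have "insert e (active n R) = active n R" using e by (auto simp: active_def)
    then show ?thesis
      using False s1 by (simp add: runs_simps frame_refl)
  next
    case True
    define s2 where "s2 = nput ''K'' e (nmem s ''lev'' y) s1"
    have s2: "nmem s2 ''n'' 0 = n" "nmem s2 ''e'' 0 = e" "frame {''K''} {} s1 s2"
      "nmem s2 ''K'' = (nmem s ''K'')(e := nmem s ''lev'' y)" "nmem s2 ''orient'' = R"
      using s1 by (auto simp: s2_def frame_def)
    have "runs b link s2 (\<lambda>t s'. t = 6 \<and> linked n (insert e (active n R)) s' \<and> frame link_arrays {} s2 s')"
      by (rule runs_link[OF s2(1,2) e _ active_subset _ b(1) s1(6) s2(3)])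
        (use True s2 s1 lev in \<open>auto simp: active_def\<close>)
    then have *: "runs b link s2 (\<lambda>t s'. ?mid (2 + t) s')"
      by (rule runs_mono) (use s2 True in \<open>auto simp: frame_def\<close>)
    show ?thesis
      using True s1 eb lev b(3)
      by (simp add: runs_simps, fold s2_def) (rule runs_mono[OF *], simp)
  qed
  have act: "insert e (active n R) = active n (R(e := Suc (R e)))"
    using e by (auto simp: active_def)
  have fin: "runs b (NPut ''orient'' (V ''e'') (NAdd (NGet ''orient'' (V ''e'')) (NLit 1))) s2
     (\<lambda>t' s'. 1 + (t + t') \<le> 10 \<and> nmem s' ''orient'' = R(e := Suc (R e)) \<and>
      nmem s' ''K'' = (if R e = 0 then (nmem s ''K'')(e := nmem s ''lev'' y) else nmem s ''K'') \<and>
      linked n (active n (nmem s' ''orient'')) s' \<and>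
      frame ({''orient'', ''K'', ''e''} \<union> link_arrays) {} s s')"
    if m: "?mid t s2" for t s2
  proof -
    define s3 where "s3 = nput ''orient'' e (Suc (R e)) s2"
    have m': "t \<le> 8" "nmem s2 ''orient'' = R" "nmem s2 ''e'' 0 = e"
      "nmem s2 ''K'' = (if R e = 0 then (nmem s ''K'')(e := nmem s ''lev'' y) else nmem s ''K'')"
      "linked n (insert e (active n R)) s2" "frame ({''K''} \<union> link_arrays) {} s1 s2"
      using m by blast+
    have s3: "frame {''orient''} {} s2 s3" "nmem s3 ''orient'' = R(e := Suc (R e))"
      "nmem s3 ''K'' = nmem s2 ''K''"
      using m'(2) by (simp_all add: s3_def frame_nput frame_refl)
    have "linked n (insert e (active n R)) s3"
      by (rule linked_frame[OF m'(5) s3(1)]) auto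
    then have "linked n (active n (nmem s3 ''orient'')) s3"
      by (simp only: act s3(2))
    moreover have "frame ({''orient'', ''K'', ''e''} \<union> link_arrays) {} s s3"
      using s1(8) m'(6) s3(1) unfolding frame_def by simp
    moreover have "nval (V ''e'') s2 = e"
      "nval (NAdd (NGet ''orient'' (V ''e'')) (NLit 1)) s2 = Suc (R e)"
      using m' by simp_all
    moreover have "Suc (R e) \<le> b"
      using b(2) by (simp add: e_def)
    ultimately show ?thesis
      unfolding runs_NPut using eb m'(1,4) s3(2,3) by (simp only: s3_def[symmetric]) simp
  qed
  have asg: "nval (NAdd (NMul (V p) (V ''n'')) (V q)) s = e"
    using n xy by (simp add: e_def)
  have "runs b (assign ''e'' (NAdd (NMul (V p) (V ''n'')) (V q))) s (\<lambda>t s'. t = 1 \<and> s' = s1)"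
    unfolding runs_NPut asg using eb by (simp add: s1_def)
  then show ?thesis
    unfolding add_edge_def block.simps e_def[symmetric]
    by (rule runs_SequI) (elim conjE, hypsubst, rule runs_SequI[OF mid], rule fin)
qed

lemma runs_del_edge:
  assumes n: "nmem s ''n'' 0 = n" and e: "nmem s ''e'' 0 = e" "e \<in> active n R"
    and R: "R = nmem s ''orient''" and lk: "linked n (active n R) s"
    and K: "nmem s ''K'' e \<le> M" and b: "(M + 1) * n * n \<le> b" "R e \<le> b"
  shows "runs b del_edge s (\<lambda>t s'. t \<le> 10 \<and> nmem s' ''orient'' = R(e := R e - 1) \<and>
    linked n (active n (nmem s' ''orient'')) s' \<and>
    frame ({''orient''} \<union> link_arrays) {} s s')"
proof -
  have e': "e < n * n" "0 < R e" using e by (auto simp: active_def)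
  define s1 where "s1 = nput ''orient'' e (R e - 1) s"
  have s1: "nmem s1 ''n'' 0 = n" "nmem s1 ''e'' 0 = e" "nmem s1 ''K'' e \<le> M"
    "linked n (active n R) s1" "nmem s1 ''orient'' = R(e := R e - 1)" "frame {''orient''} {} s s1"
    using n e R lk K by (auto simp: s1_def linked_def frame_def)
  have asg: "nval (NSub (NGet ''orient'' (V ''e'')) (NLit 1)) s = R e - 1"
    using e R by simp
  have eb: "e \<le> b" "R e - 1 \<le> b" using e' square_le_bound[OF b(1)] b(2) by auto
  have "runs b (IfThen (NLess (NLit 0) (NGet ''orient'' (V ''e''))) Skip unlink) s1
    (\<lambda>t s'. 1 + t \<le> 10 \<and> nmem s' ''orient'' = R(e := R e - 1) \<and>
      linked n (active n (nmem s' ''orient'')) s' \<and>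
      frame ({''orient''} \<union> link_arrays) {} s s')"
  proof (cases "R e = 1")
    case True
    then have act: "active n (R(e := R e - 1)) = active n R - {e}"
      by (auto simp: active_def)
    have "runs b unlink s1 (\<lambda>t s'. t = 8 \<and> linked n (active n R - {e}) s' \<and> frame link_arrays {} s1 s')"
      by (rule runs_unlink[OF s1(1,2) e(2) active_subset s1(3) b(1) s1(4)])
    then have "runs b unlink s1 (\<lambda>t s'. 1 + (1 + t) \<le> 10 \<and> nmem s' ''orient'' = R(e := R e - 1) \<and>
      linked n (active n (nmem s' ''orient'')) s' \<and>
      frame ({''orient''} \<union> link_arrays) {} s s')"
      by (rule runs_mono) (use s1 act in \<open>auto simp: frame_def\<close>)
    then show ?thesis
      using True s1 by (simp add: runs_simps)
  next
    case False
    then have act: "active n (R(e := R e - 1)) = active n R"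
      using e' by (auto simp: active_def)
    have "linked n (active n (nmem s1 ''orient'')) s1"
      using s1(4) by (simp only: s1(5) act)
    moreover have "frame ({''orient''} \<union> link_arrays) {} s s1"
      using s1(6) by (auto simp: frame_def)
    ultimately show ?thesis
      using False e' s1(2,5) by (simp add: runs_simps)
  qed
  then show ?thesis
    unfolding del_edge_def block.simps runs_Sequ runs_NPut asg
    using eb by (simp add: s1_def e)
qed

lemma runs_relevel:
  assumes n: "nmem s ''n'' 0 = n" and e: "nmem s ''e'' 0 = e" "e \<in> A" and A: "A \<subseteq> {..<n * n}"
    and j: "nmem s ''j'' 0 = j" "j \<le> M" and lk: "linked n A s"
    and K: "nmem s ''K'' e \<le> M" and b: "(M + 1) * n * n \<le> b" "M \<le> b"
  shows "runs b relevel s (\<lambda>t s'. t = 15 \<and> nmem s' ''K'' = (nmem s ''K'')(e := j) \<and>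
    linked n A s' \<and> frame ({''K''} \<union> link_arrays) {} s s')"
proof -
  have eb: "e \<le> b" using e A square_le_bound[OF b(1)] by auto
  have e': "e < n * n" using e A by auto
  have "runs b unlink s (\<lambda>t s'. t = 8 \<and> linked n (A - {e}) s' \<and> frame link_arrays {} s s')"
    by (rule runs_unlink[OF n e A K b(1) lk])
  then show ?thesis
    unfolding relevel_def block.simps runs_Sequ
  proof (rule runs_mono, elim conjE)
    fix t s1
    assume t: "t = (8::nat)" and lk1: "linked n (A - {e}) s1" and fr: "frame link_arrays {} s s1"
    define s2 where "s2 = nput ''K'' e j s1"
    have s2: "nmem s2 ''n'' 0 = n" "nmem s2 ''e'' 0 = e" "frame {''K''} {} s1 s2"
      "nmem s2 ''K'' = (nmem s ''K'')(e := j)" "nmem s1 ''K'' = nmem s ''K''"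
      "nmem s1 ''e'' 0 = e" "nmem s1 ''j'' 0 = j"
      using fr n e j by (auto simp: s2_def frame_def)
    have "runs b link s2 (\<lambda>t s'. t = 6 \<and> linked n (insert e (A - {e})) s' \<and> frame link_arrays {} s2 s')"
      by (rule runs_link[OF s2(1,2) e' _ _ _ b(1) lk1 s2(3)])
        (use A s2 j in auto)
    then have "runs b link s2 (\<lambda>t' s'. t + (1 + t') = 15 \<and> nmem s' ''K'' = (nmem s ''K'')(e := j) \<and>
      linked n A s' \<and> frame ({''K''} \<union> link_arrays) {} s s')"
      by (rule runs_mono) (use s2 t fr e in \<open>auto simp: frame_def insert_absorb\<close>)
    then show "runs b (NPut ''K'' (V ''e'') (V ''j'')) s1 (\<lambda>t1 s1. runs b link s1
       (\<lambda>t2 s'. t + (t1 + t2) = 15 \<and> nmem s' ''K'' = (nmem s ''K'')(e := j) \<and>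
         linked n A s' \<and> frame ({''K''} \<union> link_arrays) {} s s'))"
      unfolding runs_NPut using s2 eb j b(2) by (simp add: s2_def)
  qed
qed


subsection \<open>Levels and stored levels\<close>

text \<open>The width 2 (tau i / s + 1) is dictated by the refiling. At weight w it takes 2 w (tau i
  / s + 1) unit changes of the degree to cross level i; with s edges each, these refile 2 w tau i +
  2 w s edges, enough for all edges that enter the vertex. The summand 1 keeps the width at least 2,
  so a unit change of the degree never skips a level.\<close>

fun tau :: "nat \<Rightarrow> nat \<Rightarrow> real" where
  "tau s 0 = 0"
| "tau s (Suc i) = tau s i + 2 * (tau s i / real s + 1)"

lemma tau_nonneg: "0 \<le> tau s i"
  by (induction i) auto

lemma tau_Suc_gt: "tau s i + 2 \<le> tau s (Suc i)"
  using tau_nonneg[of s i] by simp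

lemma tau_mono: "i \<le> j \<Longrightarrow> tau s i \<le> tau s j"
  by (rule lift_Suc_mono_le[of "tau s"]) (use tau_Suc_gt[of s] in \<open>smt (verit)\<close>)+

text \<open>
  The directed edge from \<open>u\<close> to \<open>v\<close> has the index \<open>e = u * n + v\<close>; \<open>R e\<close> is the number of its copies and
  \<open>K e\<close> the level of \<open>v\<close> under which it is filed, which may be out of date.
\<close>

definition lows :: "nat \<Rightarrow> (nat \<Rightarrow> nat) \<Rightarrow> (nat \<Rightarrow> nat) \<Rightarrow> (nat \<Rightarrow> nat) \<Rightarrow> nat \<Rightarrow> nat set" where
  "lows n R K lev v = {e. e < n * n \<and> e mod n = v \<and> 0 < R e \<and> K e + 2 = lev v}"

definition highs :: "nat \<Rightarrow> (nat \<Rightarrow> nat) \<Rightarrow> (nat \<Rightarrow> nat) \<Rightarrow> (nat \<Rightarrow> nat) \<Rightarrow> nat \<Rightarrow> nat set" where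
  "highs n R K lev v = {e. e < n * n \<and> e mod n = v \<and> 0 < R e \<and> K e = lev v + 2}"

definition ind :: "nat \<Rightarrow> (nat \<Rightarrow> nat) \<Rightarrow> nat \<Rightarrow> nat" where
  "ind n R v = (\<Sum>e | e < n * n \<and> e mod n = v. R e)"

text \<open>The tolerance 3 at the tail exceeds the tolerance 2 at the head. An edge filed at the
  limit \<open>lev (e div n) + 3\<close> therefore has a strictly higher head, which makes the
  chains of deletions climb. A refiled edge receives the level of its head or one more, so it is
  neither low nor high.\<close>

definition edge_inv :: "nat \<Rightarrow> (nat \<Rightarrow> nat) \<Rightarrow> (nat \<Rightarrow> nat) \<Rightarrow> (nat \<Rightarrow> nat) \<Rightarrow> bool" where
  "edge_inv n R K lev \<longleftrightarrow> (\<forall>e<n * n. 0 < R e \<longrightarrow>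
     K e \<le> lev (e div n) + 3 \<and> lev (e mod n) \<le> K e + 2 \<and> K e \<le> lev (e mod n) + 2)"

text \<open>
  \<open>K e\<close> must stay within distance \<open>2\<close> of the level of the head, so \<open>lows\<close> has to be empty when the level
  of \<open>v\<close> rises and \<open>highs\<close> when it falls. A unit change of the degree \<open>dv\<close> pays for refiling \<open>s\<close> edges:
  the bounds below are exhausted exactly when \<open>dv\<close> reaches a threshold. The allowance \<open>rv\<close> is what
  remains of the payment for the last increase.
\<close>

definition vertex_inv ::
  "nat \<Rightarrow> real \<Rightarrow> nat \<Rightarrow> (nat \<Rightarrow> nat) \<Rightarrow> (nat \<Rightarrow> nat) \<Rightarrow> (nat \<Rightarrow> nat) \<Rightarrow> nat \<Rightarrow> nat \<Rightarrow> nat \<Rightarrow> bool" where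
  "vertex_inv n wv s R K lev dv rv v \<longleftrightarrow> rv \<le> s \<and>
     wv * tau s (lev v) \<le> real dv \<and> real dv < wv * tau s (lev v + 1) \<and>
     real (card (lows n R K lev v)) \<le> real rv + real s * max 0 (wv * tau s (lev v + 1) - real dv - 1) \<and>
     real (card (highs n R K lev v)) \<le> real s * (real dv - wv * tau s (lev v))"

text \<open>\<open>deg\<close> is a parameter and is not tied to \<open>R\<close> here: while a
  chain is in progress, \<open>R\<close> has already changed but the counter of one vertex has
  not.\<close>

definition core where
  "core n w s R K lev deg rem \<longleftrightarrow> edge_inv n R K lev \<and>
     (\<forall>v<n. vertex_inv n (w v) s R K lev (deg v) (rem v) v)"

lemma finite_lows [simp]: "finite (lows n R K lev v)" by (simp add: lows_def)
lemma finite_highs [simp]: "finite (highs n R K lev v)" by (simp add: highs_def)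

lemma card_in_edges_le: "card {e. e < n * n \<and> e mod n = v \<and> 0 < R e} \<le> ind n R v"
proof -
  have "card {e. e < n * n \<and> e mod n = v \<and> 0 < R e} = (\<Sum>e | e < n * n \<and> e mod n = v \<and> 0 < R e. 1)"
    by simp
  also have "\<dots> \<le> (\<Sum>e | e < n * n \<and> e mod n = v \<and> 0 < R e. R e)"
    by (rule sum_mono) auto
  also have "\<dots> \<le> ind n R v"
    unfolding ind_def by (rule sum_mono2) auto
  finally show ?thesis .
qed

lemma card_lows_le: "card (lows n R K lev v) \<le> ind n R v"
  by (rule order_trans[OF card_mono card_in_edges_le[of n v R]]) (auto simp: lows_def)

lemma card_highs_le: "card (highs n R K lev v) \<le> ind n R v"
  by (rule order_trans[OF card_mono card_in_edges_le[of n v R]]) (auto simp: highs_def)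

section \<open>Preservation of the invariants by elementary changes\<close>

lemma vertex_inv_antimono:
  assumes "vertex_inv n wv s R K lev dv rv v"
    and "lows n R' K' lev v \<subseteq> lows n R K lev v" "highs n R' K' lev v \<subseteq> highs n R K lev v"
  shows "vertex_inv n wv s R' K' lev dv rv v"
  using assms card_mono[OF _ assms(2)] card_mono[OF _ assms(3)]
  unfolding vertex_inv_def by (smt (verit) finite_lows finite_highs of_nat_mono)

lemma core_remove:
  assumes "core n w s R K lev deg rem"
  shows "core n w s (R(e := R e - 1)) K lev deg rem"
  unfolding core_def
proof (intro conjI allI impI)
  show "edge_inv n (R(e := R e - 1)) K lev"
    using assms by (auto simp: core_def edge_inv_def)
  fix v assume "v < n"
  then have vi: "vertex_inv n (w v) s R K lev (deg v) (rem v) v"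
    using assms by (simp add: core_def)
  show "vertex_inv n (w v) s (R(e := R e - 1)) K lev (deg v) (rem v) v"
    by (rule vertex_inv_antimono[OF vi]) (auto simp: lows_def highs_def split: if_splits)
qed

text \<open>A newly filed edge carries the exact level of its head. Being neither low nor high, it
  is charged to no bound; the assumption on the levels is the tail condition for it.\<close>

lemma core_add:
  assumes "core n w s R K lev deg rem" and "lev (e mod n) \<le> lev (e div n) + 3"
  shows "core n w s (R(e := Suc (R e))) (if R e = 0 then K(e := lev (e mod n)) else K) lev deg rem"
  unfolding core_def
proof (intro conjI allI impI)
  show "edge_inv n (R(e := Suc (R e))) (if R e = 0 then K(e := lev (e mod n)) else K) lev"
    using assms by (auto simp: core_def edge_inv_def)
  fix v assume "v < n"
  then have vi: "vertex_inv n (w v) s R K lev (deg v) (rem v) v"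
    using assms by (simp add: core_def)
  show "vertex_inv n (w v) s (R(e := Suc (R e))) (if R e = 0 then K(e := lev (e mod n)) else K)
      lev (deg v) (rem v) v"
    by (rule vertex_inv_antimono[OF vi]) (auto simp: lows_def highs_def split: if_splits)
qed

text \<open>The allowance and the number of low edges drop together, so their bound survives.
  \<open>j\<close> is the level that \<open>c\<close> would have after its pending growth, whence
  the limit \<open>lev c + 1\<close>.\<close>

lemma core_scan_low:
  assumes core: "core n w s R K lev deg rem" and e: "e \<in> lows n R K lev c" and c: "c < n"
    and j: "lev c \<le> j" "j \<le> lev c + 1" "j \<le> lev (e div n) + 3" and r: "0 < rem c"
  shows "core n w s R (K(e := j)) lev deg (rem(c := rem c - 1))"
  unfolding core_def
proof (intro conjI allI impI)
  have ec: "e mod n = c" using e by (simp add: lows_def)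
  show "edge_inv n R (K(e := j)) lev"
    using core e j by (auto simp: core_def edge_inv_def lows_def)
  fix v assume v: "v < n"
  have *: "highs n R (K(e := j)) lev v \<subseteq> highs n R K lev v"
    using ec j by (auto simp: highs_def)
  show "vertex_inv n (w v) s R (K(e := j)) lev (deg v) ((rem(c := rem c - 1)) v) v"
  proof (cases "v = c")
    case False
    then have "lows n R (K(e := j)) lev v \<subseteq> lows n R K lev v"
      using ec by (auto simp: lows_def)
    then show ?thesis
      using False core v * by (auto simp: core_def intro: vertex_inv_antimono)
  next
    case True
    have "lows n R (K(e := j)) lev c = lows n R K lev c - {e}"
      using ec j e by (auto simp: lows_def)
    then have "card (lows n R (K(e := j)) lev c) = card (lows n R K lev c) - 1" "0 < card (lows n R K lev c)"
      using e by (auto simp: card_gt_0_iff)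
    then have 1: "real (card (lows n R (K(e := j)) lev c)) = real (card (lows n R K lev c)) - 1"
      by simp
    have 2: "card (highs n R (K(e := j)) lev c) \<le> card (highs n R K lev c)"
      using * True by (intro card_mono) auto
    have "vertex_inv n (w c) s R K lev (deg c) (rem c) c"
      using core c by (simp add: core_def)
    then show ?thesis
      unfolding vertex_inv_def True using 1 2 r by (auto simp: of_nat_diff)
  qed
qed

text \<open>Refiling a high edge lowers its stored level, which only relaxes the tail condition.
  This is why deletions can refile without looking at tails and without an allowance.\<close>

lemma core_scan_high:
  assumes core: "core n w s R K lev deg rem" and e: "e \<in> highs n R K lev c"
  shows "core n w s R (K(e := lev c)) lev deg rem"
  unfolding core_def
proof (intro conjI allI impI)
  show "edge_inv n R (K(e := lev c)) lev"
    using core e by (auto simp: core_def edge_inv_def highs_def)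
  fix v assume v: "v < n"
  have "highs n R (K(e := lev c)) lev v \<subseteq> highs n R K lev v"
    "lows n R (K(e := lev c)) lev v \<subseteq> lows n R K lev v"
    using e by (auto simp: highs_def lows_def)
  then show "vertex_inv n (w v) s R (K(e := lev c)) lev (deg v) (rem v) v"
    using core v by (auto simp: core_def intro: vertex_inv_antimono)
qed

lemma vertex_inv_lev_cong:
  assumes "lev' v = lev v"
  shows "vertex_inv n wv s R K lev' dv rv v = vertex_inv n wv s R K lev dv rv v"
  using assms by (simp add: vertex_inv_def lows_def highs_def)

lemma core_accept_inc:
  assumes core: "core n w s R K lev deg rem" and c: "c < n" and w: "1 \<le> w c" and s: "2 \<le> s"
    and d: "ind n R c = deg c + 1" and quiet: "rem c = 0 \<or> lows n R K lev c = {}"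
    and j: "j = (if real (deg c + 1) < w c * tau s (lev c + 1) then lev c else lev c + 1)"
  shows "core n w s R K (lev(c := j)) (deg(c := deg c + 1)) (rem(c := s))"
proof -
  let ?lev = "lev(c := j)"
  have vi: "vertex_inv n (w c) s R K lev (deg c) (rem c) c"
    using core c by (simp add: core_def)
  \<comment> \<open>\<open>Y\<close> is the degree missing to the next threshold; the level rises
    exactly if \<open>Y\<close> is at most 1.\<close>
  define Y where "Y = w c * tau s (lev c + 1) - real (deg c)"
  have Y: "0 < Y" using vi by (simp add: vertex_inv_def Y_def)
  have low: "real (card (lows n R K lev c)) \<le> real s * max 0 (Y - 1)"
    using vi quiet by (auto simp: vertex_inv_def Y_def)
  have jump: "lows n R K lev c = {}" "Y \<le> 1" if "j \<noteq> lev c"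
  proof -
    show "Y \<le> 1" using that j by (simp add: Y_def split: if_splits)
    then have "card (lows n R K lev c) = 0" using low by simp
    then show "lows n R K lev c = {}" by simp
  qed
  have edge: "edge_inv n R K ?lev"
    unfolding edge_inv_def
  proof (intro allI impI)
    fix e assume e: "e < n * n" "0 < R e"
    have ei: "K e \<le> lev (e div n) + 3 \<and> lev (e mod n) \<le> K e + 2 \<and> K e \<le> lev (e mod n) + 2"
      using core e by (simp add: core_def edge_inv_def)
    have "e \<notin> lows n R K lev c" if "j \<noteq> lev c" using jump(1)[OF that] by simp
    then have "K e + 2 \<noteq> lev c" if "j \<noteq> lev c" "e mod n = c"
      using that e by (auto simp: lows_def)
    then show "K e \<le> ?lev (e div n) + 3 \<and> ?lev (e mod n) \<le> K e + 2 \<and> K e \<le> ?lev (e mod n) + 2"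
      using ei j by (auto split: if_splits)
  qed
  have new: "vertex_inv n (w c) s R K ?lev (deg c + 1) s c"
  proof (cases "j = lev c")
    case True
    then have same: "?lev = lev" by simp
    have "Y > 1" using True j by (auto simp: Y_def split: if_splits)
    then have "real (card (lows n R K lev c)) \<le> real s * (Y - 1)" using low by simp
    \<comment> \<open>The fresh allowance \<open>s\<close> pays for the unit by which the distance
      to the threshold shrinks.\<close>
    also have "\<dots> = real s + real s * (Y - 2)" by (simp add: algebra_simps)
    also have "\<dots> \<le> real s + real s * max 0 (Y - 2)" by (simp add: mult_left_mono)
    finally have 1: "real (card (lows n R K lev c)) \<le> real s + real s * max 0 (w c * tau s (lev c + 1) - real (deg c + 1) - 1)"
      by (simp add: Y_def algebra_simps)
    have "real s * (real (deg c) - w c * tau s (lev c)) \<le> real s * (real (deg c + 1) - w c * tau s (lev c))"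
      by (intro mult_left_mono) auto
    then show ?thesis
      using vi 1 \<open>Y > 1\<close> unfolding same vertex_inv_def Y_def by auto
  next
    case False
    then have jj: "j = lev c + 1" using j by (simp split: if_splits)
    have "real (deg c + 1) < w c * tau s (lev c + 1) + 1" using Y by (simp add: Y_def)
    moreover have "w c * tau s (lev c + 1) + 2 * w c * (tau s (lev c + 1) / real s + 1) = w c * tau s (lev c + 2)"
      by (simp add: algebra_simps)
    ultimately have Y': "w c * tau s (lev c + 2) - real (deg c + 1) \<ge> 2 * w c * (tau s (lev c + 1) / real s + 1) - 1"
      by linarith
    \<comment> \<open>After a rise every incoming edge is counted as low. The whole width of the new
      level lies ahead, and s times that width covers them all.\<close>
    have "card (lows n R K ?lev c) \<le> deg c + 1" using card_lows_le[of n R K ?lev c] d by simp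
    then have "real (card (lows n R K ?lev c)) \<le> w c * tau s (lev c + 1) + 1"
      using Y by (simp add: Y_def)
    also have "\<dots> \<le> real s * (2 * w c * (tau s (lev c + 1) / real s + 1) - 1)"
    proof -
      have "real s * (2 * w c * (tau s (lev c + 1) / real s + 1) - 1)
        = 2 * (w c * tau s (lev c + 1)) + real s * (2 * w c - 1)"
        using s by (simp add: field_simps)
      moreover have "real s * (2 * w c - 1) \<ge> 2 * 1" using s w by (intro mult_mono) auto
      moreover have "0 \<le> w c * tau s (lev c + 1)" using w tau_nonneg by (intro mult_nonneg_nonneg) (auto simp del: tau.simps)
      ultimately show ?thesis by linarith
    qed
    also have "\<dots> \<le> real s * (w c * tau s (lev c + 2) - real (deg c + 1))"
      using Y' by (intro mult_left_mono) auto
    also have "\<dots> = real s + real s * (w c * tau s (lev c + 2) - real (deg c + 1) - 1)"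
      by (simp add: algebra_simps)
    also have "\<dots> \<le> real s + real s * max 0 (w c * tau s (lev c + 2) - real (deg c + 1) - 1)"
      by (intro add_left_mono mult_left_mono) auto
    finally have low': "real (card (lows n R K ?lev c)) \<le> \<dots>" .
    \<comment> \<open>Stored levels are at most 2 above the old level, hence at most 1 above the new
      one.\<close>
    have hi': "highs n R K ?lev c = {}"
      using core jj by (auto simp: core_def edge_inv_def highs_def)
    have "real (deg c + 1) < w c * tau s (lev c + 2)"
    proof -
      have "2 * w c * (tau s (lev c + 1) / real s + 1) \<ge> 2 * 1 * 1"
        using w tau_nonneg[of s "lev c + 1"] by (intro mult_mono) (auto simp del: tau.simps)
      then show ?thesis using Y' by linarith
    qed
    moreover have "w c * tau s (lev c + 1) \<le> real (deg c + 1)" using False j by (simp del: tau.simps split: if_splits)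
    ultimately show ?thesis
      using low' hi' unfolding vertex_inv_def jj by (simp del: tau.simps add: numeral_2_eq_2)
  qed
  show ?thesis
    unfolding core_def
  proof (intro conjI allI impI)
    fix v assume v: "v < n"
    show "vertex_inv n (w v) s R K ?lev ((deg(c := deg c + 1)) v) ((rem(c := s)) v) v"
      using new core v vertex_inv_lev_cong[of ?lev v lev] by (cases "v = c") (simp_all add: core_def)
  qed (rule edge)
qed

text \<open>The mirror image of \<open>core_accept_inc\<close> without an allowance: the deletion
  itself has just refiled s high edges, or all of them. In addition a fall of \<open>c\<close>
  tightens the tail condition of the edges that leave \<open>c\<close>; \<open>out\<close> excludes
  those at the limit.\<close>

lemma core_accept_dec:
  assumes core: "core n w s R K lev deg rem" and c: "c < n" and w: "1 \<le> w c" and s: "2 \<le> s"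
    and d: "ind n R c + 1 = deg c"
    and quiet: "highs n R K lev c = {} \<or>
      real (card (highs n R K lev c)) + real s \<le> real s * (real (deg c) - w c * tau s (lev c))"
    and j: "j = (if real (deg c) - 1 < w c * tau s (lev c) then lev c - 1 else lev c)"
    and out: "\<And>e. j < lev c \<Longrightarrow> e < n * n \<Longrightarrow> 0 < R e \<Longrightarrow> e div n = c \<Longrightarrow> K e \<noteq> lev c + 3"
  shows "core n w s R K (lev(c := j)) (deg(c := deg c - 1)) rem"
proof -
  let ?lev = "lev(c := j)"
  have vi: "vertex_inv n (w c) s R K lev (deg c) (rem c) c"
    using core c by (simp add: core_def)
  have d1: "1 \<le> deg c" using d by simp
  define X where "X = real (deg c) - w c * tau s (lev c)"
  have X: "0 \<le> X" using vi by (simp add: vertex_inv_def X_def)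
  have j': "j = (if X < 1 then lev c - 1 else lev c)" using j by (auto simp: X_def)
  have jump: "highs n R K lev c = {}" "X < 1" "0 < lev c" "lev c = Suc j" if "j \<noteq> lev c"
  proof -
    show X1: "X < 1" and "0 < lev c" "lev c = Suc j" using that j' by (auto split: if_splits)
    \<comment> \<open>If the level falls, the second alternative of \<open>quiet\<close> would leave
      a negative bound for a cardinality, so the first one holds.\<close>
    have "real s * X < real s" using X1 s by simp
    then show "highs n R K lev c = {}" using quiet unfolding X_def by linarith
  qed
  have edge: "edge_inv n R K ?lev"
    unfolding edge_inv_def
  proof (intro allI impI)
    fix e assume e: "e < n * n" "0 < R e"
    have ei: "K e \<le> lev (e div n) + 3 \<and> lev (e mod n) \<le> K e + 2 \<and> K e \<le> lev (e mod n) + 2"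
      using core e by (simp add: core_def edge_inv_def)
    have hi: "K e \<noteq> lev c + 2" if "j \<noteq> lev c" "e mod n = c"
      using that e jump(1) by (auto simp: highs_def)
    have ou: "K e \<noteq> lev c + 3" if "j \<noteq> lev c" "e div n = c"
      using that e out[of e] jump(4) by auto
    show "K e \<le> ?lev (e div n) + 3 \<and> ?lev (e mod n) \<le> K e + 2 \<and> K e \<le> ?lev (e mod n) + 2"
      using ei hi ou jump(4) by (cases "j = lev c") auto
  qed
  have new: "vertex_inv n (w c) s R K ?lev (deg c - 1) (rem c) c"
  proof (cases "j = lev c")
    case True
    then have same: "?lev = lev" by simp
    \<comment> \<open>The predecessor in \<open>j\<close> truncates at level 0. There the threshold
      is 0 and \<open>X\<close> is the degree, which is positive because one unit is about to be
      removed.\<close>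
    have X1: "X \<ge> 1"
    proof (rule ccontr)
      assume "\<not> X \<ge> 1"
      then have "lev c = 0" using True j' by auto
      then show False using \<open>\<not> X \<ge> 1\<close> d1 by (simp add: X_def)
    qed
    have "real s * max 0 (w c * tau s (lev c + 1) - real (deg c) - 1) \<le>
      real s * max 0 (w c * tau s (lev c + 1) - real (deg c - 1) - 1)"
      using d1 by (intro mult_left_mono) (auto simp: of_nat_diff)
    moreover have "real (card (highs n R K lev c)) \<le> real s * (real (deg c - 1) - w c * tau s (lev c))"
    proof (cases "highs n R K lev c = {}")
      case True
      then show ?thesis using X1 d1 by (simp add: X_def of_nat_diff)
    next
      case False
      then show ?thesis using quiet d1 by (simp add: algebra_simps of_nat_diff)
    qed
    ultimately show ?thesis
      using vi X1 d1 unfolding same vertex_inv_def X_def by (auto simp: of_nat_diff simp del: tau.simps)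
  next
    case False
    note jump = jump[OF False]
    have le: "real (deg c - 1) = real (deg c) - 1" using d1 by simp
    have up: "real (deg c - 1) < w c * tau s (j + 1)"
      using jump(2,4) le by (simp add: X_def)
    have step: "w c * tau s (Suc j) = w c * tau s j + 2 * w c * (tau s j / real s + 1)"
      by (simp add: algebra_simps)
    have "w c * tau s (Suc j) \<le> real (deg c)" using X jump(4) by (simp add: X_def)
    then have X': "real (deg c - 1) - w c * tau s j \<ge> 2 * w c * (tau s j / real s + 1) - 1"
      unfolding le step by linarith
    have "2 * w c * (tau s j / real s + 1) \<ge> 2 * 1 * 1"
      using w tau_nonneg[of s j] by (intro mult_mono) auto
    then have pos: "0 \<le> 2 * w c * (tau s j / real s + 1) - 1" by linarith
    \<comment> \<open>One of the s shares pays for the excess of the degree over the lower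
      threshold. The other s - 1, at least s / 2, pay for the threshold itself by the width of the
      level.\<close>
    have "real s * (real (deg c - 1) - w c * tau s j) = (real s - 1) * (real (deg c - 1) - w c * tau s j) + (real (deg c - 1) - w c * tau s j)"
      by (simp add: algebra_simps)
    moreover have "(real s - 1) * (real (deg c - 1) - w c * tau s j) \<ge> w c * tau s j"
    proof -
      have "(real s - 1) * (real (deg c - 1) - w c * tau s j) \<ge> (real s / 2) * (2 * w c * (tau s j / real s + 1) - 1)"
        using X' s pos by (intro mult_mono) auto
      also have "(real s / 2) * (2 * w c * (tau s j / real s + 1) - 1) = w c * tau s j + real s * (w c - 1 / 2)"
        using s by (simp add: field_simps)
      moreover have "0 \<le> real s * (w c - 1 / 2)" using w by simp
      ultimately show ?thesis by linarith
    qed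
    ultimately have big: "real (deg c - 1) \<le> real s * (real (deg c - 1) - w c * tau s j)"
      by linarith
    have "card (highs n R K ?lev c) \<le> deg c - 1" using card_highs_le[of n R K ?lev c] d by simp
    then have hi': "real (card (highs n R K ?lev c)) \<le> real s * (real (deg c - 1) - w c * tau s j)"
      using big by linarith
    \<comment> \<open>Stored levels are at most 2 below the old level, hence at most 1 below the new
      one.\<close>
    have lo': "lows n R K ?lev c = {}"
      using core jump(4) by (auto simp: core_def edge_inv_def lows_def)
    have "w c * tau s j \<le> real (deg c - 1)"
      using X' pos by linarith
    then show ?thesis
      using hi' lo' up vi s unfolding vertex_inv_def by (auto simp del: tau.simps intro!: add_nonneg_nonneg mult_nonneg_nonneg)
  qed
  show ?thesis
    unfolding core_def
  proof (intro conjI allI impI)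
    fix v assume v: "v < n"
    show "vertex_inv n (w v) s R K ?lev ((deg(c := deg c - 1)) v) (rem v) v"
      using new core v vertex_inv_lev_cong[of ?lev v lev] by (cases "v = c") (simp_all add: core_def)
  qed (rule edge)
qed


subsection \<open>Orientations, the linear program and dense levels\<close>

abbreviation orient_of :: "nat \<Rightarrow> (nat \<Rightarrow> nat) \<Rightarrow> nat \<Rightarrow> nat \<Rightarrow> nat" where
  "orient_of n R \<equiv> (\<lambda>u v. R (u * n + v))"

definition graph_on :: "nat \<Rightarrow> graph \<Rightarrow> bool" where
  "graph_on n G \<longleftrightarrow> (\<forall>e\<in>#G. \<exists>u v. u < n \<and> v < n \<and> u \<noteq> v \<and> e = {u, v})"

lemma edge_id: "v < n \<Longrightarrow> (u * n + v) div n = u" "v < n \<Longrightarrow> (u * n + v) mod n = v" for n :: nat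
  by auto

lemma edge_id_eq: "e < n * n \<Longrightarrow> (e div n) * n + e mod n = e" "e < n * n \<Longrightarrow> e div n < n"
    "e < n * n \<Longrightarrow> e mod n < n" for n :: nat
proof -
  assume e: "e < n * n"
  then have "0 < n" by (cases n) auto
  then show "(e div n) * n + e mod n = e" "e div n < n" "e mod n < n"
    using e by (simp_all add: less_mult_imp_div_less)
qed

lemma edge_id_inj: "v < n \<Longrightarrow> v' < n \<Longrightarrow> u * n + v = u' * n + v' \<longleftrightarrow> u = u' \<and> v = v'" for n :: nat
  using bucket_address_inj[of u n v u' v'] by blast

lemma ind_eq_in_degree: "v < n \<Longrightarrow> ind n R v = in_degree n (orient_of n R) v"
  unfolding ind_def in_degree_def
  by (rule sum.reindex_bij_witness[of _ "\<lambda>u. u * n + v" "\<lambda>e. e div n"])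
    (auto simp: edge_less less_mult_imp_div_less)

lemma ind_upd:
  assumes "e < n * n"
  shows "ind n (R(e := x)) v + (if e mod n = v then R e else 0) = ind n R v + (if e mod n = v then x else 0)"
proof (cases "e mod n = v")
  case True
  let ?A = "{e. e < n * n \<and> e mod n = v}"
  have "e \<in> ?A" "finite ?A" using True assms by auto
  then show ?thesis
    unfolding ind_def using True by (simp add: sum.remove[of ?A e])
next
  case False
  then show ?thesis
    unfolding ind_def by (auto intro: sum.cong)
qed

lemma ind_add: "e < n * n \<Longrightarrow> ind n (R(e := Suc (R e))) v = ind n R v + (if e mod n = v then 1 else 0)"
  using ind_upd[of e n R "Suc (R e)" v] by (auto split: if_splits)

lemma ind_remove: "e < n * n \<Longrightarrow> 0 < R e \<Longrightarrow>
    ind n R v = ind n (R(e := R e - 1)) v + (if e mod n = v then 1 else 0)"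
  using ind_upd[of e n R "R e - 1" v] by (auto split: if_splits)

lemma orientation_insert:
  assumes "orientation n G (orient_of n R)" "u < n" "v < n" "u \<noteq> v"
  shows "orientation n (add_mset {u, v} G) (orient_of n (R(u * n + v := Suc (R (u * n + v)))))"
  using assms unfolding orientation_def by (auto simp: edge_id_inj doubleton_eq_iff)

lemma orientation_delete:
  assumes "orientation n G (orient_of n R)" "u < n" "v < n" "u \<noteq> v" "0 < R (u * n + v)"
  shows "orientation n (G - {#{u, v}#}) (orient_of n (R(u * n + v := R (u * n + v) - 1)))"
  using assms unfolding orientation_def by (auto simp: edge_id_inj doubleton_eq_iff)

lemma orientation_irrefl:
  assumes "orientation n G (orient_of n R)" "e < n * n" "0 < R e"
  shows "e div n \<noteq> e mod n"
proof
  assume *: "e div n = e mod n"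
  have "R ((e div n) * n + e div n) = 0"
    using assms edge_id_eq[OF assms(2)] by (simp add: orientation_def)
  then show False using * assms(3) edge_id_eq(1)[OF assms(2)] by simp
qed

lemma orientation_flip:
  assumes "orientation n G (orient_of n R)" "u < n" "v < n" "u \<noteq> v" "0 < R (u * n + v)"
  shows "orientation n G (orient_of n ((R(u * n + v := R (u * n + v) - 1))(v * n + u := Suc (R (v * n + u)))))"
proof -
  have "R (u * n + v) + R (v * n + u) = count G {u, v}" "{v, u} = {u, v}"
    using assms unfolding orientation_def by auto
  moreover from this have "0 < count G {u, v}" "0 < count G {v, u}"
    using assms(5) by (metis add_gr_0)+
  ultimately show ?thesis
    using assms unfolding orientation_def by (auto simp: edge_id_inj doubleton_eq_iff)
qed

lemma sum_mset_count: "(\<Sum>e\<in>#G. (h e :: real)) = (\<Sum>e\<in>set_mset G. real (count G e) * h e)"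
proof (induction G)
  case (add x G)
  show ?case
  proof (cases "x \<in># G")
    case True
    have "(\<Sum>e\<in>set_mset (add_mset x G). real (count (add_mset x G) e) * h e)
       = (\<Sum>e\<in>set_mset G. real (count G e) * h e + (if e = x then h x else 0))"
      using True by (intro sum.cong) (auto simp: insert_absorb algebra_simps)
    then show ?thesis using add True by (simp add: sum.distrib)
  next
    case False
    have "(\<Sum>e\<in>set_mset G. real (count (add_mset x G) e) * h e) = (\<Sum>e\<in>set_mset G. real (count G e) * h e)"
      using False by (intro sum.cong) auto
    then show ?thesis using add False by (simp add: not_in_iff)
  qed
qed auto

text \<open>Each edge is the common image of the two ordered pairs of its ends, whose copy numbers
  add up to its multiplicity. This links sums over edges, as in the linear program, with
  in-degrees.\<close>

lemma sum_over_orientation: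
  fixes h :: "nat set \<Rightarrow> real"
  assumes o: "orientation n G R" and G: "graph_on n G"
  shows "(\<Sum>e\<in>#G. h e) = (\<Sum>u<n. \<Sum>v<n. real (R u v) * h {u, v})"
proof -
  let ?P = "{..<n} \<times> {..<n}" and ?f = "\<lambda>p. {fst p, snd p}"
  let ?g = "\<lambda>p. real (R (fst p) (snd p)) * h {fst p, snd p}"
  have fibre: "(\<Sum>p | p \<in> ?P \<and> ?f p = e. ?g p) = real (count G e) * h e" if e: "e \<in> ?f ` ?P" for e
  proof -
    from e obtain a b where ab: "a < n" "b < n" "e = {a, b}" by auto
    show ?thesis
    proof (cases "a = b")
      \<comment> \<open>A diagonal pair would stand for a loop: it carries no copies, and singletons
        are not edges.\<close>
      case True
      have "{p. p \<in> ?P \<and> ?f p = e} = {(a, a)}" using ab True by auto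
      moreover have "R a a = 0" using o ab by (simp add: orientation_def)
      moreover have "e \<notin># G" using G ab True unfolding graph_on_def by fastforce
      ultimately show ?thesis by (simp add: not_in_iff)
    next
      case False
      have "{p. p \<in> ?P \<and> ?f p = e} = {(a, b), (b, a)}" using ab by (auto simp: doubleton_eq_iff)
      moreover have "real (R a b) + real (R b a) = real (count G e)"
        using o ab False unfolding orientation_def by (metis of_nat_add)
      ultimately show ?thesis using False ab by (simp add: insert_commute flip: distrib_right)
    qed
  qed
  have "(\<Sum>e\<in>#G. h e) = (\<Sum>e\<in>set_mset G. real (count G e) * h e)" by (rule sum_mset_count)
  also have "\<dots> = (\<Sum>e\<in>?f ` ?P. real (count G e) * h e)"
  proof (rule sum.mono_neutral_left)
    show "set_mset G \<subseteq> ?f ` ?P"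
    proof
      fix e assume "e \<in># G"
      then obtain u v where "u < n" "v < n" "e = {u, v}" using G unfolding graph_on_def by blast
      then show "e \<in> ?f ` ?P" by (intro image_eqI[of _ _ "(u, v)"]) auto
    qed
  qed (auto simp: not_in_iff)
  also have "\<dots> = (\<Sum>e\<in>?f ` ?P. \<Sum>p | p \<in> ?P \<and> ?f p = e. ?g p)"
    by (intro sum.cong refl) (rule fibre[symmetric])
  also have "\<dots> = (\<Sum>p\<in>?P. ?g p)"
    by (rule sum.image_gen[symmetric]) simp
  also have "\<dots> = (\<Sum>u<n. \<Sum>v<n. real (R u v) * h {u, v})"
    by (simp add: sum.cartesian_product case_prod_unfold)
  finally show ?thesis .
qed

text \<open>Every copy directed into \<open>S\<close> has its tail in \<open>T\<close> and so lies
  within \<open>T\<close>. Since a copy has only one head, summing in-degrees over \<open>S\<close>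
  counts it once.\<close>

lemma edges_within_ge:
  assumes o: "orientation n G R" and G: "graph_on n G" and S: "S \<subseteq> {..<n}" and T: "T \<subseteq> {..<n}" "S \<subseteq> T"
    and tails: "\<And>u v. u < n \<Longrightarrow> v \<in> S \<Longrightarrow> 0 < R u v \<Longrightarrow> u \<in> T"
  shows "(\<Sum>v\<in>S. real (in_degree n R v)) \<le> real (size (filter_mset (\<lambda>e. e \<subseteq> T) G))"
proof -
  have "(\<Sum>v\<in>S. real (in_degree n R v)) = (\<Sum>v\<in>S. \<Sum>u<n. real (R u v))"
    by (simp add: in_degree_def)
  also have "\<dots> \<le> (\<Sum>v\<in>S. \<Sum>u<n. real (R u v) * of_bool ({u, v} \<subseteq> T))"
  proof (intro sum_mono)
    fix v u assume "v \<in> S" "u \<in> {..<n}"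
    then show "real (R u v) \<le> real (R u v) * of_bool ({u, v} \<subseteq> T)"
      using tails[of u v] T by (cases "R u v = 0") auto
  qed
  also have "\<dots> \<le> (\<Sum>v<n. \<Sum>u<n. real (R u v) * of_bool ({u, v} \<subseteq> T))"
    using S by (intro sum_mono2) (auto intro: sum_nonneg)
  also have "\<dots> = (\<Sum>u<n. \<Sum>v<n. real (R u v) * of_bool ({u, v} \<subseteq> T))"
    by (rule sum.swap)
  also have "\<dots> = (\<Sum>e\<in>#G. of_bool (e \<subseteq> T))"
    by (rule sum_over_orientation[OF o G, symmetric])
  also have "\<dots> = real (size (filter_mset (\<lambda>e. e \<subseteq> T) G))"
    by (induction G) auto
  finally show ?thesis .
qed

section \<open>Bounds for the linear program\<close>

lemma graph_onD: "graph_on n G \<Longrightarrow> \<forall>e\<in>#G. e \<noteq> {} \<and> e \<subseteq> {..<n}"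
  unfolding graph_on_def by auto

text \<open>Weak duality: an orientation is an integral dual solution. Each term of the objective is
  bounded by the value of \<open>x\<close> at the head of the edge, so vertex v collects its
  in-degree times \<open>x v\<close>, and the weight constraint finishes the estimate.\<close>

lemma opt_lp_le:
  assumes o: "orientation n G R" and G: "graph_on n G" and w: "\<forall>v<n. 1 \<le> w v"
    and \<mu>: "0 \<le> \<mu>" "\<And>v. v < n \<Longrightarrow> real (in_degree n R v) \<le> \<mu> * w v"
  shows "opt_lp n w G \<le> \<mu>"
  unfolding opt_lp_def
proof (rule cSup_least)
  show "{(\<Sum>e\<in>#G. Min (x ` e)) | x. lp_feasible n w x} \<noteq> {}"
    by (rule opt_lp_bounded(1)[OF w graph_onD[OF G]])
  fix r assume "r \<in> {(\<Sum>e\<in>#G. Min (x ` e)) | x. lp_feasible n w x}"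
  then obtain x where x: "lp_feasible n w x" and r: "r = (\<Sum>e\<in>#G. Min (x ` e))" by blast
  have "r = (\<Sum>u<n. \<Sum>v<n. real (R u v) * Min (x ` {u, v}))"
    unfolding r by (rule sum_over_orientation[OF o G])
  also have "\<dots> \<le> (\<Sum>u<n. \<Sum>v<n. real (R u v) * x v)"
    by (intro sum_mono mult_left_mono) auto
  also have "\<dots> = (\<Sum>v<n. real (in_degree n R v) * x v)"
    unfolding in_degree_def by (subst sum.swap) (simp add: sum_distrib_right)
  also have "\<dots> \<le> (\<Sum>v<n. \<mu> * w v * x v)"
    using x \<mu> by (intro sum_mono mult_right_mono) (auto simp: lp_feasible_def)
  also have "\<dots> = \<mu> * (\<Sum>v<n. w v * x v)"
    by (simp add: sum_distrib_left mult.assoc)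
  also have "\<dots> \<le> \<mu> * 1"
    using x \<mu> by (intro mult_left_mono) (auto simp: lp_feasible_def)
  finally show "r \<le> \<mu>" by simp
qed

lemma density_le_opt_lp:
  assumes G: "graph_on n G" and w: "\<forall>v<n. 1 \<le> w v" and S: "S \<subseteq> {..<n}" "S \<noteq> {}"
  shows "density w G S \<le> opt_lp n w G"
proof -
  have fin: "finite S" using S finite_subset by blast
  have wS: "0 < (\<Sum>v\<in>S. w v)" using S w fin by (intro sum_pos) (force+)
  \<comment> \<open>The multiple of the indicator of \<open>S\<close> that uses up the weight
    constraint; its objective value is the density of \<open>S\<close>.\<close>
  define x where "x = (\<lambda>v. if v \<in> S then 1 / (\<Sum>v\<in>S. w v) else 0)"
  have "(\<Sum>v<n. w v * x v) = (\<Sum>v\<in>S. w v * x v)"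
    using S by (intro sum.mono_neutral_right) (auto simp: x_def)
  also have "\<dots> = (\<Sum>v\<in>S. w v) / (\<Sum>v\<in>S. w v)"
    by (simp add: x_def flip: sum_divide_distrib)
  finally have feas: "lp_feasible n w x"
    using wS by (auto simp: lp_feasible_def x_def)
  have "Min (x ` e) = of_bool (e \<subseteq> S) / (\<Sum>v\<in>S. w v)" if e: "e \<in># G" for e
  proof -
    obtain u v where "e = {u, v}" using G e unfolding graph_on_def by blast
    then have "Min (x ` e) = min (x u) (x v)" by simp
    then show ?thesis using wS \<open>e = {u, v}\<close> by (auto simp: x_def min_def)
  qed
  then have "(\<Sum>e\<in>#G. Min (x ` e)) = (\<Sum>e\<in>#G. of_bool (e \<subseteq> S) / (\<Sum>v\<in>S. w v))"
    by (intro arg_cong[where f = sum_mset] image_mset_cong) auto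
  also have "\<dots> = density w G S"
    unfolding density_def by (induction G) (auto simp: add_divide_distrib)
  finally show ?thesis
    unfolding opt_lp_def using feas
    by (intro cSup_upper opt_lp_bounded(2)[OF w graph_onD[OF G]]) (auto intro!: exI[of _ x])
qed

text \<open>The recursion says that tau i + s is geometric with ratio 1 + 2 / s.\<close>

lemma tau_add:
  assumes "0 < s"
  shows "tau s (a + b) = (1 + 2 / real s) ^ b * tau s a + real s * ((1 + 2 / real s) ^ b - 1)"
proof (induction b)
  case (Suc b)
  define q where "q = 1 + 2 / real s"
  have "tau s (a + Suc b) = q * tau s (a + b) + 2"
    by (simp add: q_def algebra_simps)
  also have "2 = real s * (q - 1)"
    using assms by (simp add: q_def)
  finally have "tau s (a + Suc b) = q * tau s (a + b) + real s * (q - 1)" .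
  also have "\<dots> = q ^ Suc b * tau s a + real s * (q ^ Suc b - 1)"
    unfolding Suc[folded q_def] by (simp add: algebra_simps)
  finally show ?case by (simp only: q_def)
qed simp

text \<open>If the descent ends below level 5, the threshold reached is bounded by a constant and
  disappears in the additive error. For s = 2 the thresholds are 0, 2, 6, 14, 30.\<close>

lemma tau_below_5: "2 \<le> s \<Longrightarrow> t < 5 \<Longrightarrow> tau s t \<le> 30"
proof -
  assume s: "2 \<le> s" and t: "t < 5"
  have step: "tau s (Suc i) \<le> 2 * tau s i + 2" for i
  proof -
    define q where "q = tau s i / real s"
    have "q \<le> tau s i / 2"
      unfolding q_def using s tau_nonneg by (intro divide_left_mono) auto
    moreover have "tau s (Suc i) = tau s i + 2 * q + 2"
      by (simp add: q_def)
    ultimately show ?thesis by linarith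
  qed
  have "tau s t \<le> tau s 4" using t by (intro tau_mono) auto
  also have "tau s 4 \<le> 30"
    using step[of 0] step[of 1] step[of 2] step[of 3] by (simp add: eval_nat_numeral del: tau.simps(2))
  finally show ?thesis .
qed

text \<open>Counts factors 1 + y by a logarithm, from ln (1 + y) >= y / 2. It is used with y =
  \<epsilon> / 4 for the steps of the descent and with y = 2 / s for the number of levels.\<close>

lemma of_nat_le_ln_ratio:
  fixes y z :: real
  assumes "0 < y" "y \<le> 1 / 2" "(1 + y) ^ i \<le> z"
  shows "real i * y / 2 \<le> ln z"
proof -
  have "y / 2 \<le> y - y\<^sup>2" using assms by (simp add: power2_eq_square field_simps)
  also have "\<dots> \<le> ln (1 + y)" using assms by (intro ln_one_plus_pos_lower_bound) auto
  finally have "real i * (y / 2) \<le> real i * ln (1 + y)" by (intro mult_left_mono) auto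
  also have "\<dots> = ln ((1 + y) ^ i)" using assms by (simp add: ln_realpow)
  also have "\<dots> \<le> ln z"
    using assms zero_less_power[of "1 + y" i] by (subst ln_le_cancel_iff) linarith+
  finally show ?thesis by simp
qed

lemma ln_le_lg: "1 \<le> z \<Longrightarrow> ln z \<le> lg z"
proof -
  assume z: "1 \<le> z"
  have "ln z = ln 2 * log 2 z" by (simp add: log_def)
  also have "\<dots> \<le> 1 * log 2 z"
    using z ln_2_less_1 by (intro mult_right_mono) auto
  finally show ?thesis by (simp add: lg_def)
qed

text \<open>Over at most s / 2 levels the geometric growth stays linear up to a factor of 2, as exp
  z <= 1 + 2 z on the unit interval.\<close>

lemma growth_bound:
  fixes x :: real
  assumes "0 < s" "2 * real b \<le> real s"
  shows "(1 + 2 / real s) ^ b \<le> 1 + 4 * real b / real s"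
proof -
  have "(1 + 2 / real s) ^ b \<le> exp (2 / real s) ^ b"
    by (intro power_mono exp_ge_add_one_self) auto
  also have "\<dots> = exp (2 * real b / real s)"
    by (simp add: exp_of_nat_mult[symmetric] mult.commute)
  also have "\<dots> \<le> 1 + 2 * (2 * real b / real s)"
  proof -
    have "exp z \<le> 1 + 2 * z" if "0 \<le> z" "z \<le> 1" for z :: real
    proof -
      have "exp z \<le> 1 + z + z\<^sup>2" using that by (intro exp_bound) auto
      moreover have "z\<^sup>2 \<le> z" using that by (simp add: power2_eq_square mult_left_le)
      ultimately show ?thesis by linarith
    qed
    from this[of "2 * real b / real s"] show ?thesis using assms by simp
  qed
  finally show ?thesis by (simp add: mult.assoc)
qed


section \<open>Level sets of large density\<close>

definition level_set :: "nat \<Rightarrow> (nat \<Rightarrow> nat) \<Rightarrow> nat \<Rightarrow> nat set" where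
  "level_set n lev j = {v. v < n \<and> j \<le> lev v}"

definition level_weight :: "nat \<Rightarrow> (nat \<Rightarrow> real) \<Rightarrow> (nat \<Rightarrow> nat) \<Rightarrow> nat \<Rightarrow> real" where
  "level_weight n w lev j = (\<Sum>v\<in>level_set n lev j. w v)"

lemma finite_level_set [simp]: "finite (level_set n lev j)"
  by (simp add: level_set_def)

lemma level_set_0 [simp]: "level_set n lev 0 = {..<n}"
  by (auto simp: level_set_def)

lemma level_density:
  assumes core: "core n w s R K lev deg rem" and o: "orientation n G (orient_of n R)"
    and G: "graph_on n G" and w: "\<forall>v<n. 1 \<le> w v" and deg: "\<forall>v<n. ind n R v = deg v"
  shows "tau s t * level_weight n w lev t
    \<le> real (size (filter_mset (\<lambda>e. e \<subseteq> level_set n lev (t - 5)) G))"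
proof -
  have "tau s t * level_weight n w lev t = (\<Sum>v\<in>level_set n lev t. tau s t * w v)"
    by (simp add: level_weight_def sum_distrib_left)
  also have "\<dots> \<le> (\<Sum>v\<in>level_set n lev t. real (in_degree n (orient_of n R) v))"
  proof (rule sum_mono)
    fix v assume v: "v \<in> level_set n lev t"
    then have "tau s t * w v \<le> tau s (lev v) * w v"
      using w by (intro mult_right_mono tau_mono) (auto simp: level_set_def intro: order_trans[of 0 1])
    also have "\<dots> \<le> real (deg v)"
      using core v by (simp add: core_def vertex_inv_def level_set_def mult.commute)
    finally show "tau s t * w v \<le> real (in_degree n (orient_of n R) v)"
      using v deg by (simp add: level_set_def flip: ind_eq_in_degree)
  qed
  also have "\<dots> \<le> real (size (filter_mset (\<lambda>e. e \<subseteq> level_set n lev (t - 5)) G))"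
  proof (rule edges_within_ge[OF o G])
    fix u v assume u: "u < n" and v: "v \<in> level_set n lev t" and R: "0 < R (u * n + v)"
    then have "K (u * n + v) \<le> lev u + 3 \<and> lev v \<le> K (u * n + v) + 2"
      using core edge_less[of u n v] unfolding core_def edge_inv_def
      by (metis (mono_tags, lifting) edge_id level_set_def mem_Collect_eq)
    then have "lev v \<le> lev u + 5" by linarith
    then show "u \<in> level_set n lev (t - 5)"
      using u v by (auto simp: level_set_def)
  qed (auto simp: level_set_def)
  finally show ?thesis .
qed

lemma chosen_level_guarantee:
  fixes \<epsilon> L \<mu> :: real
  assumes core: "core n w s R K lev deg rem" and o: "orientation n G (orient_of n R)"
    and G: "graph_on n G" and w: "\<forall>v<n. 1 \<le> w v" and deg: "\<forall>v<n. ind n R v = deg v"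
    and eps: "0 < \<epsilon>" "\<epsilon> < 1" and L: "1 \<le> L" "ln (level_weight n w lev 0) \<le> L"
    and s: "1000 * L / \<epsilon>\<^sup>2 \<le> real s"
    and top: "t + 5 * i = T" "\<forall>v<n. lev v \<le> T" "level_set n lev T \<noteq> {}"
    and growth: "(1 + \<epsilon> / 4) ^ i * level_weight n w lev T \<le> level_weight n w lev t"
    and stop: "t < 5 \<or> level_weight n w lev (t - 5) \<le> (1 + \<epsilon> / 4) * level_weight n w lev t"
  defines "\<mu> \<equiv> max_load n w (orient_of n R)" and "S \<equiv> level_set n lev (t - 5)"
  shows "\<mu> \<le> (1 + \<epsilon>) * opt_lp n w G + 300 * L / \<epsilon>"
    and "(1 - \<epsilon>) * opt_lp n w G - 300 * L / \<epsilon> \<le> density w G S"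
proof -
  let ?W = "level_weight n w lev"
  have w0: "0 \<le> w v" if "v < n" for v using w that by force
  have W_mono: "?W b \<le> ?W a" if "a \<le> b" for a b
    unfolding level_weight_def using that w0 by (intro sum_mono2) (auto simp: level_set_def)
  have W1: "1 \<le> ?W j" if "j \<le> T" for j
  proof -
    obtain v where v: "v \<in> level_set n lev T" using top by blast
    then have "w v \<le> ?W T"
      unfolding level_weight_def using w0 by (intro member_le_sum) (auto simp: level_set_def)
    then show ?thesis using W_mono[OF that] w v by (force simp: level_set_def)
  qed
  have n0: "0 < n" using top by (auto simp: level_set_def)
  have tT: "t \<le> T" using top by simp
  have S: "S \<subseteq> {..<n}" "S \<noteq> {}"
    using top tT by (auto simp: S_def level_set_def)
  have \<rho>0: "0 \<le> density w G S"
    unfolding density_def using S w0 by (intro divide_nonneg_nonneg sum_nonneg) auto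
  \<comment> \<open>All loads lie below the threshold of \<open>T + 1\<close>, which is
    \<open>5 * i + 1\<close> levels above \<open>t\<close>.\<close>
  define b where "b = 5 * i + 1"
  \<comment> \<open>Each of the \<open>i\<close> steps contributes a factor 1 + \<epsilon> / 4 to
    the weight. It starts with at least 1, as the top level is occupied, and ends with at most the
    total weight, whose logarithm is at most \<open>L\<close>.\<close>
  have i: "real i \<le> 8 * L / \<epsilon>"
  proof -
    have "(1 + \<epsilon> / 4) ^ i * 1 \<le> (1 + \<epsilon> / 4) ^ i * ?W T"
      using W1[of T] eps by (intro mult_left_mono) auto
    also have "\<dots> \<le> ?W 0" using growth W_mono[of 0 t] by simp
    finally have "real i * (\<epsilon> / 4) / 2 \<le> ln (?W 0)"
      using eps by (intro of_nat_le_ln_ratio) auto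
    then have "real i * (\<epsilon> / 4) / 2 \<le> L" using L by simp
    then show ?thesis using eps by (simp add: field_simps)
  qed
  have L\<epsilon>: "1 \<le> L / \<epsilon>" using L eps by (simp add: field_simps)
  have bL: "real b \<le> 41 * (L / \<epsilon>)" using i L\<epsilon> by (simp add: b_def)
  have s': "1000 * (L / \<epsilon>) \<le> real s * \<epsilon>" using s eps by (simp add: field_simps power2_eq_square)
  have "real s * \<epsilon> \<le> real s * 1" using eps by (intro mult_left_mono) auto
  then have s1: "1000 * (L / \<epsilon>) \<le> real s" using s' by linarith
  then have s2: "2 \<le> s" "0 < s" using L\<epsilon> by linarith+
  define q where "q = (1 + 2 / real s) ^ b"
  have "q \<le> 1 + 4 * real b / real s"
    unfolding q_def by (rule growth_bound) (use s1 s2 bL L\<epsilon> in linarith)+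
  then have "real s * (q - 1) \<le> 4 * real b"
    using s2 by (simp add: field_simps)
  \<comment> \<open>The origin of the constant 1000: four times 41 L / \<epsilon> has to be at most
    (\<epsilon> / 4) s, that is, s must be at least 656 L / \<epsilon>^2.\<close>
  moreover have "4 * real b / real s \<le> \<epsilon> / 4"
  proof -
    have "4 * real b \<le> (\<epsilon> / 4) * real s" using bL s' by (simp add: mult.commute)
    then show ?thesis using s2 by (simp add: pos_divide_le_eq)
  qed
  ultimately have q: "q \<le> 1 + \<epsilon> / 4" "real s * (q - 1) \<le> 4 * real b"
    using \<open>q \<le> 1 + 4 * real b / real s\<close> by linarith+
  have load: "real (in_degree n (orient_of n R) v) < tau s (T + 1) * w v" if v: "v < n" for v
  proof -
    have "real (deg v) < w v * tau s (lev v + 1)"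
      using core v by (simp add: core_def vertex_inv_def)
    also have "\<dots> \<le> w v * tau s (T + 1)"
      using top v w0 by (intro mult_left_mono tau_mono) auto
    finally show ?thesis using v deg by (simp add: mult.commute flip: ind_eq_in_degree)
  qed
  have opt: "opt_lp n w G \<le> \<mu>"
  proof (rule opt_lp_le[OF o G w])
    show "real (in_degree n (orient_of n R) v) \<le> \<mu> * w v" if v: "v < n" for v
    proof -
      have "load n w (orient_of n R) v \<le> \<mu>"
        unfolding \<mu>_def max_load_def using v by (intro Max_ge) auto
      then show ?thesis using w v by (simp add: load_def pos_divide_le_eq order_less_le_trans[of 0 1])
    qed
    have "0 \<le> load n w (orient_of n R) 0" using w0[OF n0] by (simp add: load_def)
    also have "\<dots> \<le> \<mu>" unfolding \<mu>_def max_load_def using n0 by (intro Max_ge) auto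
    finally show "0 \<le> \<mu>" .
  qed
  have "\<mu> \<le> tau s (T + 1)"
    unfolding \<mu>_def max_load_def
  proof (intro iffD2[OF Max_le_iff] ballI)
    fix r assume "r \<in> load n w (orient_of n R) ` {..<n}"
    then obtain v where v: "v < n" "r = load n w (orient_of n R) v" by auto
    then show "r \<le> tau s (T + 1)"
      using load[of v] w by (simp add: load_def pos_divide_le_eq order_less_le_trans[of 0 1] del: tau.simps)
  qed (use n0 in auto)
  also have "tau s (T + 1) = q * tau s t + real s * (q - 1)"
    using tau_add[OF s2(2), of t b] top(1) by (simp add: q_def b_def add.commute add.left_commute del: tau.simps)
  also have "\<dots> \<le> (1 + \<epsilon> / 4) * tau s t + 164 * (L / \<epsilon>)"
    using q bL tau_nonneg[of s t] by (intro add_mono mult_right_mono) auto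
  also have "\<dots> \<le> (1 + \<epsilon>) * density w G S + 300 * (L / \<epsilon>)"
  proof (cases "t < 5")
    \<comment> \<open>Here the density may be 0. The threshold contributes at most 75 / 2, which
      fits into the gap between 164 and 300.\<close>
    case True
    have "(1 + \<epsilon> / 4) * tau s t \<le> (1 + 1 / 4) * 30"
      using eps tau_below_5[OF s2(1) True] tau_nonneg[of s t] by (intro mult_mono) auto
    then have "(1 + \<epsilon> / 4) * tau s t \<le> 75 / 2" by simp
    moreover have "0 \<le> (1 + \<epsilon>) * density w G S" using \<rho>0 eps by simp
    ultimately show ?thesis using L\<epsilon> by linarith
  next
    case False
    then have st: "?W (t - 5) \<le> (1 + \<epsilon> / 4) * ?W t" using stop by simp
    have "t - 5 \<le> T" using tT by simp
    then have W0: "0 < ?W (t - 5)" "0 < ?W t"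
      using W1[of "t - 5"] W1[of t] tT by simp_all
    have "tau s t * ?W t \<le> density w G S * ?W (t - 5)"
      using level_density[OF core o G w deg, of t] W0
      by (simp add: density_def S_def level_weight_def)
    also have "\<dots> \<le> density w G S * ((1 + \<epsilon> / 4) * ?W t)"
      using \<rho>0 st by (intro mult_left_mono)
    finally have "tau s t \<le> density w G S * (1 + \<epsilon> / 4)" using W0 by (simp flip: mult.assoc)
    then have "(1 + \<epsilon> / 4) * tau s t \<le> (1 + \<epsilon> / 4) * (density w G S * (1 + \<epsilon> / 4))"
      using eps by (intro mult_left_mono) auto
    also have "\<dots> = (1 + \<epsilon> / 4)\<^sup>2 * density w G S" by (simp add: power2_eq_square)
    \<comment> \<open>One factor 1 + \<epsilon> / 4 comes from the levels above \<open>t\<close>,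
      the other from the growth of weight at the last step; their product is at most 1 + \<epsilon>
      for \<epsilon> below 1.\<close>
    also have "\<dots> \<le> (1 + \<epsilon>) * density w G S"
      using \<rho>0 eps by (intro mult_right_mono) (auto simp: power2_eq_square field_simps)
    finally show ?thesis using L\<epsilon> by linarith
  qed
  finally have main: "\<mu> \<le> (1 + \<epsilon>) * density w G S + 300 * L / \<epsilon>" by simp
  have "(1 + \<epsilon>) * density w G S \<le> (1 + \<epsilon>) * opt_lp n w G"
    using density_le_opt_lp[OF G w S] eps by (intro mult_left_mono) auto
  then show "\<mu> \<le> (1 + \<epsilon>) * opt_lp n w G + 300 * L / \<epsilon>" using main by linarith
  \<comment> \<open>For the lower bound, multiply by 1 - \<epsilon> and use (1 - \<epsilon>) (1 +
    \<epsilon>) <= 1.\<close>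
  have "(1 - \<epsilon>) * opt_lp n w G \<le> (1 - \<epsilon>) * ((1 + \<epsilon>) * density w G S + 300 * L / \<epsilon>)"
    using opt main eps by (intro mult_left_mono) auto
  also have "\<dots> = density w G S - \<epsilon>\<^sup>2 * density w G S + (1 - \<epsilon>) * (300 * L / \<epsilon>)"
    by (simp add: algebra_simps power2_eq_square)
  also have "\<dots> \<le> density w G S + 1 * (300 * L / \<epsilon>)"
  proof -
    have "(1 - \<epsilon>) * (300 * L / \<epsilon>) \<le> 1 * (300 * L / \<epsilon>)"
      using eps L by (intro mult_right_mono) auto
    moreover have "0 \<le> \<epsilon>\<^sup>2 * density w G S" using \<rho>0 by simp
    ultimately show ?thesis by linarith
  qed
  finally show "(1 - \<epsilon>) * opt_lp n w G - 300 * L / \<epsilon> \<le> density w G S" by simp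
qed


subsection \<open>Vertices sorted by level\<close>

text \<open>\<open>ord\<close> lists the vertices by decreasing level, and \<open>cge j\<close> is the number of those of level at least \<open>j\<close>.\<close>

definition ordered ::
  "nat \<Rightarrow> (nat \<Rightarrow> nat) \<Rightarrow> (nat \<Rightarrow> nat) \<Rightarrow> (nat \<Rightarrow> nat) \<Rightarrow> (nat \<Rightarrow> nat) \<Rightarrow> bool" where
  "ordered n lev ord pos cge \<longleftrightarrow>
     (\<forall>i<n. ord i < n \<and> pos (ord i) = i) \<and> (\<forall>v<n. pos v < n \<and> ord (pos v) = v) \<and>
     (\<forall>v<n. \<forall>j. pos v < cge j \<longleftrightarrow> j \<le> lev v) \<and> (\<forall>j. cge j \<le> n)"

text \<open>Position \<open>cge j\<close> holds the first vertex \<open>y\<close> of the level that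
  \<open>c\<close> leaves. After \<open>c\<close> and \<open>y\<close> are swapped, extending the
  prefix for \<open>j\<close> by one cell adds exactly \<open>c\<close>.\<close>

lemma ordered_up:
  assumes ord: "ordered n lev ord pos cge" and c: "c < n" and j: "j = Suc (lev c)"
    and m: "m = cge j" and y: "y = ord m" and p: "p = pos c"
  shows "ordered n (lev(c := j)) (ord(p := y, m := c)) (pos(y := p, c := m)) (cge(j := Suc m))"
    and "m < n" "y < n" "p < n"
proof -
  have 1: "ord i < n" "pos (ord i) = i" if "i < n" for i using ord that by (auto simp: ordered_def)
  have 2: "pos v < n" "ord (pos v) = v" if "v < n" for v using ord that by (auto simp: ordered_def)
  have 3: "pos v < cge i \<longleftrightarrow> i \<le> lev v" if "v < n" for v i using ord that by (auto simp: ordered_def)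
  have 4: "cge i \<le> n" for i using ord by (auto simp: ordered_def)
  have mp: "m \<le> p" using 3[OF c, of j] j m p by auto
  show pn: "p < n" using 2(1)[OF c] p by simp
  then show mn: "m < n" using mp by simp
  then show yn: "y < n" using 1 y by simp
  have posy: "pos y = m" using 1(2)[OF mn] y by simp
  have levy: "lev y = lev c"
  proof (rule antisym)
    show "lev y \<le> lev c" using 3[OF yn, of j] posy m j by auto
    have "p < cge (lev c)" using 3[OF c] p by simp
    then show "lev c \<le> lev y" using 3[OF yn, of "lev c"] posy mp by simp
  qed
  \<comment> \<open>Both positions lie on the same side of every old prefix boundary, so the swap
    alone disturbs none of them.\<close>
  have eqp: "m < cge i \<longleftrightarrow> p < cge i" for i
    using 3[OF yn, of i] 3[OF c, of i] posy p levy by simp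
  show "ordered n (lev(c := j)) (ord(p := y, m := c)) (pos(y := p, c := m)) (cge(j := Suc m))"
    unfolding ordered_def
  proof (intro conjI allI impI)
    fix i assume i: "i < n"
    show "(ord(p := y, m := c)) i < n" using 1(1)[OF i] yn c by simp
    show "(pos(y := p, c := m)) ((ord(p := y, m := c)) i) = i"
      using 1[OF i] posy p 2[OF c] by (auto)
  next
    fix v assume v: "v < n"
    show "(pos(y := p, c := m)) v < n" using 2(1)[OF v] mn pn by simp
    show "(ord(p := y, m := c)) ((pos(y := p, c := m)) v) = v"
      using 2[OF v] posy p y 2[OF c] 1[OF mn] by auto
    fix i
    have "v \<noteq> y \<Longrightarrow> pos v \<noteq> m" using 2(2)[OF v] y by auto
    moreover have "y \<noteq> c \<Longrightarrow> p \<noteq> m" using posy p 2[OF c] 2[OF yn] by auto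
    ultimately show "(pos(y := p, c := m)) v < (cge(j := Suc m)) i \<longleftrightarrow> i \<le> (lev(c := j)) v"
      using 3[OF v, of i] 3[OF c, of i] 3[OF yn, of i] eqp[of i] levy posy p m j mp
      by (cases "v = c"; cases "v = y"; cases "i = j") auto
  next
    fix i show "(cge(j := Suc m)) i \<le> n" using 4 mn by auto
  qed
qed

text \<open>Here \<open>c\<close> is swapped with the last vertex of the level that it leaves, and
  the prefix for that level is shortened by one cell.\<close>

lemma ordered_down:
  assumes ord: "ordered n lev ord pos cge" and c: "c < n" and j: "lev c = Suc j"
    and m: "m = cge (Suc j) - 1" and y: "y = ord m" and p: "p = pos c"
  shows "ordered n (lev(c := j)) (ord(p := y, m := c)) (pos(y := p, c := m)) (cge(Suc j := m))"
    and "m < n" "y < n" "p < n"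
proof -
  have 1: "ord i < n" "pos (ord i) = i" if "i < n" for i using ord that by (auto simp: ordered_def)
  have 2: "pos v < n" "ord (pos v) = v" if "v < n" for v using ord that by (auto simp: ordered_def)
  have 3: "pos v < cge i \<longleftrightarrow> i \<le> lev v" if "v < n" for v i using ord that by (auto simp: ordered_def)
  have 4: "cge i \<le> n" for i using ord by (auto simp: ordered_def)
  have "p < cge (Suc j)" using 3[OF c, of "Suc j"] j p by auto
  then have mp: "p \<le> m" "cge (Suc j) = Suc m" using m by simp_all
  show pn: "p < n" using 2(1)[OF c] p by simp
  show mn: "m < n" using mp(2) 4[of "Suc j"] by simp
  then show yn: "y < n" using 1 y by simp
  have posy: "pos y = m" using 1(2)[OF mn] y by simp
  have levy: "lev y = lev c"
  proof (rule antisym)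
    show "lev c \<le> lev y" using 3[OF yn, of "Suc j"] posy mp j by auto
    have "\<not> p < cge (Suc (Suc j))" using 3[OF c, of "Suc (Suc j)"] p j by simp
    then have "\<not> m < cge (Suc (Suc j))" using mp(1) by simp
    then show "lev y \<le> lev c" using 3[OF yn, of "Suc (Suc j)"] posy j by simp
  qed
  have eqp: "m < cge i \<longleftrightarrow> p < cge i" for i
    using 3[OF yn, of i] 3[OF c, of i] posy p levy by simp
  show "ordered n (lev(c := j)) (ord(p := y, m := c)) (pos(y := p, c := m)) (cge(Suc j := m))"
    unfolding ordered_def
  proof (intro conjI allI impI)
    fix i assume i: "i < n"
    show "(ord(p := y, m := c)) i < n" using 1(1)[OF i] yn c by simp
    show "(pos(y := p, c := m)) ((ord(p := y, m := c)) i) = i"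
      using 1[OF i] posy p 2[OF c] by (auto)
  next
    fix v assume v: "v < n"
    show "(pos(y := p, c := m)) v < n" using 2(1)[OF v] mn pn by simp
    show "(ord(p := y, m := c)) ((pos(y := p, c := m)) v) = v"
      using 2[OF v] posy p y 2[OF c] 1[OF mn] by auto
    fix i
    have vy: "v \<noteq> y \<Longrightarrow> pos v \<noteq> m" using 2(2)[OF v] y by auto
    have yc: "y \<noteq> c \<Longrightarrow> p \<noteq> m" using posy p 2[OF c] 2[OF yn] by auto
    show "(pos(y := p, c := m)) v < (cge(Suc j := m)) i \<longleftrightarrow> i \<le> (lev(c := j)) v"
    proof (cases "v = c")
      case True
      then show ?thesis using 3[OF c, of i] eqp[of i] p j by auto
    next
      case False
      then show ?thesis
        using 3[OF v, of i] 3[OF c, of i] levy p j mp vy yc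
        by (cases "v = y"; cases "i = Suc j") (simp_all, linarith+)
    qed
  next
    fix i show "(cge(Suc j := m)) i \<le> n" using 4 mn by (auto intro: less_imp_le)
  qed
qed

lemma level_weight_up:
  assumes "c < n"
  shows "level_weight n w (lev(c := Suc (lev c))) i =
    level_weight n w lev i + (if i = Suc (lev c) then w c else 0)"
proof (cases "i = Suc (lev c)")
  case True
  have "level_set n (lev(c := Suc (lev c))) i = insert c (level_set n lev i)" "c \<notin> level_set n lev i"
    using assms True by (auto simp: level_set_def)
  then show ?thesis using True by (simp add: level_weight_def)
next
  case False
  have "level_set n (lev(c := Suc (lev c))) i = level_set n lev i"
    using assms False by (auto simp: level_set_def)
  then show ?thesis using False by (simp add: level_weight_def)
qed

lemma level_weight_down:
  assumes "c < n" "lev c = Suc j"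
  shows "level_weight n w (lev(c := j)) i = level_weight n w lev i - (if i = lev c then w c else 0)"
proof -
  have eq: "(lev(c := j))(c := Suc ((lev(c := j)) c)) = lev" using assms(2) by auto
  show ?thesis
    using level_weight_up[OF assms(1), of w "lev(c := j)" i] unfolding eq by (simp add: assms(2))
qed

text \<open>\<open>lo\<close> and \<open>hi\<close> cache the two thresholds around each vertex.
  Computing tau from the level would take time proportional to the level, whereas a move to a
  neighbouring level needs one application of the recursion or of its inverse.\<close>

definition levels_rep :: "nat \<Rightarrow> (nat \<Rightarrow> real) \<Rightarrow> nat \<Rightarrow> state \<Rightarrow> bool" where
  "levels_rep n w sc s \<longleftrightarrow>
     ordered n (nmem s ''lev'') (nmem s ''ord'') (nmem s ''pos'') (nmem s ''cge'') \<and>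
     (\<forall>j. rmem s ''wge'' j = level_weight n w (nmem s ''lev'') j) \<and>
     (\<forall>v<n. rmem s ''lo'' v = tau sc (nmem s ''lev'' v) \<and> rmem s ''hi'' v = tau sc (nmem s ''lev'' v + 1))"

definition swap_order :: com where
  "swap_order = block
    [assign ''y'' (NGet ''ord'' (V ''m'')),
     assign ''p'' (NGet ''pos'' (V ''c'')),
     NPut ''ord'' (V ''p'') (V ''y''),
     NPut ''pos'' (V ''y'') (V ''p''),
     NPut ''ord'' (V ''m'') (V ''c''),
     NPut ''pos'' (V ''c'') (V ''m'')]"

definition level_up :: com where
  "level_up = block
    [assign ''m'' (NGet ''cge'' (V ''j'')),
     swap_order,
     NPut ''cge'' (V ''j'') (NAdd (V ''m'') (NLit 1)),
     RPut ''wge'' (V ''j'') (RAdd (RGet ''wge'' (V ''j'')) (RGet ''w'' (V ''c''))),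
     NPut ''lev'' (V ''c'') (V ''j''),
     RPut ''lo'' (V ''c'') (RGet ''hi'' (V ''c'')),
     RPut ''hi'' (V ''c'') (RAdd (RGet ''hi'' (V ''c''))
       (RMul (ROfNat (NLit 2)) (RAdd (RDiv (RGet ''hi'' (V ''c'')) (ROfNat (V ''s''))) (ROfNat (NLit 1)))))]"

definition level_down :: com where
  "level_down = block
    [assign ''j'' (NGet ''lev'' (V ''c'')),
     assign ''m'' (NSub (NGet ''cge'' (V ''j'')) (NLit 1)),
     swap_order,
     NPut ''cge'' (V ''j'') (V ''m''),
     RPut ''wge'' (V ''j'') (RSub (RGet ''wge'' (V ''j'')) (RGet ''w'' (V ''c''))),
     NPut ''lev'' (V ''c'') (NSub (V ''j'') (NLit 1)),
     RPut ''hi'' (V ''c'') (RGet ''lo'' (V ''c'')),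
     RPut ''lo'' (V ''c'') (RDiv (RMul (RSub (RGet ''lo'' (V ''c'')) (ROfNat (NLit 2))) (ROfNat (V ''s'')))
       (ROfNat (NAdd (V ''s'') (NLit 2))))]"

abbreviation level_arrays :: "string set" where
  "level_arrays \<equiv> {''m'', ''y'', ''p'', ''ord'', ''pos'', ''cge'', ''lev''}"

abbreviation level_reals :: "string set" where
  "level_reals \<equiv> {''wge'', ''lo'', ''hi''}"

lemma runs_swap_order:
  assumes "nmem s ''c'' 0 = c" "nmem s ''m'' 0 = m" "y = nmem s ''ord'' m" "p = nmem s ''pos'' c"
    and "c \<le> b" "m \<le> b" "y \<le> b" "p \<le> b"
  shows "runs b swap_order s (\<lambda>t s'. t = 6 \<and> nmem s' ''ord'' = (nmem s ''ord'')(p := y, m := c) \<and>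
    nmem s' ''pos'' = (nmem s ''pos'')(y := p, c := m) \<and> frame {''y'', ''p'', ''ord'', ''pos''} {} s s')"
  unfolding swap_order_def
  apply (simp add: runs_simps assms(1,2) assms(3,4)[symmetric])
  using assms(5-8) by (simp add: frame_nput frame_refl)

text \<open>The inverse of the recursion, with which \<open>level_down\<close> computes the new
  lower threshold in constant time.\<close>

lemma tau_down: "0 < s \<Longrightarrow> (tau s (Suc j) - 2) * real s / real (s + 2) = tau s j"
proof -
  assume s: "0 < s"
  have "tau s (Suc j) - 2 = tau s j * (real (s + 2) / real s)"
    using s by (simp add: field_simps)
  then show ?thesis using s by (simp del: tau.simps)
qed

lemma runs_level_up:
  assumes c: "nmem s ''c'' 0 = c" "c < n" and j: "nmem s ''j'' 0 = Suc (nmem s ''lev'' c)"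
    and sc: "nmem s ''s'' 0 = sc" "0 < sc" and w: "rmem s ''w'' c = w c"
    and rep: "levels_rep n w sc s" and b: "n \<le> b" "Suc (nmem s ''lev'' c) \<le> b"
  shows "runs b level_up s (\<lambda>t s'. t = 12 \<and> nmem s' ''lev'' = (nmem s ''lev'')(c := Suc (nmem s ''lev'' c)) \<and>
    levels_rep n w sc s' \<and> frame level_arrays level_reals s s')"
proof -
  define lev where "lev = nmem s ''lev''"
  define l where "l = Suc (lev c)"
  define m where "m = nmem s ''cge'' l"
  define y where "y = nmem s ''ord'' m"
  define p where "p = nmem s ''pos'' c"
  have ord: "ordered n lev (nmem s ''ord'') (nmem s ''pos'') (nmem s ''cge'')"
    using rep by (simp add: levels_rep_def lev_def)
  note up = ordered_up[OF ord c(2) l_def m_def y_def p_def]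
  define s1 where "s1 = nput ''m'' 0 m s"
  have s1: "nmem s1 ''c'' 0 = c" "nmem s1 ''m'' 0 = m" "y = nmem s1 ''ord'' m" "p = nmem s1 ''pos'' c"
    using c by (simp_all add: s1_def y_def p_def)
  have jl: "nmem s ''j'' 0 = l" using j by (simp add: l_def lev_def)
  have 1: "runs b (assign ''m'' (NGet ''cge'' (V ''j''))) s (\<lambda>t s'. t = 1 \<and> s' = s1)"
    using up(2) b by (simp add: runs_NPut s1_def jl m_def)
  have 2: "runs b swap_order s1 (\<lambda>t s'. t = 6 \<and> nmem s' ''ord'' = (nmem s1 ''ord'')(p := y, m := c) \<and>
    nmem s' ''pos'' = (nmem s1 ''pos'')(y := p, c := m) \<and> frame {''y'', ''p'', ''ord'', ''pos''} {} s1 s')"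
    by (rule runs_swap_order[OF s1]) (use up(2-4) c b in simp_all)
  show ?thesis
    unfolding level_up_def block.simps
  proof (rule runs_SequI[OF 1], elim conjE, hypsubst, rule runs_SequI[OF 2], elim conjE, hypsubst)
    fix t s2
    assume o: "nmem s2 ''ord'' = (nmem s1 ''ord'')(p := y, m := c)"
      and po: "nmem s2 ''pos'' = (nmem s1 ''pos'')(y := p, c := m)"
      and fr: "frame {''y'', ''p'', ''ord'', ''pos''} {} s1 s2"
    have eqs: "nmem s2 ''j'' 0 = l" "nmem s2 ''c'' 0 = c" "nmem s2 ''m'' 0 = m" "nmem s2 ''s'' 0 = sc"
      "nmem s2 ''cge'' = nmem s ''cge''" "nmem s2 ''lev'' = lev" "rmem s2 = rmem s"
      "nmem s2 ''ord'' = (nmem s ''ord'')(p := y, m := c)"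
      "nmem s2 ''pos'' = (nmem s ''pos'')(y := p, c := m)"
      using fr jl c sc o po by (simp_all add: frame_def s1_def lev_def fun_eq_iff)
    have fr2: "frame level_arrays level_reals s s2"
      using fr by (auto simp: frame_def s1_def)
    have bb: "l \<le> b" "Suc m \<le> b" "c \<le> b" using b up(2) c by (simp_all add: l_def lev_def)
    have hl: "rmem s ''hi'' c = tau sc l" using rep c(2) by (simp add: levels_rep_def l_def lev_def)
    have wg: "rmem s ''wge'' i = level_weight n w lev i" for i using rep by (simp add: levels_rep_def lev_def)
    define h where "h = tau sc l + (2 * tau sc l / real sc + 2)"
    have h: "tau sc (Suc l) = h" by (simp add: h_def)
    define s3 where "s3 = rput ''hi'' c h (rput ''lo'' c (tau sc l) (nput ''lev'' c l
      (rput ''wge'' l (level_weight n w lev l + w c) (nput ''cge'' l (Suc m) s2))))"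
    have rep3: "levels_rep n w sc s3"
      unfolding levels_rep_def
    proof (intro conjI allI impI)
      show "ordered n (nmem s3 ''lev'') (nmem s3 ''ord'') (nmem s3 ''pos'') (nmem s3 ''cge'')"
        using up(1) by (simp add: s3_def eqs m_def[symmetric])
      show "rmem s3 ''wge'' i = level_weight n w (nmem s3 ''lev'') i" for i
        using level_weight_up[OF c(2), of w lev i] wg[of i]
        by (simp add: s3_def eqs l_def)
    next
      fix v assume v: "v < n"
      then have "rmem s ''lo'' v = tau sc (lev v)" "rmem s ''hi'' v = tau sc (lev v + 1)"
        using rep by (simp_all add: levels_rep_def lev_def)
      then show "rmem s3 ''lo'' v = tau sc (nmem s3 ''lev'' v)"
        "rmem s3 ''hi'' v = tau sc (nmem s3 ''lev'' v + 1)"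
        by (simp_all add: s3_def eqs h del: tau.simps)
    qed
    have fr3: "frame level_arrays level_reals s s3" "nmem s3 ''lev'' = lev(c := l)"
      using fr2 by (simp_all add: s3_def frame_nput frame_rput eqs)
    show "runs b (Sequ (NPut ''cge'' (V ''j'') (NAdd (V ''m'') (NLit 1)))
      (Sequ (RPut ''wge'' (V ''j'') (RAdd (RGet ''wge'' (V ''j'')) (RGet ''w'' (V ''c''))))
      (Sequ (NPut ''lev'' (V ''c'') (V ''j''))
      (Sequ (RPut ''lo'' (V ''c'') (RGet ''hi'' (V ''c'')))
        (RPut ''hi'' (V ''c'') (RAdd (RGet ''hi'' (V ''c''))
          (RMul (ROfNat (NLit 2)) (RAdd (RDiv (RGet ''hi'' (V ''c'')) (ROfNat (V ''s''))) (ROfNat (NLit 1)))))))))) s2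
      (\<lambda>t2 s'. 1 + (6 + t2) = 12 \<and> nmem s' ''lev'' = (nmem s ''lev'')(c := Suc (nmem s ''lev'' c)) \<and>
        levels_rep n w sc s' \<and> frame level_arrays level_reals s s')"
      apply (simp add: runs_simps eqs w hl wg del: tau.simps)
      apply (fold h_def, fold s3_def)
      using rep3 fr3 bb by (simp add: lev_def l_def)
  qed
qed

lemma runs_level_down:
  assumes c: "nmem s ''c'' 0 = c" "c < n" and j: "nmem s ''lev'' c = Suc j"
    and sc: "nmem s ''s'' 0 = sc" "0 < sc" and w: "rmem s ''w'' c = w c"
    and rep: "levels_rep n w sc s" and b: "n \<le> b" "Suc j \<le> b"
  shows "runs b level_down s (\<lambda>t s'. t = 13 \<and> nmem s' ''lev'' = (nmem s ''lev'')(c := j) \<and>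
    levels_rep n w sc s' \<and> frame ({''j''} \<union> level_arrays) level_reals s s')"
proof -
  define lev where "lev = nmem s ''lev''"
  have lc: "lev c = Suc j" using j by (simp add: lev_def)
  define m where "m = nmem s ''cge'' (Suc j) - 1"
  define y where "y = nmem s ''ord'' m"
  define p where "p = nmem s ''pos'' c"
  have ord: "ordered n lev (nmem s ''ord'') (nmem s ''pos'') (nmem s ''cge'')"
    using rep by (simp add: levels_rep_def lev_def)
  note down = ordered_down[OF ord c(2) lc m_def y_def p_def]
  define s0 where "s0 = nput ''j'' 0 (Suc j) s"
  define s1 where "s1 = nput ''m'' 0 m s0"
  have s1: "nmem s1 ''c'' 0 = c" "nmem s1 ''m'' 0 = m" "y = nmem s1 ''ord'' m" "p = nmem s1 ''pos'' c"
    using c by (simp_all add: s1_def s0_def y_def p_def)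
  have 0: "runs b (assign ''j'' (NGet ''lev'' (V ''c''))) s (\<lambda>t s'. t = 1 \<and> s' = s0)"
    using b by (simp add: runs_NPut s0_def c(1) j)
  have 1: "runs b (assign ''m'' (NSub (NGet ''cge'' (V ''j'')) (NLit 1))) s0 (\<lambda>t s'. t = 1 \<and> s' = s1)"
    using down(2) b by (simp add: runs_NPut s1_def s0_def m_def)
  have 2: "runs b swap_order s1 (\<lambda>t s'. t = 6 \<and> nmem s' ''ord'' = (nmem s1 ''ord'')(p := y, m := c) \<and>
    nmem s' ''pos'' = (nmem s1 ''pos'')(y := p, c := m) \<and> frame {''y'', ''p'', ''ord'', ''pos''} {} s1 s')"
    by (rule runs_swap_order[OF s1]) (use down(2-4) c b in simp_all)
  show ?thesis
    unfolding level_down_def block.simps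
  proof (rule runs_SequI[OF 0], elim conjE, hypsubst, rule runs_SequI[OF 1], elim conjE, hypsubst,
      rule runs_SequI[OF 2], elim conjE, hypsubst)
    fix t s2
    assume o: "nmem s2 ''ord'' = (nmem s1 ''ord'')(p := y, m := c)"
      and po: "nmem s2 ''pos'' = (nmem s1 ''pos'')(y := p, c := m)"
      and fr: "frame {''y'', ''p'', ''ord'', ''pos''} {} s1 s2"
    have eqs: "nmem s2 ''j'' 0 = Suc j" "nmem s2 ''c'' 0 = c" "nmem s2 ''m'' 0 = m" "nmem s2 ''s'' 0 = sc"
      "nmem s2 ''cge'' = nmem s ''cge''" "nmem s2 ''lev'' = lev" "rmem s2 = rmem s"
      "nmem s2 ''ord'' = (nmem s ''ord'')(p := y, m := c)"
      "nmem s2 ''pos'' = (nmem s ''pos'')(y := p, c := m)"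
      using fr c sc o po by (simp_all add: frame_def s1_def s0_def lev_def fun_eq_iff)
    have fr2: "frame ({''j''} \<union> level_arrays) level_reals s s2"
      using fr by (auto simp: frame_def s1_def s0_def)
    have bb: "Suc j \<le> b" "m \<le> b" "c \<le> b" "j \<le> b" using b down(2) c by simp_all
    have hl: "rmem s ''lo'' c = tau sc (Suc j)" using rep c(2) j by (simp add: levels_rep_def)
    have wg: "rmem s ''wge'' i = level_weight n w lev i" for i using rep by (simp add: levels_rep_def lev_def)
    have td: "(tau sc (Suc j) - 2) * real sc / (2 + real sc) = tau sc j"
      using tau_down[OF sc(2), of j] by (simp del: tau.simps add: add.commute)
    define s3 where "s3 = rput ''lo'' c (tau sc j) (rput ''hi'' c (tau sc (Suc j)) (nput ''lev'' c j
      (rput ''wge'' (Suc j) (level_weight n w lev (Suc j) - w c) (nput ''cge'' (Suc j) m s2))))"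
    have rep3: "levels_rep n w sc s3"
      unfolding levels_rep_def
    proof (intro conjI allI impI)
      show "ordered n (nmem s3 ''lev'') (nmem s3 ''ord'') (nmem s3 ''pos'') (nmem s3 ''cge'')"
        using down(1) by (simp add: s3_def eqs)
      show "rmem s3 ''wge'' i = level_weight n w (nmem s3 ''lev'') i" for i
        using level_weight_down[of c n lev j w i] c(2) wg[of i] lc
        by (simp add: s3_def eqs)
    next
      fix v assume v: "v < n"
      then have "rmem s ''lo'' v = tau sc (lev v)" "rmem s ''hi'' v = tau sc (lev v + 1)"
        using rep by (simp_all add: levels_rep_def lev_def)
      then show "rmem s3 ''lo'' v = tau sc (nmem s3 ''lev'' v)"
        "rmem s3 ''hi'' v = tau sc (nmem s3 ''lev'' v + 1)"
        by (simp_all add: s3_def eqs del: tau.simps)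
    qed
    have fr3: "frame ({''j''} \<union> level_arrays) level_reals s s3" "nmem s3 ''lev'' = lev(c := j)"
      using fr2 by (simp_all add: s3_def frame_nput frame_rput eqs)
    show "runs b (Sequ (NPut ''cge'' (V ''j'') (V ''m''))
      (Sequ (RPut ''wge'' (V ''j'') (RSub (RGet ''wge'' (V ''j'')) (RGet ''w'' (V ''c''))))
      (Sequ (NPut ''lev'' (V ''c'') (NSub (V ''j'') (NLit 1)))
      (Sequ (RPut ''hi'' (V ''c'') (RGet ''lo'' (V ''c'')))
        (RPut ''lo'' (V ''c'') (RDiv (RMul (RSub (RGet ''lo'' (V ''c'')) (ROfNat (NLit 2))) (ROfNat (V ''s'')))
          (ROfNat (NAdd (V ''s'') (NLit 2))))))))) s2
      (\<lambda>t2 s'. 1 + (1 + (6 + t2)) = 13 \<and> nmem s' ''lev'' = (nmem s ''lev'')(c := j) \<and>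
        levels_rep n w sc s' \<and> frame ({''j''} \<union> level_arrays) level_reals s s')"
      apply (simp add: runs_simps eqs w hl wg td add.commute[of "real sc"] del: tau.simps)
      apply (fold s3_def)
      using rep3 fr3 bb by (simp add: lev_def)
  qed
qed


subsection \<open>Insertion\<close>

lemma nput_nput [simp]: "nput x i a (nput x i a' s) = nput x i a s"
  by (simp add: nput_def)

text \<open>\<open>j\<close> becomes the level that \<open>c\<close> would have with one more incoming edge.\<close>

definition set_j :: com where
  "set_j = Sequ (assign ''j'' (NGet ''lev'' (V ''c'')))
    (IfThen (RLess (ROfNat (NAdd (NGet ''deg'' (V ''c'')) (NLit 1)))
        (RMul (RGet ''w'' (V ''c'')) (RGet ''hi'' (V ''c''))))
      Skip (assign ''j'' (NAdd (V ''j'') (NLit 1))))"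

definition low_key :: nexp where
  "low_key = NAdd (NMul (NSub (NGet ''lev'' (V ''c'')) (NLit 2)) (V ''n'')) (V ''c'')"

text \<open>The subtraction in \<open>low_key\<close> truncates, so at levels 0 and 1 it would
  address bucket level 0 by mistake. No edge can be low there, and the middle test excludes these
  levels.\<close>

definition inc_guard :: bexp where
  "inc_guard = Conj (NLess (NLit 0) (NGet ''rem'' (V ''c'')))
    (Conj (NLess (NLit 1) (NGet ''lev'' (V ''c''))) (NLess (NLit 0) (NGet ''ic'' low_key)))"

definition inc_prefix :: com where
  "inc_prefix = Sequ set_j (Sequ (assign ''e'' (NGet ''ia'' (NMul low_key (V ''n''))))
    (assign ''x'' (NDiv (V ''e'') (V ''n''))))"

definition inc_flip :: com where
  "inc_flip = Sequ del_edge (Sequ (add_edge ''c'' ''x'') (assign ''c'' (V ''x'')))"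

definition inc_keep :: com where
  "inc_keep = Sequ relevel (NPut ''rem'' (V ''c'') (NSub (NGet ''rem'' (V ''c'')) (NLit 1)))"

text \<open>The test succeeds exactly if refiling under \<open>j\<close> would violate the tail
  condition.\<close>

definition inc_body :: com where
  "inc_body = Sequ inc_prefix
    (IfThen (NLess (NAdd (NGet ''lev'' (V ''x'')) (NLit 3)) (V ''j'')) inc_flip inc_keep)"

definition inc_accept :: com where
  "inc_accept = block
    [set_j,
     NPut ''deg'' (V ''c'') (NAdd (NGet ''deg'' (V ''c'')) (NLit 1)),
     NPut ''rem'' (V ''c'') (V ''s''),
     IfThen (NLess (NGet ''lev'' (V ''c'')) (V ''j'')) level_up Skip]"

text \<open>\<open>\<Lambda>\<close> bounds the loads, \<open>M\<close> the levels, and \<open>b\<close> the words and addresses.\<close>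

locale machine =
  fixes n :: nat and w :: "nat \<Rightarrow> real" and \<epsilon> :: real and sc M b :: nat and \<Lambda> :: real
  assumes n: "0 < n" and eps: "0 < \<epsilon>" and w: "v < n \<Longrightarrow> 1 \<le> w v" and sc: "2 \<le> sc" "sc \<le> b"
    and lev_bound: "tau sc i \<le> \<Lambda> + 1 \<Longrightarrow> i \<le> M"
    and b: "(M + 6) * n * n \<le> b"
    and deg_bound: "v < n \<Longrightarrow> real d \<le> \<Lambda> * w v \<Longrightarrow> d + 2 \<le> b"
begin

definition stat :: "state \<Rightarrow> bool" where
  "stat s \<longleftrightarrow> nmem s ''n'' 0 = n \<and> nmem s ''s'' 0 = sc \<and> (\<forall>v<n. rmem s ''w'' v = w v) \<and>
     rmem s ''eps'' 0 = \<epsilon> \<and> levels_rep n w sc s"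

definition rep :: "state \<Rightarrow> bool" where
  "rep s \<longleftrightarrow> stat s \<and> linked n (active n (nmem s ''orient'')) s \<and>
     core n w sc (nmem s ''orient'') (nmem s ''K'') (nmem s ''lev'') (nmem s ''deg'') (nmem s ''rem'')"

definition oriented :: "graph \<Rightarrow> state \<Rightarrow> bool" where
  "oriented G s \<longleftrightarrow> orientation n G (orient_of n (nmem s ''orient''))"

text \<open>All orientations are covered, since the flips of a chain pass through orientations that
  are not known beforehand.\<close>

definition bounded :: "graph \<Rightarrow> bool" where
  "bounded G \<longleftrightarrow> (\<forall>R. orientation n G (orient_of n R) \<longrightarrow> (\<forall>v<n. real (ind n R v) \<le> \<Lambda> * w v))"

lemma levels_rep_frame:
  assumes "levels_rep n w sc s" "frame X Y s s'" "X \<inter> {''lev'', ''ord'', ''pos'', ''cge''} = {}"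
    "Y \<inter> {''wge'', ''lo'', ''hi''} = {}"
  shows "levels_rep n w sc s'"
proof -
  have "nmem s' x = nmem s x" if "x \<in> {''lev'', ''ord'', ''pos'', ''cge''}" for x
    using assms(2,3) that by (intro frame_nmem[OF assms(2)]) auto
  moreover have "rmem s' x = rmem s x" if "x \<in> {''wge'', ''lo'', ''hi''}" for x
    using assms(2,4) that by (intro frame_rmem[OF assms(2)]) auto
  ultimately show ?thesis using assms(1) by (simp add: levels_rep_def)
qed

lemma stat_frame:
  assumes "stat s" "frame X {} s s'" "X \<inter> {''n'', ''s'', ''lev'', ''ord'', ''pos'', ''cge''} = {}"
  shows "stat s'"
proof -
  have "nmem s' x = nmem s x" if "x \<in> {''n'', ''s''}" for x
    using assms(2,3) that by (intro frame_nmem[OF assms(2)]) auto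
  moreover have "rmem s' = rmem s"
    using frame_rmem[OF assms(2)] by auto
  moreover have "levels_rep n w sc s'"
    using assms by (intro levels_rep_frame[of s X "{}" s']) (auto simp: stat_def)
  ultimately show ?thesis using assms(1) by (simp add: stat_def)
qed

lemma rep_frame:
  assumes "rep s" "frame X {} s s'" "X \<subseteq> {''u'', ''v'', ''c'', ''x'', ''e'', ''j'', ''i'', ''l'', ''t'', ''cnt''}"
  shows "rep s'"
proof -
  have "nmem s' x = nmem s x" if "x \<in> {''orient'', ''K'', ''lev'', ''deg'', ''rem''}" for x
    using assms(2,3) that by (intro frame_nmem[OF assms(2)]) auto
  moreover have "stat s'"
    using assms by (intro stat_frame[of s X s']) (auto simp: rep_def)
  moreover have "linked n (active n (nmem s ''orient'')) s'"
    using assms by (intro linked_frame[of n _ s X "{}" s']) (auto simp: rep_def)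
  ultimately show ?thesis using assms(1) by (simp add: rep_def)
qed

lemma word_bounds: "(M + 2 + 1) * n * n \<le> b" "M + 6 \<le> b" "n \<le> b" "n * n \<le> b"
proof -
  have "(M + 2 + 1) * n * n \<le> (M + 6) * n * n" by (intro mult_right_mono) auto
  then show 1: "(M + 2 + 1) * n * n \<le> b" using b by (rule order_trans)
  have "(M + 6) * 1 * 1 \<le> (M + 6) * n * n" using n by (intro mult_mono) auto
  then show "M + 6 \<le> b" using order_trans[OF _ b, of "(M + 6) * 1 * 1"] by simp
  show "n * n \<le> b" "n \<le> b" using square_le_bound[OF 1] by simp_all
qed

text \<open>The slack of 1 is for deletions: during their chains the counter of one vertex exceeds
  its in-degree by 1, and weights are at least 1.\<close>

lemma core_lev_le:
  assumes "core n w sc R K lev deg rem" "v < n" "real (deg v) \<le> (\<Lambda> + 1) * w v"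
  shows "lev v \<le> M"
proof -
  have "w v * tau sc (lev v) \<le> real (deg v)"
    using assms by (simp add: core_def vertex_inv_def)
  also have "\<dots> \<le> w v * (\<Lambda> + 1)" using assms by (simp add: mult.commute)
  finally show ?thesis using w[OF assms(2)] by (intro lev_bound) simp
qed

lemma low_item:
  assumes "linked n (active n R) s" "R = nmem s ''orient''" "0 < nmem s ''ic'' (k * n + c)" "c < n"
    and e: "e = nmem s ''ia'' ((k * n + c) * n)"
  shows "e \<in> active n R" "e mod n = c" "nmem s ''K'' e = k"
proof -
  have r: "bucket_rep n (nmem s ''ic'') (nmem s ''ia'') (nmem s ''ip'') (active n R) (\<lambda>e. nmem s ''K'' e * n + e mod n)"
    using assms(1) by (simp add: linked_def)
  then have *: "e \<in> active n R" "nmem s ''K'' e * n + e mod n = k * n + c"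
    using assms(3) unfolding bucket_rep_def e by (metis add.right_neutral)+
  then show "e \<in> active n R" by simp
  show "nmem s ''K'' e = k" "e mod n = c"
    using bucket_address_inj[OF *(2) _ assms(4)] n by simp_all
qed

lemma out_item:
  assumes "linked n (active n R) s" "R = nmem s ''orient''" "0 < nmem s ''oc'' (k * n + c)" "c < n"
    and e: "e = nmem s ''oa'' ((k * n + c) * n)"
  shows "e \<in> active n R" "e div n = c" "nmem s ''K'' e = k"
proof -
  have r: "bucket_rep n (nmem s ''oc'') (nmem s ''oa'') (nmem s ''op'') (active n R) (\<lambda>e. nmem s ''K'' e * n + e div n)"
    using assms(1) by (simp add: linked_def)
  then have *: "e \<in> active n R" "nmem s ''K'' e * n + e div n = k * n + c"
    using assms(3) unfolding bucket_rep_def e by (metis add.right_neutral)+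
  then show "e \<in> active n R" by simp
  then have "e div n < n" by (simp add: active_def less_mult_imp_div_less)
  then show "nmem s ''K'' e = k" "e div n = c"
    using bucket_address_inj[OF *(2) _ assms(4)] by simp_all
qed

lemma in_bucket_empty:
  assumes "linked n (active n R) s" "nmem s ''ic'' (k * n + c) = 0" "e \<in> active n R" "e mod n = c"
  shows "nmem s ''K'' e \<noteq> k"
  using assms unfolding linked_def bucket_rep_def by (metis less_nat_zero_code)

lemma out_bucket_empty:
  assumes "linked n (active n R) s" "nmem s ''oc'' (k * n + c) = 0" "e \<in> active n R" "e div n = c"
  shows "nmem s ''K'' e \<noteq> k"
  using assms unfolding linked_def bucket_rep_def by (metis less_nat_zero_code)

text \<open>While a chain of flips is in progress at \<open>c\<close>, only the counter \<open>deg\<close> of \<open>c\<close> is out of date.\<close>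

definition pre_inc :: "graph \<Rightarrow> nat \<Rightarrow> state \<Rightarrow> bool" where
  "pre_inc G c s \<longleftrightarrow> rep s \<and> oriented G s \<and> c < n \<and> nmem s ''c'' 0 = c \<and>
     (\<forall>v<n. ind n (nmem s ''orient'') v = nmem s ''deg'' v + of_bool (v = c))"

definition consistent :: "graph \<Rightarrow> state \<Rightarrow> bool" where
  "consistent G s \<longleftrightarrow> rep s \<and> oriented G s \<and>
     (\<forall>v<n. ind n (nmem s ''orient'') v = nmem s ''deg'' v)"

definition tentative_level :: "state \<Rightarrow> nat \<Rightarrow> nat" where
  "tentative_level s c = (if real (nmem s ''deg'' c + 1) < w c * tau sc (nmem s ''lev'' c + 1)
     then nmem s ''lev'' c else nmem s ''lev'' c + 1)"

text \<open>\<open>ind\<close> already counts the pending unit at \<open>c\<close>. Therefore even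
  the tentative level, which belongs to \<open>deg c + 1\<close>, is subject to the bound on
  loads.\<close>

lemma pre_inc_bounds:
  assumes pre: "pre_inc G c s" and G: "bounded G"
  shows "v < n \<Longrightarrow> nmem s ''lev'' v \<le> M" "tentative_level s c \<le> M" "v < n \<Longrightarrow> nmem s ''deg'' v + 2 \<le> b"
    "v < n \<Longrightarrow> ind n (nmem s ''orient'') v + 2 \<le> b"
proof -
  have ind: "real (ind n (nmem s ''orient'') v) \<le> \<Lambda> * w v" if "v < n" for v
    using pre G that unfolding pre_inc_def bounded_def oriented_def by blast
  have deg: "nmem s ''deg'' v \<le> ind n (nmem s ''orient'') v" if "v < n" for v
    using pre that by (simp add: pre_inc_def)
  show L: "nmem s ''lev'' v \<le> M" if v: "v < n" for v
  proof -
    have "real (nmem s ''deg'' v) \<le> \<Lambda> * w v"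
      using ind[OF v] deg[OF v] by linarith
    also have "\<dots> \<le> (\<Lambda> + 1) * w v" using w[OF v] by (intro mult_right_mono) auto
    finally show ?thesis
      using pre by (intro core_lev_le[OF _ v]) (auto simp: pre_inc_def rep_def)
  qed
  show "ind n (nmem s ''orient'') v + 2 \<le> b" if v: "v < n" for v
    using deg_bound[OF v] ind[OF v] by blast
  then show "nmem s ''deg'' v + 2 \<le> b" if v: "v < n" for v
    using deg[OF v] v by (meson add_le_mono1 le_trans)
  have c: "c < n" using pre by (simp add: pre_inc_def)
  show "tentative_level s c \<le> M"
  proof (cases "tentative_level s c = nmem s ''lev'' c")
    case True
    then show ?thesis using L[OF c] by simp
  next
    case False
    then have "tentative_level s c = nmem s ''lev'' c + 1" "w c * tau sc (tentative_level s c) \<le> real (nmem s ''deg'' c + 1)"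
      by (auto simp: tentative_level_def split: if_splits)
    moreover have "real (nmem s ''deg'' c + 1) \<le> w c * \<Lambda>"
      using ind[OF c] pre c by (simp add: pre_inc_def mult.commute)
    ultimately have "tau sc (tentative_level s c) \<le> \<Lambda>" using w[OF c]
      by (meson mult_le_cancel_left_pos order_less_le_trans order_trans zero_less_one)
    then show ?thesis by (intro lev_bound) simp
  qed
qed

lemma R_le_ind: "e < n * n \<Longrightarrow> R e \<le> ind n R (e mod n)"
  unfolding ind_def by (intro member_le_sum) auto

lemma runs_set_j:
  assumes "stat s" "c < n" "nmem s ''c'' 0 = c" "tentative_level s c \<le> b"
  shows "runs b set_j s (\<lambda>t s'. t \<le> 3 \<and> s' = nput ''j'' 0 (tentative_level s c) s)"
proof -
  have hi: "rmem s ''hi'' c = tau sc (nmem s ''lev'' c + 1)" "rmem s ''w'' c = w c"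
    using assms by (simp_all add: stat_def levels_rep_def)
  have b': "nmem s ''lev'' c \<le> b" using assms(4) by (auto simp: tentative_level_def split: if_splits)
  show ?thesis
    unfolding set_j_def
    apply (simp add: runs_simps assms(3) hi del: tau.simps)
    using assms(4) b' by (simp add: tentative_level_def del: tau.simps split: if_splits)
qed

lemma runs_inc_prefix:
  assumes pre: "pre_inc G c s" and G: "bounded G" and g: "bval inc_guard s"
  obtains e x where "e \<in> lows n (nmem s ''orient'') (nmem s ''K'') (nmem s ''lev'') c"
    "e \<in> active n (nmem s ''orient'')" "x = e div n" "0 < nmem s ''rem'' c"
    "runs b inc_prefix s (\<lambda>t s'. t \<le> 5 \<and> s' = nput ''x'' 0 x (nput ''e'' 0 e (nput ''j'' 0 (tentative_level s c) s)))"
proof -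
  have c: "c < n" "nmem s ''c'' 0 = c" and st: "stat s" and lk: "linked n (active n (nmem s ''orient'')) s"
    using pre by (simp_all add: pre_inc_def rep_def)
  have nn: "nmem s ''n'' 0 = n" using st by (simp add: stat_def)
  define k where "k = nmem s ''lev'' c - 2"
  have g': "0 < nmem s ''rem'' c" "2 \<le> nmem s ''lev'' c" "0 < nmem s ''ic'' (k * n + c)"
    using g by (auto simp: inc_guard_def low_key_def c nn k_def)
  define e where "e = nmem s ''ia'' ((k * n + c) * n)"
  note it = low_item[OF lk refl g'(3) c(1) e_def]
  have el: "e \<in> lows n (nmem s ''orient'') (nmem s ''K'') (nmem s ''lev'') c"
    using it g' by (auto simp: lows_def active_def k_def)
  have eb: "e \<le> b" using it(1) word_bounds(4) by (simp add: active_def)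
  then have xb: "e div n \<le> b" using div_le_dividend le_trans by blast
  have tb: "tentative_level s c \<le> b" using pre_inc_bounds(2)[OF pre G] word_bounds(2) by simp
  have "runs b (assign ''e'' (NGet ''ia'' (NMul low_key (V ''n'')))) (nput ''j'' 0 (tentative_level s c) s)
     (\<lambda>t s'. t = 1 \<and> s' = nput ''e'' 0 e (nput ''j'' 0 (tentative_level s c) s))"
    using eb by (simp add: runs_NPut low_key_def c nn k_def[symmetric] numeral_2_eq_2[symmetric] e_def[symmetric])
  then have 2: "runs b (Sequ (assign ''e'' (NGet ''ia'' (NMul low_key (V ''n''))))
    (assign ''x'' (NDiv (V ''e'') (V ''n'')))) (nput ''j'' 0 (tentative_level s c) s)
    (\<lambda>t s'. t = 2 \<and> s' = nput ''x'' 0 (e div n) (nput ''e'' 0 e (nput ''j'' 0 (tentative_level s c) s)))"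
    by (rule runs_SequI) (use xb in \<open>simp add: runs_NPut nn\<close>)
  have "runs b inc_prefix s (\<lambda>t s'. t \<le> 5 \<and>
     s' = nput ''x'' 0 (e div n) (nput ''e'' 0 e (nput ''j'' 0 (tentative_level s c) s)))"
    unfolding inc_prefix_def
    by (rule runs_SequI[OF runs_set_j[OF st c tb]]) (elim conjE, hypsubst, rule runs_mono[OF 2], simp)
  then show ?thesis
    using that el it(1) g'(1) by blast
qed

text \<open>Shared by both kinds of chains. A flip moves one unit of in-degree from the old head to
  the old tail and leaves the counters alone, so the discrepancy between counter and in-degree moves
  to the other end of the edge.\<close>

lemma runs_flip:
  assumes rep: "rep s" and o: "oriented G s" and e: "nmem s ''e'' 0 = e" "e \<in> active n (nmem s ''orient'')"
    and pq: "p \<in> {''x'', ''c''}" "q \<in> {''x'', ''c''}" "nmem s p 0 = e mod n" "nmem s q 0 = e div n"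
    and lev: "nmem s ''lev'' (e div n) \<le> nmem s ''lev'' (e mod n) + 3" "nmem s ''lev'' (e div n) \<le> M"
    and K: "nmem s ''K'' e \<le> M + 3"
    and bb: "\<And>v. v < n \<Longrightarrow> ind n (nmem s ''orient'') v + 2 \<le> b"
  shows "runs b (Sequ del_edge (add_edge p q)) s (\<lambda>t s'. t \<le> 20 \<and> rep s' \<and> oriented G s' \<and>
    (\<forall>v. ind n (nmem s' ''orient'') v + of_bool (v = e mod n) = ind n (nmem s ''orient'') v + of_bool (v = e div n)) \<and>
    frame ({''orient'', ''K'', ''e''} \<union> link_arrays) {} s s')"
proof -
  define R where "R = nmem s ''orient''"
  define x where "x = e div n"
  define y where "y = e mod n"
  define f where "f = y * n + x"
  have st: "stat s" and lk: "linked n (active n R) s"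
    and core: "core n w sc R (nmem s ''K'') (nmem s ''lev'') (nmem s ''deg'') (nmem s ''rem'')"
    using rep by (simp_all add: rep_def R_def)
  have nn: "nmem s ''n'' 0 = n" using st by (simp add: stat_def)
  have e': "e < n * n" "0 < R e" using e by (simp_all add: active_def R_def)
  have xy: "x < n" "y < n" "e = x * n + y" using edge_id_eq[OF e'(1)] by (simp_all add: x_def y_def)
  have xney: "x \<noteq> y" using orientation_irrefl[of n G R e] o e' by (simp add: oriented_def R_def x_def y_def)
  have f: "f < n * n" "f div n = y" "f mod n = x" "f \<noteq> e"
    using xy xney edge_less[of y n x] by (auto simp: f_def edge_id_inj)
  have "R e \<le> ind n R y" "R f \<le> ind n R x"
    using R_le_ind[OF e'(1), of R] R_le_ind[OF f(1), of R] unfolding y_def f(3) .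
  moreover have "ind n R x + 2 \<le> b" "ind n R y + 2 \<le> b"
    using bb[OF xy(1)] bb[OF xy(2)] by (simp_all add: R_def)
  ultimately have Rb: "R e \<le> b" "Suc (R f) \<le> b" by linarith+
  define R1 where "R1 = R(e := R e - 1)"
  define R2 where "R2 = R1(f := Suc (R1 f))"
  have R1f: "R1 f = R f" using f by (simp add: R1_def)
  have bM': "(M + 3 + 1) * n * n \<le> b"
    by (rule order_trans[OF _ b]) (intro mult_right_mono, auto)
  let ?X = "{''orient'', ''K'', ''e''} \<union> link_arrays"
  have 1: "runs b del_edge s (\<lambda>t s'. t \<le> 10 \<and> nmem s' ''orient'' = R1 \<and>
    linked n (active n (nmem s' ''orient'')) s' \<and> frame ({''orient''} \<union> link_arrays) {} s s')"
    unfolding R1_def by (rule runs_del_edge[OF nn e(1) _ R_def lk K bM' Rb(1)]) (use e in \<open>simp add: R_def\<close>)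
  have 2: "runs b (add_edge p q) s1 (\<lambda>t s'. t \<le> 10 \<and> nmem s' ''orient'' = R2 \<and>
      nmem s' ''K'' = (if R1 f = 0 then (nmem s ''K'')(f := nmem s ''lev'' x) else nmem s ''K'') \<and>
      linked n (active n (nmem s' ''orient'')) s' \<and> frame ?X {} s1 s')"
    if s1: "nmem s1 ''orient'' = R1" "linked n (active n (nmem s1 ''orient'')) s1"
      "frame ({''orient''} \<union> link_arrays) {} s s1" for s1
  proof -
    have eqs: "nmem s1 ''n'' 0 = n" "nmem s1 p 0 = y" "nmem s1 q 0 = x" "nmem s1 ''lev'' = nmem s ''lev''"
      "nmem s1 ''K'' = nmem s ''K''"
    proof -
      have "nmem s1 p = nmem s p"
        by (rule frame_nmem[OF s1(3)]) (use pq(1) in auto)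
      moreover have "nmem s1 q = nmem s q"
        by (rule frame_nmem[OF s1(3)]) (use pq(2) in auto)
      ultimately show "nmem s1 p 0 = y" "nmem s1 q 0 = x" using pq(3,4) by (simp_all add: x_def y_def)
    qed (use frame_nmem[OF s1(3)] nn in simp_all)
    have lx: "nmem s1 ''lev'' x \<le> M + 3" using lev(2) eqs by (simp add: x_def)
    have "M + 3 \<le> b" using word_bounds(2) by simp
    note add = runs_add_edge[OF eqs(1) pq(1,2) eqs(2,3) xy(2,1) s1(1)[symmetric] s1(2)[unfolded s1(1)] lx bM' _ this]
    have "Suc (R1 (y * n + x)) \<le> b" using Rb(2) R1f by (simp add: f_def)
    from add[OF this] show ?thesis
      unfolding f_def[symmetric] R2_def eqs .
  qed
  have 3: "rep s2 \<and> oriented G s2 \<and>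
    (\<forall>v. ind n (nmem s2 ''orient'') v + of_bool (v = y) = ind n R v + of_bool (v = x)) \<and> frame ?X {} s s2"
    if fr1: "frame ({''orient''} \<union> link_arrays) {} s s1"
      and s2: "nmem s2 ''orient'' = R2"
      "nmem s2 ''K'' = (if R1 f = 0 then (nmem s ''K'')(f := nmem s ''lev'' x) else nmem s ''K'')"
      "linked n (active n (nmem s2 ''orient'')) s2" "frame ?X {} s1 s2" for s1 s2
  proof (intro conjI allI)
    show fr: "frame ?X {} s s2"
      by (rule frame_trans[OF fr1 s2(4)]) auto
    have eqs: "nmem s2 ''lev'' = nmem s ''lev''" "nmem s2 ''deg'' = nmem s ''deg''" "nmem s2 ''rem'' = nmem s ''rem''"
      using fr by (simp_all add: frame_def)
    have "core n w sc R1 (nmem s ''K'') (nmem s ''lev'') (nmem s ''deg'') (nmem s ''rem'')"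
      unfolding R1_def by (rule core_remove[OF core])
    from core_add[OF this, of f] lev(1)
    have "core n w sc R2 (nmem s2 ''K'') (nmem s ''lev'') (nmem s ''deg'') (nmem s ''rem'')"
      by (simp only: f R2_def s2(2) x_def y_def)
    then show "rep s2"
      using stat_frame[OF st fr] s2(1,3) by (simp add: rep_def eqs)
    show "oriented G s2"
      using orientation_flip[of n G R x y] o xy xney e' R1f
      by (simp add: oriented_def s2(1) R2_def R1_def R_def f_def)
    fix v
    show "ind n (nmem s2 ''orient'') v + of_bool (v = y) = ind n R v + of_bool (v = x)"
      using ind_add[OF f(1), of R1 v] ind_remove[of e n R v, folded R1_def] e' f(3)
      by (auto simp: s2(1) R2_def y_def)
  qed
  show ?thesis
    unfolding x_def[symmetric] y_def[symmetric] R_def[symmetric]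
  proof (rule runs_SequI[OF 1], elim conjE)
    fix t1 s1
    assume t1: "t1 \<le> (10 :: nat)" and s1: "nmem s1 ''orient'' = R1" "linked n (active n (nmem s1 ''orient'')) s1"
      "frame ({''orient''} \<union> link_arrays) {} s s1"
    show "runs b (add_edge p q) s1 (\<lambda>t2 s'. t1 + t2 \<le> 20 \<and> rep s' \<and> oriented G s' \<and>
      (\<forall>v. ind n (nmem s' ''orient'') v + of_bool (v = y) = ind n R v + of_bool (v = x)) \<and> frame ?X {} s s')"
    proof (rule runs_mono[OF 2[OF s1]], elim conjE)
      fix t2 s2
      assume t2: "t2 \<le> (10 :: nat)" and s2: "nmem s2 ''orient'' = R2"
        "nmem s2 ''K'' = (if R1 f = 0 then (nmem s ''K'')(f := nmem s ''lev'' x) else nmem s ''K'')"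
        "linked n (active n (nmem s2 ''orient'')) s2" "frame ?X {} s1 s2"
      have "t1 + t2 \<le> 20" using t1 t2 by simp
      with 3[OF s1(3) s2] show "t1 + t2 \<le> 20 \<and> rep s2 \<and> oriented G s2 \<and>
        (\<forall>v. ind n (nmem s2 ''orient'') v + of_bool (v = y) = ind n R v + of_bool (v = x)) \<and> frame ?X {} s s2"
        by blast
    qed
  qed
qed

lemma runs_inc_body:
  assumes pre: "pre_inc G c s" and G: "bounded G" and g: "bval inc_guard s"
  shows "runs b inc_body s (\<lambda>t s'. t \<le> 30 \<and> nmem s' ''lev'' = nmem s ''lev'' \<and> 0 < nmem s ''rem'' c \<and>
     (pre_inc G c s' \<and> nmem s' ''rem'' = (nmem s ''rem'')(c := nmem s ''rem'' c - 1) \<or>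
      (\<exists>c'. pre_inc G c' s' \<and> nmem s ''lev'' c' < nmem s ''lev'' c \<and> nmem s' ''rem'' = nmem s ''rem'')))"
proof -
  obtain e x where e: "e \<in> lows n (nmem s ''orient'') (nmem s ''K'') (nmem s ''lev'') c"
    "e \<in> active n (nmem s ''orient'')" and x: "x = e div n" and r: "0 < nmem s ''rem'' c" and
    prefix: "runs b inc_prefix s (\<lambda>t s'. t \<le> 5 \<and> s' = nput ''x'' 0 x (nput ''e'' 0 e (nput ''j'' 0 (tentative_level s c) s)))"
    using runs_inc_prefix[OF assms] by metis
  define j where "j = tentative_level s c"
  define s1 where "s1 = nput ''x'' 0 x (nput ''e'' 0 e (nput ''j'' 0 j s))"
  have c: "c < n" "nmem s ''c'' 0 = c" and rep: "rep s" and o: "oriented G s"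
    and ind: "\<And>v. v < n \<Longrightarrow> ind n (nmem s ''orient'') v = nmem s ''deg'' v + of_bool (v = c)"
    using pre by (simp_all add: pre_inc_def)
  note bds = pre_inc_bounds[OF pre G]
  have fr1: "frame {''x'', ''e'', ''j''} {} s s1" by (simp add: s1_def frame_nput frame_refl)
  have rep1: "rep s1" by (rule rep_frame[OF rep fr1]) auto
  have s1: "nmem s1 ''e'' 0 = e" "nmem s1 ''x'' 0 = x" "nmem s1 ''j'' 0 = j" "nmem s1 ''c'' 0 = c"
    "nmem s1 ''orient'' = nmem s ''orient''" "nmem s1 ''K'' = nmem s ''K''" "nmem s1 ''lev'' = nmem s ''lev''"
    "nmem s1 ''deg'' = nmem s ''deg''" "nmem s1 ''rem'' = nmem s ''rem''"
    by (simp_all add: s1_def c)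
  have en: "e < n * n" "e mod n = c" "nmem s ''K'' e + 2 = nmem s ''lev'' c" using e by (auto simp: lows_def)
  have xn: "x < n" using edge_id_eq[OF en(1)] x by simp
  have jc: "nmem s ''lev'' c \<le> j" "j \<le> nmem s ''lev'' c + 1" by (auto simp: j_def tentative_level_def)
  have Kb: "nmem s ''K'' e \<le> M + 2" using bds(1)[OF c(1)] en(3) by simp
  have o1: "oriented G s1" using o by (simp add: oriented_def s1)
  let ?Q = "\<lambda>t s'. t \<le> 24 \<and> nmem s' ''lev'' = nmem s ''lev'' \<and>
     (pre_inc G c s' \<and> nmem s' ''rem'' = (nmem s ''rem'')(c := nmem s ''rem'' c - 1) \<or>
      (\<exists>c'. pre_inc G c' s' \<and> nmem s ''lev'' c' < nmem s ''lev'' c \<and> nmem s' ''rem'' = nmem s ''rem''))"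
  have "runs b (IfThen (NLess (NAdd (NGet ''lev'' (V ''x'')) (NLit 3)) (V ''j'')) inc_flip inc_keep) s1 ?Q"
  proof (cases "nmem s ''lev'' x + 3 < j")
    case True
    \<comment> \<open>\<open>j\<close> is at most \<open>lev c + 1\<close>, so a tail more than 3
      below \<open>j\<close> is strictly lower than \<open>c\<close>: the chain descends.\<close>
    have lx: "nmem s ''lev'' x < nmem s ''lev'' c" using True jc by simp
    have "runs b (Sequ del_edge (add_edge ''c'' ''x'')) s1 (\<lambda>t s'. t \<le> 20 \<and> rep s' \<and> oriented G s' \<and>
      (\<forall>v. ind n (nmem s' ''orient'') v + of_bool (v = e mod n) = ind n (nmem s1 ''orient'') v + of_bool (v = e div n)) \<and>
      frame ({''orient'', ''K'', ''e''} \<union> link_arrays) {} s1 s')"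
      by (rule runs_flip[OF rep1 o1 s1(1)]) (use s1 e en x lx bds(1)[OF xn] bds(4) Kb in auto)
    then have "runs b (Sequ (Sequ del_edge (add_edge ''c'' ''x'')) (assign ''c'' (V ''x''))) s1
      (\<lambda>t s'. 1 + t \<le> 24 \<and> (\<exists>c'. pre_inc G c' s' \<and> nmem s ''lev'' c' < nmem s ''lev'' c) \<and>
        nmem s' ''rem'' = nmem s ''rem'' \<and> nmem s' ''lev'' = nmem s ''lev'')"
    proof (rule runs_SequI, elim conjE)
      fix t s2
      assume t: "t \<le> (20 :: nat)" and rep2: "rep s2" and o2: "oriented G s2"
        and i2: "\<forall>v. ind n (nmem s2 ''orient'') v + of_bool (v = e mod n) = ind n (nmem s1 ''orient'') v + of_bool (v = e div n)"
        and fr2: "frame ({''orient'', ''K'', ''e''} \<union> link_arrays) {} s1 s2"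
      have s2: "nmem s2 ''lev'' = nmem s ''lev''" "nmem s2 ''deg'' = nmem s ''deg''" "nmem s2 ''rem'' = nmem s ''rem''"
        "nmem s2 ''x'' 0 = x"
        using fr2 s1 by (simp_all add: frame_def)
      define s3 where "s3 = nput ''c'' 0 x s2"
      have s3: "nmem s3 ''lev'' = nmem s ''lev''" "nmem s3 ''deg'' = nmem s ''deg''" "nmem s3 ''rem'' = nmem s ''rem''"
        "nmem s3 ''c'' 0 = x" "nmem s3 ''orient'' = nmem s2 ''orient''"
        by (simp_all add: s3_def s2)
      have "frame {''c''} {} s2 s3" by (simp add: s3_def frame_nput frame_refl)
      then have "rep s3" by (rule rep_frame[OF rep2]) auto
      moreover have "ind n (nmem s2 ''orient'') v = nmem s ''deg'' v + of_bool (v = x)" if "v < n" for v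
        using i2[rule_format, of v] ind[OF that] en(2) x s1(5) by auto
      ultimately have "pre_inc G x s3"
        using o2 xn s3 by (simp add: pre_inc_def oriented_def)
      moreover have "x \<le> b" using xn word_bounds(3) by simp
      ultimately show "runs b (assign ''c'' (V ''x'')) s2 (\<lambda>t2 s'. 1 + (t + t2) \<le> 24 \<and>
        (\<exists>c'. pre_inc G c' s' \<and> nmem s ''lev'' c' < nmem s ''lev'' c) \<and>
        nmem s' ''rem'' = nmem s ''rem'' \<and> nmem s' ''lev'' = nmem s ''lev'')"
        using lx t s3 by (auto simp: runs_NPut s2(4) s3_def[symmetric])
    qed
    then have "runs b inc_flip s1 (\<lambda>t. ?Q (1 + t))"
      unfolding inc_flip_def runs_Sequ by (rule runs_mono) (auto elim!: runs_mono simp: add.assoc)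
    then show ?thesis
      using True by (simp only: runs_IfThen bval.simps nval.simps s1 if_True)
  next
    case False
    have nn: "nmem s1 ''n'' 0 = n" using rep1 by (simp add: rep_def stat_def)
    have lk1: "linked n (active n (nmem s ''orient'')) s1" using rep1 by (simp add: rep_def s1)
    have "runs b relevel s1 (\<lambda>t s'. t = 15 \<and> nmem s' ''K'' = (nmem s1 ''K'')(e := j) \<and>
      linked n (active n (nmem s ''orient'')) s' \<and> frame ({''K''} \<union> link_arrays) {} s1 s')"
      by (rule runs_relevel[OF nn s1(1) e(2) active_subset s1(3) _ lk1 _ word_bounds(1)])
        (use Kb s1 bds(2) word_bounds(2) in \<open>auto simp: j_def\<close>)
    then have "runs b inc_keep s1 (\<lambda>t s'. 1 + t \<le> 24 \<and> nmem s' ''lev'' = nmem s ''lev'' \<and>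
      pre_inc G c s' \<and> nmem s' ''rem'' = (nmem s ''rem'')(c := nmem s ''rem'' c - 1))"
      unfolding inc_keep_def
    proof (rule runs_SequI, elim conjE)
      fix t s2
      assume t: "t = (15 :: nat)" and K2: "nmem s2 ''K'' = (nmem s1 ''K'')(e := j)"
        and lk2: "linked n (active n (nmem s ''orient'')) s2"
        and fr2: "frame ({''K''} \<union> link_arrays) {} s1 s2"
      have s2: "nmem s2 ''lev'' = nmem s ''lev''" "nmem s2 ''deg'' = nmem s ''deg''" "nmem s2 ''rem'' = nmem s ''rem''"
        "nmem s2 ''c'' 0 = c" "nmem s2 ''orient'' = nmem s ''orient''"
        using fr2 s1 by (simp_all add: frame_def)
      define s3 where "s3 = nput ''rem'' c (nmem s ''rem'' c - 1) s2"
      have s3: "nmem s3 ''lev'' = nmem s ''lev''" "nmem s3 ''deg'' = nmem s ''deg''"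
        "nmem s3 ''rem'' = (nmem s ''rem'')(c := nmem s ''rem'' c - 1)" "nmem s3 ''c'' 0 = c"
        "nmem s3 ''orient'' = nmem s ''orient''" "nmem s3 ''K'' = (nmem s ''K'')(e := j)"
        by (simp_all add: s3_def s2 K2 s1)
      have fr3: "frame {''rem''} {} s2 s3" by (simp add: s3_def frame_nput frame_refl)
      have fr: "frame ({''K'', ''rem''} \<union> link_arrays) {} s1 s3"
        by (rule frame_trans[OF fr2 fr3]) auto
      have "stat s3" by (rule stat_frame[OF _ fr]) (use rep1 in \<open>auto simp: rep_def\<close>)
      moreover have "linked n (active n (nmem s ''orient'')) s3" by (rule linked_frame[OF lk2 fr3]) auto
      moreover have "core n w sc (nmem s ''orient'') ((nmem s ''K'')(e := j)) (nmem s ''lev'') (nmem s ''deg'')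
          ((nmem s ''rem'')(c := nmem s ''rem'' c - 1))"
        by (rule core_scan_low) (use rep False x e(1) c(1) jc r in \<open>auto simp: rep_def\<close>)
      ultimately have "rep s3" by (simp add: rep_def s3)
      then have "pre_inc G c s3" using o ind c by (simp add: pre_inc_def oriented_def s3)
      moreover have "c \<le> b" "nmem s ''rem'' c - 1 \<le> b"
      proof -
        have "nmem s ''rem'' c \<le> sc" using rep c by (simp add: rep_def core_def vertex_inv_def)
        then show "nmem s ''rem'' c - 1 \<le> b" using sc by simp
        show "c \<le> b" using c word_bounds(3) by simp
      qed
      ultimately show "runs b (NPut ''rem'' (V ''c'') (NSub (NGet ''rem'' (V ''c'')) (NLit 1))) s2
        (\<lambda>t2 s'. 1 + (t + t2) \<le> 24 \<and> nmem s' ''lev'' = nmem s ''lev'' \<and>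
         pre_inc G c s' \<and> nmem s' ''rem'' = (nmem s ''rem'')(c := nmem s ''rem'' c - 1))"
        unfolding runs_NPut nval.simps s2 s3_def[symmetric] using t s3 by simp
    qed
    then have "runs b inc_keep s1 (\<lambda>t. ?Q (1 + t))" by (rule runs_mono) blast
    then show ?thesis
      using False by (simp only: runs_IfThen bval.simps nval.simps s1 if_False)
  qed
  note ite = this
  show ?thesis
    unfolding inc_body_def
    apply (rule runs_SequI[OF prefix])
    apply (elim conjE, hypsubst)
    apply (fold j_def, fold s1_def)
    apply (rule runs_mono[OF ite])
    using r by auto
qed

end

section \<open>Complete insertions and their two time bounds\<close>

definition insert_prefix :: com where
  "insert_prefix = Sequ
     (IfThen (NLess (NGet ''lev'' (V ''u'')) (NGet ''lev'' (V ''v'')))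
       (Sequ (assign ''c'' (V ''u'')) (assign ''x'' (V ''v'')))
       (Sequ (assign ''c'' (V ''v'')) (assign ''x'' (V ''u''))))
     (add_edge ''x'' ''c'')"

definition insert_main :: com where
  "insert_main = Sequ insert_prefix (Sequ (WhileDo inc_guard inc_body) inc_accept)"

context machine
begin

definition budget :: "state \<Rightarrow> nat" where
  "budget s = (\<Sum>v<n. nmem s ''rem'' v)"

lemma budget_upd:
  assumes "c < n" "nmem s' ''rem'' = (nmem s ''rem'')(c := r)"
  shows "budget s' + nmem s ''rem'' c = budget s + r"
proof -
  have "sum (nmem s' ''rem'') ({..<n} - {c}) = sum (nmem s ''rem'') ({..<n} - {c})"
    using assms(2) by (intro sum.cong) auto
  then show ?thesis
    using assms unfolding budget_def by (simp add: sum.remove[of "{..<n}" c])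
qed

lemma rep_rem_le: "rep s \<Longrightarrow> v < n \<Longrightarrow> nmem s ''rem'' v \<le> sc"
  by (simp add: rep_def core_def vertex_inv_def)

text \<open>An iteration with its test takes at most 31 steps and lowers two measures.
  \<open>f\<close> orders level and allowance of the current vertex lexicographically, which gives
  termination and the worst-case bound; \<open>g\<close> adds the level to the sum of all
  allowances, which gives the amortized bound.\<close>

lemma runs_inc_loop:
  assumes pre: "pre_inc G c s" and G: "bounded G"
  shows "runs b (WhileDo inc_guard inc_body) s (\<lambda>t s'. (\<exists>c'. pre_inc G c' s') \<and> \<not> bval inc_guard s' \<and>
    t \<le> 31 * ((M + 1) * (sc + 1)) + 1 \<and> t + 31 * budget s' \<le> 31 * (M + budget s) + 1)"
proof -
  define lev where "lev = nmem s ''lev''"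
  define f where "f = (\<lambda>s' :: state. lev (nmem s' ''c'' 0) * (sc + 1) + nmem s' ''rem'' (nmem s' ''c'' 0))"
  define g where "g = (\<lambda>s' :: state. lev (nmem s' ''c'' 0) + budget s')"
  define I where "I = (\<lambda>t s'. (\<exists>c'. pre_inc G c' s') \<and> nmem s' ''lev'' = lev \<and>
    t + 31 * f s' \<le> 31 * f s \<and> t + 31 * g s' \<le> 31 * g s)"
  have c: "c < n" "nmem s ''c'' 0 = c" using pre by (simp_all add: pre_inc_def)
  have "lev c \<le> M" using pre_inc_bounds(1)[OF pre G c(1)] by (simp add: lev_def)
  moreover have "nmem s ''rem'' c \<le> sc" using rep_rem_le pre by (simp add: pre_inc_def)
  ultimately have fs: "f s \<le> (M + 1) * (sc + 1)" "g s \<le> M + budget s"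
    using mult_right_mono[of "lev c" M "sc + 1"] by (simp_all add: f_def g_def c)
  have "runs b (WhileDo inc_guard inc_body) s (\<lambda>t'. (\<lambda>t s'. (\<exists>c'. pre_inc G c' s') \<and> \<not> bval inc_guard s' \<and>
    t \<le> 31 * ((M + 1) * (sc + 1)) + 1 \<and> t + 31 * budget s' \<le> 31 * (M + budget s) + 1) (0 + t'))"
  proof (rule runs_While[where I = I and f = f])
    show "I 0 s" using pre by (auto simp: I_def lev_def)
  next
    fix t s1 assume I: "I t s1" and gd: "bval inc_guard s1"
    then obtain c1 where pre1: "pre_inc G c1 s1" and lev1: "nmem s1 ''lev'' = lev"
      and t1: "t + 31 * f s1 \<le> 31 * f s" "t + 31 * g s1 \<le> 31 * g s" by (auto simp: I_def)
    have c1: "c1 < n" "nmem s1 ''c'' 0 = c1" using pre1 by (simp_all add: pre_inc_def)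
    show "runs b inc_body s1 (\<lambda>t' s'. I (1 + t + t') s' \<and> f s' < f s1)"
    proof (rule runs_mono[OF runs_inc_body[OF pre1 G gd]], elim conjE)
      fix t' s2
      assume t': "t' \<le> (30 :: nat)" and lev2: "nmem s2 ''lev'' = nmem s1 ''lev''" and r: "0 < nmem s1 ''rem'' c1"
        and step: "pre_inc G c1 s2 \<and> nmem s2 ''rem'' = (nmem s1 ''rem'')(c1 := nmem s1 ''rem'' c1 - 1) \<or>
          (\<exists>c'. pre_inc G c' s2 \<and> nmem s1 ''lev'' c' < nmem s1 ''lev'' c1 \<and> nmem s2 ''rem'' = nmem s1 ''rem'')"
      obtain c2 where pre2: "pre_inc G c2 s2" and fg: "f s2 < f s1" "g s2 < g s1"
        using step
      proof
        assume A: "pre_inc G c1 s2 \<and> nmem s2 ''rem'' = (nmem s1 ''rem'')(c1 := nmem s1 ''rem'' c1 - 1)"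
        then have "nmem s2 ''c'' 0 = c1" by (simp add: pre_inc_def)
        moreover have "budget s2 < budget s1" using budget_upd[OF c1(1), of s2 s1] A r by fastforce
        ultimately show ?thesis using A r c1 by (intro that[of c1]) (auto simp: f_def g_def)
      next
        assume "\<exists>c'. pre_inc G c' s2 \<and> nmem s1 ''lev'' c' < nmem s1 ''lev'' c1 \<and> nmem s2 ''rem'' = nmem s1 ''rem''"
        then obtain c2 where A: "pre_inc G c2 s2" "lev c2 < lev c1" "nmem s2 ''rem'' = nmem s1 ''rem''"
          using lev1 by auto
        then have c2: "nmem s2 ''c'' 0 = c2" "nmem s1 ''rem'' c2 \<le> sc"
          using rep_rem_le[of s2 c2] by (simp_all add: pre_inc_def)
        \<comment> \<open>One level outweighs any gain in allowance, because allowances never exceed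
          \<open>sc\<close>.\<close>
        have "lev c2 * (sc + 1) + (sc + 1) \<le> lev c1 * (sc + 1)"
          using mult_right_mono[of "Suc (lev c2)" "lev c1" "sc + 1"] A(2) by simp
        then show ?thesis using A c2 c1 by (intro that[of c2]) (auto simp: f_def g_def budget_def)
      qed
      then show "I (1 + t + t') s2 \<and> f s2 < f s1"
        using t1 t' lev1 lev2 by (auto simp: I_def)
    qed
  next
    fix t s1 assume I: "I t s1" and gd: "\<not> bval inc_guard s1"
    then have "budget s1 \<le> g s1" by (simp add: g_def)
    then show "(\<exists>c'. pre_inc G c' s1) \<and> \<not> bval inc_guard s1 \<and> t + 1 \<le> 31 * ((M + 1) * (sc + 1)) + 1 \<and>
      t + 1 + 31 * budget s1 \<le> 31 * (M + budget s) + 1"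
      using I gd fs by (auto simp: I_def)
  qed
  then show ?thesis unfolding add_0 .
qed

lemma runs_inc_accept:
  assumes pre: "pre_inc G c s" and G: "bounded G" and g: "\<not> bval inc_guard s"
  shows "runs b inc_accept s (\<lambda>t s'. t \<le> 20 \<and> consistent G s' \<and> budget s' \<le> budget s + sc)"
proof -
  have c: "c < n" "nmem s ''c'' 0 = c" and o: "oriented G s" and st: "stat s"
    and lk: "linked n (active n (nmem s ''orient'')) s"
    and ind: "\<And>v. v < n \<Longrightarrow> ind n (nmem s ''orient'') v = nmem s ''deg'' v + of_bool (v = c)"
    and core: "core n w sc (nmem s ''orient'') (nmem s ''K'') (nmem s ''lev'') (nmem s ''deg'') (nmem s ''rem'')"
    using pre by (simp_all add: pre_inc_def rep_def)
  have nn: "nmem s ''n'' 0 = n" "nmem s ''s'' 0 = sc" using st by (simp_all add: stat_def)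
  note bds = pre_inc_bounds[OF pre G]
  define j where "j = tentative_level s c"
  define lev where "lev = nmem s ''lev''"
  define deg where "deg = nmem s ''deg''"
  define rm where "rm = nmem s ''rem''"
  \<comment> \<open>A failed guard means a spent allowance, a level below 2, or an empty bucket; the
    last two leave no low edge.\<close>
  have quiet: "rm c = 0 \<or> lows n (nmem s ''orient'') (nmem s ''K'') lev c = {}"
  proof (cases "rm c = 0 \<or> lev c \<le> 1")
    case True
    then show ?thesis by (auto simp: lows_def)
  next
    case False
    then have "nmem s ''ic'' ((lev c - 2) * n + c) = 0"
      using g by (auto simp: inc_guard_def low_key_def c nn lev_def rm_def)
    from in_bucket_empty[OF lk this]
    have "nmem s ''K'' e + 2 \<noteq> lev c" if "e \<in> active n (nmem s ''orient'')" "e mod n = c" for e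
      using that by (metis add_diff_cancel_right')
    then have "lows n (nmem s ''orient'') (nmem s ''K'') lev c = {}"
      by (auto simp: lows_def active_def)
    then show ?thesis by simp
  qed
  have tb: "tentative_level s c \<le> b" using bds(2) word_bounds(2) by simp
  have cb: "c \<le> b" "deg c + 1 \<le> b" using c word_bounds(3) bds(3)[OF c(1)] by (simp_all add: deg_def)
  define s1 where "s1 = nput ''rem'' c sc (nput ''deg'' c (deg c + 1) (nput ''j'' 0 j s))"
  have s1: "nmem s1 ''c'' 0 = c" "nmem s1 ''j'' 0 = j" "nmem s1 ''lev'' = lev" "nmem s1 ''s'' 0 = sc"
    "nmem s1 ''rem'' = rm(c := sc)" "nmem s1 ''deg'' = deg(c := deg c + 1)"
    "nmem s1 ''orient'' = nmem s ''orient''" "nmem s1 ''K'' = nmem s ''K''"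
    by (simp_all add: s1_def c nn lev_def rm_def deg_def)
  have fr1: "frame {''rem'', ''deg'', ''j''} {} s s1" by (simp add: s1_def frame_nput frame_refl)
  have st1: "stat s1" by (rule stat_frame[OF st fr1]) auto
  have lk1: "linked n (active n (nmem s ''orient'')) s1" by (rule linked_frame[OF lk fr1]) auto
  have core1: "core n w sc (nmem s ''orient'') (nmem s ''K'') (lev(c := j)) (deg(c := deg c + 1)) (rm(c := sc))"
    by (rule core_accept_inc) (use core c w sc ind quiet in \<open>auto simp: lev_def deg_def rm_def j_def tentative_level_def\<close>)
  have fin: "consistent G s2 \<and> budget s2 \<le> budget s + sc"
    if st2: "stat s2" and lev2: "nmem s2 ''lev'' = lev(c := j)" and fr2: "frame level_arrays level_reals s1 s2" for s2
  proof
    have s2: "nmem s2 ''rem'' = rm(c := sc)" "nmem s2 ''deg'' = deg(c := deg c + 1)"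
      "nmem s2 ''orient'' = nmem s ''orient''" "nmem s2 ''K'' = nmem s ''K''"
      using fr2 s1 by (simp_all add: frame_def)
    have "linked n (active n (nmem s ''orient'')) s2" by (rule linked_frame[OF lk1 fr2]) auto
    then have "rep s2" using st2 core1 by (simp add: rep_def s2 lev2)
    then show "consistent G s2"
      using o ind by (auto simp: consistent_def oriented_def s2 deg_def)
    show "budget s2 \<le> budget s + sc"
      using budget_upd[OF c(1), of s2 s sc] s2(1) by (simp add: rm_def)
  qed
  have 1: "runs b (NPut ''deg'' (V ''c'') (NAdd (NGet ''deg'' (V ''c'')) (NLit 1))) (nput ''j'' 0 j s)
     (\<lambda>t s'. t = 1 \<and> s' = nput ''deg'' c (deg c + 1) (nput ''j'' 0 j s))"
    using cb by (simp add: runs_NPut c deg_def)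
  have 2: "runs b (NPut ''rem'' (V ''c'') (V ''s'')) (nput ''deg'' c (deg c + 1) (nput ''j'' 0 j s))
     (\<lambda>t s'. t = 1 \<and> s' = s1)"
    using cb sc by (simp add: runs_NPut c nn s1_def)
  have 3: "runs b (IfThen (NLess (NGet ''lev'' (V ''c'')) (V ''j'')) level_up Skip) s1
    (\<lambda>t s'. t \<le> 14 \<and> consistent G s' \<and> budget s' \<le> budget s + sc)"
  proof (cases "lev c < j")
    case True
    then have j: "j = Suc (lev c)" by (auto simp: j_def tentative_level_def lev_def split: if_splits)
    have "runs b level_up s1 (\<lambda>t s'. t = 12 \<and> nmem s' ''lev'' = (nmem s1 ''lev'')(c := Suc (nmem s1 ''lev'' c)) \<and>
      levels_rep n w sc s' \<and> frame level_arrays level_reals s1 s')"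
      by (rule runs_level_up[OF s1(1) c(1) _ s1(4)])
        (use j s1 sc st1 word_bounds(3) tb c in \<open>auto simp: stat_def j_def[symmetric]\<close>)
    then have "runs b level_up s1 (\<lambda>t s'. 1 + t \<le> 14 \<and> consistent G s' \<and> budget s' \<le> budget s + sc)"
    proof (rule runs_mono, elim conjE)
      fix t s2
      assume t: "t = (12 :: nat)" and l2: "nmem s2 ''lev'' = (nmem s1 ''lev'')(c := Suc (nmem s1 ''lev'' c))"
        and lr: "levels_rep n w sc s2" and fr2: "frame level_arrays level_reals s1 s2"
      have "stat s2" using st1 lr frame_nmem[OF fr2] frame_rmem[OF fr2] by (simp add: stat_def)
      from fin[OF this _ fr2] show "1 + t \<le> 14 \<and> consistent G s2 \<and> budget s2 \<le> budget s + sc"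
        using t l2 j s1(3) by simp
    qed
    then show ?thesis using True by (simp only: runs_IfThen bval.simps nval.simps s1 if_True)
  next
    case False
    then have "j = lev c" by (auto simp: j_def tentative_level_def lev_def split: if_splits)
    then have "consistent G s1 \<and> budget s1 \<le> budget s + sc"
      using fin[OF st1 _ frame_refl] s1(3) by simp
    then show ?thesis using False by (simp add: runs_IfThen runs_Skip s1)
  qed
  show ?thesis
    unfolding inc_accept_def block.simps
    apply (rule runs_SequI[OF runs_set_j[OF st c tb]], elim conjE, hypsubst, fold j_def)
    apply (rule runs_SequI[OF 1], elim conjE, hypsubst)
    apply (rule runs_SequI[OF 2], elim conjE, hypsubst)
    apply (rule runs_mono[OF 3], simp)
    done
qed

lemma consistent_bounds:
  assumes "consistent G s" and G: "bounded G"
  shows "v < n \<Longrightarrow> nmem s ''lev'' v \<le> M" "v < n \<Longrightarrow> ind n (nmem s ''orient'') v + 2 \<le> b"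
proof -
  have ind: "real (ind n (nmem s ''orient'') v) \<le> \<Lambda> * w v" if "v < n" for v
    using assms that unfolding consistent_def bounded_def oriented_def by blast
  show "ind n (nmem s ''orient'') v + 2 \<le> b" if v: "v < n"
    using deg_bound[OF v] ind[OF v] by blast
  show "nmem s ''lev'' v \<le> M" if v: "v < n"
  proof -
    have "real (nmem s ''deg'' v) \<le> \<Lambda> * w v"
      using ind[OF v] assms(1) v by (simp add: consistent_def)
    also have "\<dots> \<le> (\<Lambda> + 1) * w v" using w[OF v] by (intro mult_right_mono) auto
    finally show ?thesis
      using assms by (intro core_lev_le[OF _ v]) (auto simp: consistent_def rep_def)
  qed
qed

text \<open>The head is an end of minimal level, so the new edge satisfies the tail condition with
  room to spare.\<close>

lemma runs_insert_prefix:
  assumes con: "consistent G s" and G: "bounded G" and uv: "u < n" "v < n" "u \<noteq> v"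
    and reg: "nmem s ''u'' 0 = u" "nmem s ''v'' 0 = v"
  shows "runs b insert_prefix s (\<lambda>t s'. t \<le> 13 \<and> (\<exists>c. pre_inc (add_mset {u, v} G) c s') \<and> budget s' = budget s)"
proof -
  define c where "c = (if nmem s ''lev'' u < nmem s ''lev'' v then u else v)"
  define x where "x = (if nmem s ''lev'' u < nmem s ''lev'' v then v else u)"
  have cx: "c < n" "x < n" "c \<noteq> x" "{x, c} = {u, v}" "nmem s ''lev'' c \<le> nmem s ''lev'' x"
    using uv by (auto simp: c_def x_def)
  define s1 where "s1 = nput ''x'' 0 x (nput ''c'' 0 c s)"
  note bds = consistent_bounds[OF con G]
  have rep: "rep s" and o: "oriented G s" using con by (simp_all add: consistent_def)
  have fr1: "frame {''x'', ''c''} {} s s1" by (simp add: s1_def frame_nput frame_refl)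
  have rep1: "rep s1" by (rule rep_frame[OF rep fr1]) auto
  have s1: "nmem s1 ''c'' 0 = c" "nmem s1 ''x'' 0 = x" "nmem s1 ''orient'' = nmem s ''orient''"
    "nmem s1 ''lev'' = nmem s ''lev''" "nmem s1 ''K'' = nmem s ''K''" "nmem s1 ''deg'' = nmem s ''deg''"
    "nmem s1 ''rem'' = nmem s ''rem''"
    by (simp_all add: s1_def)
  have xb: "u \<le> b" "v \<le> b" using uv word_bounds(3) by simp_all
  have 1: "runs b (IfThen (NLess (NGet ''lev'' (V ''u'')) (NGet ''lev'' (V ''v'')))
       (Sequ (assign ''c'' (V ''u'')) (assign ''x'' (V ''v'')))
       (Sequ (assign ''c'' (V ''v'')) (assign ''x'' (V ''u'')))) s (\<lambda>t s'. t = 3 \<and> s' = s1)"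
    using xb by (simp add: runs_simps reg s1_def c_def x_def)
  define R where "R = nmem s ''orient''"
  define e where "e = x * n + c"
  have e: "e < n * n" "e div n = x" "e mod n = c" using cx edge_less[of x n c] by (simp_all add: e_def)
  have nn: "nmem s1 ''n'' 0 = n" using rep1 by (simp add: rep_def stat_def)
  have Rb: "Suc (R e) \<le> b"
    using R_le_ind[OF e(1), of R] bds(2)[OF cx(1)] by (simp add: e(3) R_def)
  have lk1: "linked n (active n R) s1" using rep1 by (simp add: rep_def s1 R_def)
  let ?X = "{''orient'', ''K'', ''e''} \<union> link_arrays"
  have 2: "runs b (add_edge ''x'' ''c'') s1 (\<lambda>t s'. t \<le> 10 \<and>
    nmem s' ''orient'' = R(e := Suc (R e)) \<and>
    nmem s' ''K'' = (if R e = 0 then (nmem s1 ''K'')(e := nmem s1 ''lev'' c) else nmem s1 ''K'') \<and>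
    linked n (active n (nmem s' ''orient'')) s' \<and> frame ?X {} s1 s')"
    unfolding e_def
    by (rule runs_add_edge[OF nn _ _ s1(2,1) cx(2,1) _ lk1 _ word_bounds(1)])
      (use Rb bds(1)[OF cx(1)] word_bounds(2) in \<open>auto simp: s1 R_def e_def\<close>)
  have 3: "pre_inc (add_mset {u, v} G) c s2 \<and> budget s2 = budget s"
    if s2: "nmem s2 ''orient'' = R(e := Suc (R e))"
      "nmem s2 ''K'' = (if R e = 0 then (nmem s1 ''K'')(e := nmem s1 ''lev'' c) else nmem s1 ''K'')"
      "linked n (active n (nmem s2 ''orient'')) s2" and fr2: "frame ?X {} s1 s2" for s2
  proof
    have eqs: "nmem s2 ''lev'' = nmem s ''lev''" "nmem s2 ''deg'' = nmem s ''deg''"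
      "nmem s2 ''rem'' = nmem s ''rem''" "nmem s2 ''c'' 0 = c"
      using fr2 s1 by (simp_all add: frame_def)
    show "budget s2 = budget s" by (simp add: budget_def eqs)
    have core: "core n w sc R (nmem s ''K'') (nmem s ''lev'') (nmem s ''deg'') (nmem s ''rem'')"
      using rep by (simp add: rep_def R_def)
    have "core n w sc (R(e := Suc (R e))) (nmem s2 ''K'') (nmem s ''lev'') (nmem s ''deg'') (nmem s ''rem'')"
      using core_add[OF core, of e] cx(5) unfolding s2(2) s1 e by simp
    moreover have "stat s2" by (rule stat_frame[OF _ fr2]) (use rep1 in \<open>auto simp: rep_def\<close>)
    ultimately have "rep s2" using s2(1,3) by (simp add: rep_def eqs)
    moreover have "oriented (add_mset {u, v} G) s2"
      using orientation_insert[of n G R x c] o cx by (simp add: oriented_def s2(1) R_def e_def)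
    moreover have "ind n (R(e := Suc (R e))) y = nmem s ''deg'' y + of_bool (y = c)" if "y < n" for y
      using ind_add[OF e(1), of R y] con that by (simp add: consistent_def R_def e(3))
    ultimately show "pre_inc (add_mset {u, v} G) c s2"
      using cx by (simp add: pre_inc_def eqs s2(1))
  qed
  show ?thesis
    unfolding insert_prefix_def
    apply (rule runs_SequI[OF 1], elim conjE, hypsubst)
    apply (rule runs_mono[OF 2], elim conjE)
    apply (use 3 in auto)
    done
qed

lemma runs_insert_main:
  assumes con: "consistent G s" and G: "bounded G" "bounded (add_mset {u, v} G)"
    and uv: "u < n" "v < n" "u \<noteq> v" and reg: "nmem s ''u'' 0 = u" "nmem s ''v'' 0 = v"
  shows "runs b insert_main s (\<lambda>t s'. consistent (add_mset {u, v} G) s' \<and>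
    t \<le> 31 * ((M + 1) * (sc + 1)) + 40 \<and> t + 31 * budget s' \<le> 31 * (M + sc + budget s) + 40)"
  unfolding insert_main_def
proof (rule runs_SequI[OF runs_insert_prefix[OF con G(1) uv reg]], elim conjE exE)
  fix t1 s1 c1
  assume t1: "t1 \<le> (13 :: nat)" and pre1: "pre_inc (add_mset {u, v} G) c1 s1" and b1: "budget s1 = budget s"
  show "runs b (Sequ (WhileDo inc_guard inc_body) inc_accept) s1 (\<lambda>t2 s'. consistent (add_mset {u, v} G) s' \<and>
    t1 + t2 \<le> 31 * ((M + 1) * (sc + 1)) + 40 \<and> t1 + t2 + 31 * budget s' \<le> 31 * (M + sc + budget s) + 40)"
  proof (rule runs_SequI[OF runs_inc_loop[OF pre1 G(2)]], elim conjE exE)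
    fix t2 s2 c2
    assume pre2: "pre_inc (add_mset {u, v} G) c2 s2" and g: "\<not> bval inc_guard s2"
      and t2: "t2 \<le> 31 * ((M + 1) * (sc + 1)) + 1" "t2 + 31 * budget s2 \<le> 31 * (M + budget s1) + 1"
    show "runs b inc_accept s2 (\<lambda>t3 s'. consistent (add_mset {u, v} G) s' \<and>
      t1 + (t2 + t3) \<le> 31 * ((M + 1) * (sc + 1)) + 40 \<and>
      t1 + (t2 + t3) + 31 * budget s' \<le> 31 * (M + sc + budget s) + 40)"
      by (rule runs_mono[OF runs_inc_accept[OF pre2 G(2) g]]) (use t1 t2 b1 in auto)
  qed
qed

end


subsection \<open>Deletion\<close>

definition out_key3 :: nexp where
  "out_key3 = NAdd (NMul (NAdd (NGet ''lev'' (V ''c'')) (NLit 3)) (V ''n'')) (V ''c'')"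

definition high_key :: nexp where
  "high_key = NAdd (NMul (NAdd (NGet ''lev'' (V ''c'')) (NLit 2)) (V ''n'')) (V ''c'')"

definition dec_guard :: bexp where
  "dec_guard = Conj (RLess (RSub (ROfNat (NGet ''deg'' (V ''c''))) (ROfNat (NLit 1)))
      (RMul (RGet ''w'' (V ''c'')) (RGet ''lo'' (V ''c''))))
    (NLess (NLit 0) (NGet ''oc'' out_key3))"

definition dec_body :: com where
  "dec_body = block
    [assign ''e'' (NGet ''oa'' (NMul out_key3 (V ''n''))),
     assign ''x'' (mod_exp (V ''e'') (V ''n'')),
     Sequ del_edge (add_edge ''x'' ''c''),
     assign ''c'' (V ''x'')]"

definition scan_guard :: bexp where
  "scan_guard = Conj (NLess (NLit 0) (V ''i'')) (NLess (NLit 0) (NGet ''ic'' high_key))"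

definition scan_body :: com where
  "scan_body = block
    [assign ''e'' (NGet ''ia'' (NMul high_key (V ''n''))),
     relevel,
     assign ''i'' (NSub (V ''i'') (NLit 1))]"

definition dec_accept :: com where
  "dec_accept = block
    [NPut ''deg'' (V ''c'') (NSub (NGet ''deg'' (V ''c'')) (NLit 1)),
     IfThen (RLess (ROfNat (NGet ''deg'' (V ''c''))) (RMul (RGet ''w'' (V ''c'')) (RGet ''lo'' (V ''c''))))
       level_down Skip]"

definition delete_prefix :: com where
  "delete_prefix = block
    [IfThen (NLess (NLit 0) (NGet ''orient'' (NAdd (NMul (V ''u'') (V ''n'')) (V ''v''))))
       (Sequ (assign ''c'' (V ''v'')) (assign ''x'' (V ''u'')))
       (Sequ (assign ''c'' (V ''u'')) (assign ''x'' (V ''v''))),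
     assign ''e'' (NAdd (NMul (V ''x'') (V ''n'')) (V ''c'')),
     del_edge]"

definition delete_main :: com where
  "delete_main = block
    [delete_prefix,
     WhileDo dec_guard dec_body,
     Sequ (assign ''i'' (V ''s'')) (assign ''j'' (NGet ''lev'' (V ''c''))),
     WhileDo scan_guard scan_body,
     dec_accept]"

context machine
begin

text \<open>The counterpart of \<open>pre_inc\<close>: a unit has left the in-degree of
  \<open>c\<close>, but not yet its counter.\<close>

definition pre_dec :: "graph \<Rightarrow> nat \<Rightarrow> state \<Rightarrow> bool" where
  "pre_dec G c s \<longleftrightarrow> rep s \<and> oriented G s \<and> c < n \<and> nmem s ''c'' 0 = c \<and>
     (\<forall>v<n. ind n (nmem s ''orient'') v + of_bool (v = c) = nmem s ''deg'' v)"

text \<open>The assumption \<open>out\<close> of \<open>core_accept_dec\<close> as a property of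
  states.\<close>

definition quiet_out :: "nat \<Rightarrow> state \<Rightarrow> bool" where
  "quiet_out c s \<longleftrightarrow> (real (nmem s ''deg'' c) - 1 < w c * tau sc (nmem s ''lev'' c) \<longrightarrow>
     (\<forall>e\<in>active n (nmem s ''orient''). e div n = c \<longrightarrow> nmem s ''K'' e \<noteq> nmem s ''lev'' c + 3))"

lemma pre_dec_bounds:
  assumes pre: "pre_dec G c s" and G: "bounded G"
  shows "v < n \<Longrightarrow> nmem s ''lev'' v \<le> M" "v < n \<Longrightarrow> nmem s ''deg'' v + 1 \<le> b"
    "v < n \<Longrightarrow> ind n (nmem s ''orient'') v + 2 \<le> b"
proof -
  have ind: "real (ind n (nmem s ''orient'') v) \<le> \<Lambda> * w v" if "v < n" for v
    using pre G that unfolding pre_dec_def bounded_def oriented_def by blast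
  have deg: "nmem s ''deg'' v \<le> ind n (nmem s ''orient'') v + 1" if "v < n" for v
    using pre that unfolding pre_dec_def by (metis add_left_mono of_bool_def le_numeral_extra(4) zero_le_one)
  show "nmem s ''lev'' v \<le> M" if v: "v < n"
  proof -
    have "real (nmem s ''deg'' v) \<le> \<Lambda> * w v + 1"
      using ind[OF v] deg[OF v] by linarith
    also have "\<dots> \<le> (\<Lambda> + 1) * w v" using w[OF v] by (simp add: algebra_simps)
    finally show ?thesis
      using pre by (intro core_lev_le[OF _ v]) (auto simp: pre_dec_def rep_def)
  qed
  show I: "ind n (nmem s ''orient'') v + 2 \<le> b" if v: "v < n" for v
    using deg_bound[OF v] ind[OF v] by blast
  show "nmem s ''deg'' v + 1 \<le> b" if v: "v < n"
    using deg[OF v] I[OF v] by linarith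
qed

lemma runs_dec_body:
  assumes pre: "pre_dec G c s" and G: "bounded G" and g: "bval dec_guard s"
  shows "runs b dec_body s (\<lambda>t s'. t \<le> 24 \<and> nmem s' ''lev'' = nmem s ''lev'' \<and>
     nmem s' ''rem'' = nmem s ''rem'' \<and> (\<exists>c'. pre_dec G c' s' \<and> nmem s ''lev'' c < nmem s ''lev'' c'))"
proof -
  have c: "c < n" "nmem s ''c'' 0 = c" and rep: "rep s" and o: "oriented G s" and st: "stat s"
    and lk: "linked n (active n (nmem s ''orient'')) s"
    and ind: "\<And>v. v < n \<Longrightarrow> ind n (nmem s ''orient'') v + of_bool (v = c) = nmem s ''deg'' v"
    and core: "core n w sc (nmem s ''orient'') (nmem s ''K'') (nmem s ''lev'') (nmem s ''deg'') (nmem s ''rem'')"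
    using pre by (simp_all add: pre_dec_def rep_def)
  have nn: "nmem s ''n'' 0 = n" using st by (simp add: stat_def)
  note bds = pre_dec_bounds[OF pre G]
  define k where "k = nmem s ''lev'' c + 3"
  have oc: "0 < nmem s ''oc'' (k * n + c)"
    using g by (simp add: dec_guard_def out_key3_def c nn k_def)
  define e where "e = nmem s ''oa'' ((k * n + c) * n)"
  note it = out_item[OF lk refl oc c(1) e_def]
  define x where "x = e mod n"
  have en: "e < n * n" "0 < nmem s ''orient'' e" using it by (simp_all add: active_def)
  have xn: "x < n" using edge_id_eq[OF en(1)] by (simp add: x_def)
  \<comment> \<open>Here the tolerance 3 at the tail meets the tolerance 2 at the head: the head
    \<open>x\<close> is strictly higher than \<open>c\<close>.\<close>
  have "k \<le> nmem s ''lev'' x + 2"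
    using core en it(3) by (auto simp: core_def edge_inv_def x_def)
  then have lx: "nmem s ''lev'' c < nmem s ''lev'' x" by (simp add: k_def)
  define s1 where "s1 = nput ''x'' 0 x (nput ''e'' 0 e s)"
  have fr1: "frame {''x'', ''e''} {} s s1" by (simp add: s1_def frame_nput frame_refl)
  have rep1: "rep s1" by (rule rep_frame[OF rep fr1]) auto
  have s1: "nmem s1 ''e'' 0 = e" "nmem s1 ''x'' 0 = x" "nmem s1 ''c'' 0 = c"
    "nmem s1 ''orient'' = nmem s ''orient''" "nmem s1 ''K'' = nmem s ''K''" "nmem s1 ''lev'' = nmem s ''lev''"
    "nmem s1 ''deg'' = nmem s ''deg''" "nmem s1 ''rem'' = nmem s ''rem''"
    by (simp_all add: s1_def c)
  have o1: "oriented G s1" using o by (simp add: oriented_def s1)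
  have eb: "e \<le> b" "x \<le> b" using en word_bounds(3,4) xn by simp_all
  have 1: "runs b (assign ''e'' (NGet ''oa'' (NMul out_key3 (V ''n'')))) s (\<lambda>t s'. t = 1 \<and> s' = nput ''e'' 0 e s)"
    unfolding runs_NPut out_key3_def nval.simps c nn k_def[symmetric] e_def[symmetric] using eb by simp
  have 2: "runs b (assign ''x'' (mod_exp (V ''e'') (V ''n''))) (nput ''e'' 0 e s) (\<lambda>t s'. t = 1 \<and> s' = s1)"
    using eb by (simp add: runs_NPut nn x_def[symmetric] s1_def)
  have 3: "runs b (Sequ del_edge (add_edge ''x'' ''c'')) s1 (\<lambda>t s'. t \<le> 20 \<and> rep s' \<and> oriented G s' \<and>
      (\<forall>v. ind n (nmem s' ''orient'') v + of_bool (v = e mod n) = ind n (nmem s1 ''orient'') v + of_bool (v = e div n)) \<and>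
      frame ({''orient'', ''K'', ''e''} \<union> link_arrays) {} s1 s')"
    by (rule runs_flip[OF rep1 o1 s1(1)])
      (use s1 it x_def lx bds(1)[OF c(1)] bds(3) in \<open>auto simp: k_def\<close>)
  have 4: "runs b (assign ''c'' (V ''x'')) s2 (\<lambda>t s'. t = 1 \<and> nmem s' ''lev'' = nmem s ''lev'' \<and>
     nmem s' ''rem'' = nmem s ''rem'' \<and> (\<exists>c'. pre_dec G c' s' \<and> nmem s ''lev'' c < nmem s ''lev'' c'))"
    if rep2: "rep s2" and o2: "oriented G s2"
      and i2: "\<forall>v. ind n (nmem s2 ''orient'') v + of_bool (v = e mod n) = ind n (nmem s1 ''orient'') v + of_bool (v = e div n)"
      and fr2: "frame ({''orient'', ''K'', ''e''} \<union> link_arrays) {} s1 s2" for s2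
  proof -
    have s2: "nmem s2 ''lev'' = nmem s ''lev''" "nmem s2 ''deg'' = nmem s ''deg''" "nmem s2 ''rem'' = nmem s ''rem''"
      "nmem s2 ''x'' 0 = x"
      using fr2 s1 by (simp_all add: frame_def)
    define s3 where "s3 = nput ''c'' 0 x s2"
    have s3: "nmem s3 ''lev'' = nmem s ''lev''" "nmem s3 ''deg'' = nmem s ''deg''" "nmem s3 ''rem'' = nmem s ''rem''"
      "nmem s3 ''c'' 0 = x" "nmem s3 ''orient'' = nmem s2 ''orient''"
      by (simp_all add: s3_def s2)
    have "frame {''c''} {} s2 s3" by (simp add: s3_def frame_nput frame_refl)
    then have "rep s3" by (rule rep_frame[OF rep2]) auto
    moreover have "ind n (nmem s2 ''orient'') v + of_bool (v = x) = nmem s ''deg'' v" if "v < n" for v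
      using i2[rule_format, of v] ind[OF that] it(2) s1(4) by (simp add: x_def)
    ultimately have "pre_dec G x s3"
      using o2 xn s3 by (simp add: pre_dec_def oriented_def)
    then show ?thesis
      using lx s3 eb by (auto simp: runs_NPut s2(4) s3_def[symmetric])
  qed
  show ?thesis
    unfolding dec_body_def block.simps
  proof (rule runs_SequI[OF 1], elim conjE, hypsubst, rule runs_SequI[OF 2], elim conjE, hypsubst,
      rule runs_SequI[OF 3], elim conjE)
    fix t s2
    assume t: "t \<le> (20 :: nat)" and A: "rep s2" "oriented G s2"
      "\<forall>v. ind n (nmem s2 ''orient'') v + of_bool (v = e mod n) = ind n (nmem s1 ''orient'') v + of_bool (v = e div n)"
      "frame ({''orient'', ''K'', ''e''} \<union> link_arrays) {} s1 s2"
    show "runs b (assign ''c'' (V ''x'')) s2 (\<lambda>t2 s'. 1 + (1 + (t + t2)) \<le> 24 \<and> nmem s' ''lev'' = nmem s ''lev'' \<and>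
     nmem s' ''rem'' = nmem s ''rem'' \<and> (\<exists>c'. pre_dec G c' s' \<and> nmem s ''lev'' c < nmem s ''lev'' c'))"
      by (rule runs_mono[OF 4[OF A]]) (use t in auto)
  qed
qed

text \<open>Levels rise along the chain and are at most \<open>M\<close>. Nothing is scanned on the
  way, so the chain costs O(M) even in the worst case.\<close>

lemma runs_dec_loop:
  assumes pre: "pre_dec G c s" and G: "bounded G"
  shows "runs b (WhileDo dec_guard dec_body) s (\<lambda>t s'. (\<exists>c'. pre_dec G c' s' \<and> quiet_out c' s') \<and>
    t \<le> 25 * M + 1 \<and> budget s' = budget s)"
proof -
  define lev where "lev = nmem s ''lev''"
  define f where "f = (\<lambda>s' :: state. M - lev (nmem s' ''c'' 0))"
  define I where "I = (\<lambda>t s'. (\<exists>c'. pre_dec G c' s') \<and> nmem s' ''lev'' = lev \<and> budget s' = budget s \<and>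
    t + 25 * f s' \<le> 25 * M)"
  have "runs b (WhileDo dec_guard dec_body) s (\<lambda>t'. (\<lambda>t s'. (\<exists>c'. pre_dec G c' s' \<and> quiet_out c' s') \<and>
    t \<le> 25 * M + 1 \<and> budget s' = budget s) (0 + t'))"
  proof (rule runs_While[where I = I and f = f])
    show "I 0 s" using pre by (auto simp: I_def lev_def f_def)
  next
    fix t s1 assume I: "I t s1" and gd: "bval dec_guard s1"
    then obtain c1 where pre1: "pre_dec G c1 s1" and lev1: "nmem s1 ''lev'' = lev"
      and b1: "budget s1 = budget s" and t1: "t + 25 * f s1 \<le> 25 * M" by (auto simp: I_def)
    have c1: "c1 < n" "nmem s1 ''c'' 0 = c1" using pre1 by (simp_all add: pre_dec_def)
    show "runs b dec_body s1 (\<lambda>t' s'. I (1 + t + t') s' \<and> f s' < f s1)"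
    proof (rule runs_mono[OF runs_dec_body[OF pre1 G gd]], elim conjE exE)
      fix t' s2 c2
      assume t': "t' \<le> (24 :: nat)" and lev2: "nmem s2 ''lev'' = nmem s1 ''lev''" and r: "nmem s2 ''rem'' = nmem s1 ''rem''"
        and pre2: "pre_dec G c2 s2" and lt: "nmem s1 ''lev'' c1 < nmem s1 ''lev'' c2"
      have c2: "c2 < n" "nmem s2 ''c'' 0 = c2" using pre2 by (simp_all add: pre_dec_def)
      have "lev c2 \<le> M" using pre_dec_bounds(1)[OF pre2 G c2(1)] lev1 lev2 by simp
      then have "f s2 < f s1" using lt c1 c2 lev1 by (simp add: f_def)
      then show "I (1 + t + t') s2 \<and> f s2 < f s1"
        using t1 t' lev1 lev2 pre2 b1 r by (auto simp: I_def budget_def)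
    qed
  next
    fix t s1 assume I: "I t s1" and gd: "\<not> bval dec_guard s1"
    then obtain c1 where pre1: "pre_dec G c1 s1" by (auto simp: I_def)
    have c1: "c1 < n" "nmem s1 ''c'' 0 = c1" and st: "stat s1" and lk: "linked n (active n (nmem s1 ''orient'')) s1"
      using pre1 by (simp_all add: pre_dec_def rep_def)
    have lo: "rmem s1 ''lo'' c1 = tau sc (nmem s1 ''lev'' c1)" "rmem s1 ''w'' c1 = w c1" "nmem s1 ''n'' 0 = n"
      using st c1 by (simp_all add: stat_def levels_rep_def)
    have "quiet_out c1 s1"
      unfolding quiet_out_def
    proof (intro impI ballI)
      fix e assume d: "real (nmem s1 ''deg'' c1) - 1 < w c1 * tau sc (nmem s1 ''lev'' c1)"
        and e: "e \<in> active n (nmem s1 ''orient'')" "e div n = c1"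
      have "nmem s1 ''oc'' ((nmem s1 ''lev'' c1 + 3) * n + c1) = 0"
        using gd d by (simp add: dec_guard_def out_key3_def c1 lo)
      from out_bucket_empty[OF lk this e] show "nmem s1 ''K'' e \<noteq> nmem s1 ''lev'' c1 + 3" .
    qed
    then show "(\<exists>c'. pre_dec G c' s1 \<and> quiet_out c' s1) \<and> t + 1 \<le> 25 * M + 1 \<and> budget s1 = budget s"
      using I pre1 by (auto simp: I_def)
  qed
  then show ?thesis unfolding add_0 .
qed

abbreviation high_set :: "state \<Rightarrow> nat \<Rightarrow> nat set" where
  "high_set s c \<equiv> highs n (nmem s ''orient'') (nmem s ''K'') (nmem s ''lev'') c"

abbreviation slack :: "state \<Rightarrow> nat \<Rightarrow> real" where
  "slack s c \<equiv> real sc * (real (nmem s ''deg'' c) - w c * tau sc (nmem s ''lev'' c))"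

text \<open>The new stored level \<open>lev c\<close> differs from \<open>lev c + 3\<close>, so
  \<open>quiet_out\<close> survives the scan.\<close>

lemma runs_scan_body:
  assumes pre: "pre_dec G c s" and G: "bounded G" and g: "bval scan_guard s"
    and j: "nmem s ''j'' 0 = nmem s ''lev'' c" and i: "nmem s ''i'' 0 \<le> sc" and q: "quiet_out c s"
  shows "runs b scan_body s (\<lambda>t s'. t = 17 \<and> pre_dec G c s' \<and> nmem s' ''rem'' = nmem s ''rem'' \<and>
    nmem s' ''deg'' = nmem s ''deg'' \<and> nmem s' ''lev'' = nmem s ''lev'' \<and> nmem s' ''j'' = nmem s ''j'' \<and>
    nmem s' ''i'' 0 + 1 = nmem s ''i'' 0 \<and> quiet_out c s' \<and> card (high_set s' c) + 1 = card (high_set s c))"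
proof -
  have c: "c < n" "nmem s ''c'' 0 = c" and rep: "rep s" and o: "oriented G s" and st: "stat s"
    and lk: "linked n (active n (nmem s ''orient'')) s"
    and ind: "\<And>v. v < n \<Longrightarrow> ind n (nmem s ''orient'') v + of_bool (v = c) = nmem s ''deg'' v"
    and core: "core n w sc (nmem s ''orient'') (nmem s ''K'') (nmem s ''lev'') (nmem s ''deg'') (nmem s ''rem'')"
    using pre by (simp_all add: pre_dec_def rep_def)
  have nn: "nmem s ''n'' 0 = n" using st by (simp add: stat_def)
  have lM: "nmem s ''lev'' c \<le> M" using pre_dec_bounds(1)[OF pre G c(1)] .
  define k where "k = nmem s ''lev'' c + 2"
  have ic: "0 < nmem s ''ic'' (k * n + c)" "0 < nmem s ''i'' 0"
    using g by (simp_all add: scan_guard_def high_key_def c nn k_def)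
  define e where "e = nmem s ''ia'' ((k * n + c) * n)"
  note it = low_item[OF lk refl ic(1) c(1) e_def]
  have eh: "e \<in> high_set s c" using it by (simp add: highs_def active_def k_def)
  have eb: "e \<le> b" using it(1) word_bounds(4) by (simp add: active_def)
  define s1 where "s1 = nput ''e'' 0 e s"
  have fr1: "frame {''e''} {} s s1" by (simp add: s1_def frame_nput frame_refl)
  have rep1: "rep s1" by (rule rep_frame[OF rep fr1]) auto
  have s1: "nmem s1 ''e'' 0 = e" "nmem s1 ''j'' = nmem s ''j''" "nmem s1 ''c'' 0 = c" "nmem s1 ''i'' = nmem s ''i''"
    "nmem s1 ''orient'' = nmem s ''orient''" "nmem s1 ''K'' = nmem s ''K''" "nmem s1 ''lev'' = nmem s ''lev''"
    "nmem s1 ''deg'' = nmem s ''deg''" "nmem s1 ''rem'' = nmem s ''rem''" "nmem s1 ''n'' 0 = n"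
    by (simp_all add: s1_def c nn)
  have 1: "runs b (assign ''e'' (NGet ''ia'' (NMul high_key (V ''n'')))) s (\<lambda>t s'. t = 1 \<and> s' = s1)"
    unfolding runs_NPut high_key_def nval.simps c nn k_def[symmetric] e_def[symmetric] s1_def using eb by simp
  have lk1: "linked n (active n (nmem s ''orient'')) s1" using rep1 by (simp add: rep_def s1)
  have 2: "runs b relevel s1 (\<lambda>t s'. t = 15 \<and> nmem s' ''K'' = (nmem s1 ''K'')(e := nmem s ''lev'' c) \<and>
      linked n (active n (nmem s ''orient'')) s' \<and> frame ({''K''} \<union> link_arrays) {} s1 s')"
    by (rule runs_relevel[OF s1(10,1) it(1) active_subset _ _ lk1 _ word_bounds(1)])
      (use it(3) s1 j lM word_bounds(2) in \<open>auto simp: k_def\<close>)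
  have 3: "runs b (assign ''i'' (NSub (V ''i'') (NLit 1))) s2 (\<lambda>t s'. t = 1 \<and> pre_dec G c s' \<and>
    nmem s' ''rem'' = nmem s ''rem'' \<and>
    nmem s' ''deg'' = nmem s ''deg'' \<and> nmem s' ''lev'' = nmem s ''lev'' \<and> nmem s' ''j'' = nmem s ''j'' \<and>
    nmem s' ''i'' 0 + 1 = nmem s ''i'' 0 \<and> quiet_out c s' \<and> card (high_set s' c) + 1 = card (high_set s c))"
    if K2: "nmem s2 ''K'' = (nmem s1 ''K'')(e := nmem s ''lev'' c)"
      and lk2: "linked n (active n (nmem s ''orient'')) s2"
      and fr2: "frame ({''K''} \<union> link_arrays) {} s1 s2" for s2
  proof -
    have s2: "nmem s2 ''i'' = nmem s ''i''" using fr2 s1 by (simp add: frame_def)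
    define s3 where "s3 = nput ''i'' 0 (nmem s ''i'' 0 - 1) s2"
    have fr3: "frame {''i''} {} s2 s3" by (simp add: s3_def frame_nput frame_refl)
    have s3: "nmem s3 ''lev'' = nmem s ''lev''" "nmem s3 ''deg'' = nmem s ''deg''" "nmem s3 ''rem'' = nmem s ''rem''"
      "nmem s3 ''c'' 0 = c" "nmem s3 ''orient'' = nmem s ''orient''" "nmem s3 ''j'' = nmem s ''j''"
      "nmem s3 ''K'' = (nmem s ''K'')(e := nmem s ''lev'' c)" "nmem s3 ''i'' 0 = nmem s ''i'' 0 - 1"
      using fr2 s1 K2 by (simp_all add: frame_def s3_def)
    have "stat s2" by (rule stat_frame[OF _ fr2]) (use rep1 in \<open>auto simp: rep_def\<close>)
    then have "stat s3" by (rule stat_frame[OF _ fr3]) auto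
    moreover have "linked n (active n (nmem s ''orient'')) s3" by (rule linked_frame[OF lk2 fr3]) auto
    moreover have "core n w sc (nmem s ''orient'') ((nmem s ''K'')(e := nmem s ''lev'' c)) (nmem s ''lev'') (nmem s ''deg'')
        (nmem s ''rem'')"
      by (rule core_scan_high[OF core eh])
    ultimately have "rep s3" by (simp add: rep_def s3)
    then have "pre_dec G c s3" using o ind c by (simp add: pre_dec_def oriented_def s3)
    moreover have "quiet_out c s3" using q by (auto simp: quiet_out_def s3)
    moreover have "card (high_set s3 c) + 1 = card (high_set s c)"
    proof -
      have "high_set s3 c = high_set s c - {e}" by (auto simp: highs_def s3)
      then show ?thesis using eh card_Suc_Diff1[of "high_set s c" e] by simp
    qed
    moreover have "nmem s ''i'' 0 - 1 \<le> b" using i sc by simp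
    ultimately show ?thesis
      unfolding runs_NPut nval.simps s2 s3_def[symmetric] using ic(2) s3 by simp
  qed
  show ?thesis
    unfolding scan_body_def block.simps
  proof (rule runs_SequI[OF 1], elim conjE, hypsubst, rule runs_SequI[OF 2], elim conjE, hypsubst)
    fix s2
    assume A: "nmem s2 ''K'' = (nmem s1 ''K'')(e := nmem s ''lev'' c)"
      "linked n (active n (nmem s ''orient'')) s2" "frame ({''K''} \<union> link_arrays) {} s1 s2"
    show "runs b (assign ''i'' (NSub (V ''i'') (NLit 1))) s2 (\<lambda>t s'. 1 + (15 + t) = 17 \<and> pre_dec G c s' \<and>
      nmem s' ''rem'' = nmem s ''rem'' \<and>
      nmem s' ''deg'' = nmem s ''deg'' \<and> nmem s' ''lev'' = nmem s ''lev'' \<and> nmem s' ''j'' = nmem s ''j'' \<and>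
      nmem s' ''i'' 0 + 1 = nmem s ''i'' 0 \<and> quiet_out c s' \<and> card (high_set s' c) + 1 = card (high_set s c))"
      by (rule runs_mono[OF 3[OF A]]) auto
  qed
qed

text \<open>The sum of the remaining high edges and the refilings made so far stays below
  \<open>slack\<close>. After \<open>sc\<close> refilings this is the second alternative that
  \<open>core_accept_dec\<close> asks for; an earlier end means that no high edge is left.\<close>

lemma runs_scan_loop:
  assumes pre: "pre_dec G c s" and G: "bounded G" and q: "quiet_out c s"
    and j: "nmem s ''j'' 0 = nmem s ''lev'' c" and i: "nmem s ''i'' 0 = sc"
  shows "runs b (WhileDo scan_guard scan_body) s (\<lambda>t s'. pre_dec G c s' \<and> quiet_out c s' \<and>
    (high_set s' c = {} \<or> real (card (high_set s' c)) + real sc \<le> slack s' c) \<and>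
    t \<le> 18 * sc + 1 \<and> budget s' = budget s)"
proof -
  define I where "I = (\<lambda>t s'. pre_dec G c s' \<and> quiet_out c s' \<and> nmem s' ''j'' 0 = nmem s' ''lev'' c \<and>
    nmem s' ''i'' 0 \<le> sc \<and> real (card (high_set s' c)) + real (sc - nmem s' ''i'' 0) \<le> slack s' c \<and>
    budget s' = budget s \<and> t + 18 * nmem s' ''i'' 0 \<le> 18 * sc)"
  have "runs b (WhileDo scan_guard scan_body) s (\<lambda>t'. (\<lambda>t s'. pre_dec G c s' \<and> quiet_out c s' \<and>
    (high_set s' c = {} \<or> real (card (high_set s' c)) + real sc \<le> slack s' c) \<and>
    t \<le> 18 * sc + 1 \<and> budget s' = budget s) (0 + t'))"
  proof (rule runs_While[where I = I and f = "\<lambda>s. nmem s ''i'' 0"])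
    have "real (card (high_set s c)) \<le> slack s c"
      using pre by (simp add: pre_dec_def rep_def core_def vertex_inv_def)
    then show "I 0 s" using pre q i j by (simp add: I_def)
  next
    fix t s1 assume I: "I t s1" and gd: "bval scan_guard s1"
    have A: "pre_dec G c s1" "nmem s1 ''j'' 0 = nmem s1 ''lev'' c" "nmem s1 ''i'' 0 \<le> sc" "quiet_out c s1"
      and B: "real (card (high_set s1 c)) + real (sc - nmem s1 ''i'' 0) \<le> slack s1 c"
        "budget s1 = budget s" "t + 18 * nmem s1 ''i'' 0 \<le> 18 * sc"
      using I unfolding I_def by blast+
    show "runs b scan_body s1 (\<lambda>t' s'. I (1 + t + t') s' \<and> nmem s' ''i'' 0 < nmem s1 ''i'' 0)"
    proof (rule runs_mono[OF runs_scan_body[OF A(1) G gd A(2,3,4)]], elim conjE)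
      fix t' s2
      assume C: "t' = (17 :: nat)" "pre_dec G c s2" "nmem s2 ''rem'' = nmem s1 ''rem''"
        "nmem s2 ''deg'' = nmem s1 ''deg''" "nmem s2 ''lev'' = nmem s1 ''lev''" "nmem s2 ''j'' = nmem s1 ''j''"
        "nmem s2 ''i'' 0 + 1 = nmem s1 ''i'' 0" "quiet_out c s2" "card (high_set s2 c) + 1 = card (high_set s1 c)"
      have "real (card (high_set s2 c)) + real (sc - nmem s2 ''i'' 0) = real (card (high_set s1 c)) + real (sc - nmem s1 ''i'' 0)"
        using C(7,9) A(3) by linarith
      then have "real (card (high_set s2 c)) + real (sc - nmem s2 ''i'' 0) \<le> slack s2 c"
        using B(1) by (simp only: C(4,5))
      moreover have "budget s2 = budget s" using B(2) C(3) by (simp add: budget_def)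
      moreover have "1 + t + t' + 18 * nmem s2 ''i'' 0 \<le> 18 * sc" "nmem s2 ''i'' 0 \<le> sc" "nmem s2 ''i'' 0 < nmem s1 ''i'' 0"
        using C(1,7) B(3) A(3) by linarith+
      ultimately show "I (1 + t + t') s2 \<and> nmem s2 ''i'' 0 < nmem s1 ''i'' 0"
        unfolding I_def using C(2,8) A(2) C(5,6) by simp
    qed
  next
    fix t s1 assume I: "I t s1" and gd: "\<not> bval scan_guard s1"
    have c: "c < n" "nmem s1 ''c'' 0 = c" and lk: "linked n (active n (nmem s1 ''orient'')) s1" and nn: "nmem s1 ''n'' 0 = n"
      using I by (simp_all add: I_def pre_dec_def rep_def stat_def)
    have "high_set s1 c = {} \<or> real (card (high_set s1 c)) + real sc \<le> slack s1 c"
    proof (cases "nmem s1 ''i'' 0 = 0")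
      case True
      then show ?thesis using I unfolding I_def by simp
    next
      case False
      then have "nmem s1 ''ic'' ((nmem s1 ''lev'' c + 2) * n + c) = 0"
        using gd by (simp add: scan_guard_def high_key_def c nn)
      from in_bucket_empty[OF lk this] have "high_set s1 c = {}"
        by (auto simp: highs_def active_def)
      then show ?thesis by simp
    qed
    then show "pre_dec G c s1 \<and> quiet_out c s1 \<and> (high_set s1 c = {} \<or> real (card (high_set s1 c)) + real sc \<le> slack s1 c) \<and>
      t + 1 \<le> 18 * sc + 1 \<and> budget s1 = budget s"
      using I by (simp add: I_def)
  qed
  then show ?thesis unfolding add_0 .
qed

lemma runs_dec_accept:
  assumes pre: "pre_dec G c s" and G: "bounded G" and q: "quiet_out c s"
    and h: "high_set s c = {} \<or> real (card (high_set s c)) + real sc \<le> slack s c"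
  shows "runs b dec_accept s (\<lambda>t s'. t \<le> 20 \<and> consistent G s' \<and> budget s' = budget s)"
proof -
  have c: "c < n" "nmem s ''c'' 0 = c" and o: "oriented G s" and st: "stat s"
    and lk: "linked n (active n (nmem s ''orient'')) s"
    and ind: "\<And>v. v < n \<Longrightarrow> ind n (nmem s ''orient'') v + of_bool (v = c) = nmem s ''deg'' v"
    and core: "core n w sc (nmem s ''orient'') (nmem s ''K'') (nmem s ''lev'') (nmem s ''deg'') (nmem s ''rem'')"
    using pre by (simp_all add: pre_dec_def rep_def)
  define lev where "lev = nmem s ''lev''"
  define deg where "deg = nmem s ''deg''"
  define rm where "rm = nmem s ''rem''"
  define j where "j = (if real (deg c) - 1 < w c * tau sc (lev c) then lev c - 1 else lev c)"
  have d: "ind n (nmem s ''orient'') c + 1 = deg c" using ind[OF c(1)] by (simp add: deg_def)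
  have core': "core n w sc (nmem s ''orient'') (nmem s ''K'') (lev(c := j)) (deg(c := deg c - 1)) rm"
  proof (rule core_accept_dec)
    show "core n w sc (nmem s ''orient'') (nmem s ''K'') lev deg rm"
      using core by (simp add: lev_def deg_def rm_def)
    show "nmem s ''K'' e \<noteq> lev c + 3"
      if "j < lev c" "e < n * n" "0 < nmem s ''orient'' e" "e div n = c" for e
      using q that by (auto simp: quiet_out_def active_def lev_def deg_def j_def split: if_splits)
    show "j = (if real (deg c) - 1 < w c * tau sc (lev c) then lev c - 1 else lev c)" by (simp add: j_def)
  qed (use c w sc d h in \<open>simp_all add: lev_def deg_def\<close>)
  have cb: "c \<le> b" "deg c - 1 \<le> b" using c word_bounds(3) pre_dec_bounds(2)[OF pre G c(1)] by (simp_all add: deg_def)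
  define s1 where "s1 = nput ''deg'' c (deg c - 1) s"
  have s1: "nmem s1 ''c'' 0 = c" "nmem s1 ''lev'' = lev" "nmem s1 ''s'' 0 = sc"
    "nmem s1 ''rem'' = rm" "nmem s1 ''deg'' = deg(c := deg c - 1)"
    "nmem s1 ''orient'' = nmem s ''orient''" "nmem s1 ''K'' = nmem s ''K''"
    "rmem s1 ''w'' c = w c" "rmem s1 ''lo'' c = tau sc (lev c)"
    using st c by (simp_all add: s1_def stat_def lev_def rm_def deg_def levels_rep_def)
  have fr1: "frame {''deg''} {} s s1" by (simp add: s1_def frame_nput frame_refl)
  have st1: "stat s1" by (rule stat_frame[OF st fr1]) auto
  have lk1: "linked n (active n (nmem s ''orient'')) s1" by (rule linked_frame[OF lk fr1]) auto
  have fin: "consistent G s2 \<and> budget s2 = budget s"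
    if st2: "stat s2" and lev2: "nmem s2 ''lev'' = lev(c := j)"
      and fr2: "frame ({''j''} \<union> level_arrays) level_reals s1 s2" for s2
  proof
    have s2: "nmem s2 ''rem'' = rm" "nmem s2 ''deg'' = deg(c := deg c - 1)"
      "nmem s2 ''orient'' = nmem s ''orient''" "nmem s2 ''K'' = nmem s ''K''"
      using fr2 s1 by (simp_all add: frame_def)
    have "linked n (active n (nmem s ''orient'')) s2" by (rule linked_frame[OF lk1 fr2]) auto
    then have "rep s2" using st2 core' by (simp add: rep_def s2 lev2)
    moreover have "ind n (nmem s ''orient'') v = (deg(c := deg c - 1)) v" if "v < n" for v
      using ind[OF that] d by (auto simp: deg_def)
    ultimately show "consistent G s2"
      using o by (simp add: consistent_def oriented_def s2)
    show "budget s2 = budget s" by (simp add: budget_def s2 rm_def)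
  qed
  have 1: "runs b (NPut ''deg'' (V ''c'') (NSub (NGet ''deg'' (V ''c'')) (NLit 1))) s (\<lambda>t s'. t = 1 \<and> s' = s1)"
    unfolding runs_NPut nval.simps c deg_def[symmetric] s1_def using cb by simp
  have dd: "real (deg c - 1) = real (deg c) - 1" using d by simp
  have 2: "runs b (IfThen (RLess (ROfNat (NGet ''deg'' (V ''c''))) (RMul (RGet ''w'' (V ''c'')) (RGet ''lo'' (V ''c''))))
       level_down Skip) s1 (\<lambda>t s'. t \<le> 19 \<and> consistent G s' \<and> budget s' = budget s)"
  proof (cases "real (deg c - 1) < w c * tau sc (lev c)")
    case True
    have "lev c \<noteq> 0" using True by (intro notI) simp
    then have j: "lev c = Suc j" using True dd by (simp add: j_def)
    have "lev c \<le> b" using pre_dec_bounds(1)[OF pre G c(1)] word_bounds(2) by (simp add: lev_def)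
    have "runs b level_down s1 (\<lambda>t s'. t = 13 \<and> nmem s' ''lev'' = (nmem s1 ''lev'')(c := j) \<and>
      levels_rep n w sc s' \<and> frame ({''j''} \<union> level_arrays) level_reals s1 s')"
      by (rule runs_level_down[OF s1(1) c(1) _ s1(3)])
        (use j s1 sc st1 word_bounds(3) \<open>lev c \<le> b\<close> in \<open>simp_all add: stat_def\<close>)
    then have "runs b level_down s1 (\<lambda>t s'. 1 + t \<le> 19 \<and> consistent G s' \<and> budget s' = budget s)"
    proof (rule runs_mono, elim conjE)
      fix t s2
      assume t: "t = (13 :: nat)" and l2: "nmem s2 ''lev'' = (nmem s1 ''lev'')(c := j)"
        and lr: "levels_rep n w sc s2" and fr2: "frame ({''j''} \<union> level_arrays) level_reals s1 s2"
      have "stat s2" using st1 lr frame_nmem[OF fr2] frame_rmem[OF fr2] by (simp add: stat_def)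
      from fin[OF this _ fr2] show "1 + t \<le> 19 \<and> consistent G s2 \<and> budget s2 = budget s"
        using t l2 s1(2) by simp
    qed
    then show ?thesis using True by (simp only: runs_IfThen bval.simps nval.simps rval.simps s1 fun_upd_same if_True)
  next
    case False
    then have "j = lev c" using dd by (simp add: j_def)
    then have "consistent G s1 \<and> budget s1 = budget s"
      using fin[OF st1 _ frame_refl] s1(2) by simp
    then show ?thesis using False by (simp add: runs_IfThen runs_Skip s1)
  qed
  show ?thesis
    unfolding dec_accept_def block.simps
    by (rule runs_SequI[OF 1], elim conjE, hypsubst, rule runs_mono[OF 2], simp)
qed

lemma runs_delete_prefix:
  assumes con: "consistent G s" and G: "bounded G" and gr: "graph_on n G" and uv: "{u, v} \<in># G"
    and reg: "nmem s ''u'' 0 = u" "nmem s ''v'' 0 = v"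
  shows "runs b delete_prefix s (\<lambda>t s'. t \<le> 14 \<and> (\<exists>c. pre_dec (G - {#{u, v}#}) c s') \<and> budget s' = budget s)"
proof -
  obtain a b' where "a < n" "b' < n" "a \<noteq> b'" "{u, v} = {a, b'}"
    using gr uv unfolding graph_on_def by blast
  then have uv': "u < n" "v < n" "u \<noteq> v" by (auto simp: doubleton_eq_iff)
  note bds = consistent_bounds[OF con G]
  have rep: "rep s" and o: "oriented G s" using con by (simp_all add: consistent_def)
  define R where "R = nmem s ''orient''"
  define c where "c = (if 0 < R (u * n + v) then v else u)"
  define x where "x = (if 0 < R (u * n + v) then u else v)"
  define e where "e = x * n + c"
  \<comment> \<open>At least one direction has a copy, because the two numbers add up to a positive
    multiplicity.\<close>
  have "R (u * n + v) + R (v * n + u) = count G {u, v}"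
    using o uv' by (simp add: oriented_def orientation_def R_def)
  moreover have "0 < count G {u, v}" using uv by simp
  ultimately have Re: "0 < R e" by (auto simp: e_def c_def x_def)
  have cx: "c < n" "x < n" "c \<noteq> x" "{x, c} = {u, v}" using uv' by (auto simp: c_def x_def)
  have e: "e < n * n" "e div n = x" "e mod n = c" using cx edge_less[of x n c] by (simp_all add: e_def)
  have nn: "nmem s ''n'' 0 = n" using rep by (simp add: rep_def stat_def)
  define s1 where "s1 = nput ''e'' 0 e (nput ''x'' 0 x (nput ''c'' 0 c s))"
  have fr1: "frame {''e'', ''x'', ''c''} {} s s1" by (simp add: s1_def frame_nput frame_refl)
  have rep1: "rep s1" by (rule rep_frame[OF rep fr1]) auto
  have s1: "nmem s1 ''c'' 0 = c" "nmem s1 ''e'' 0 = e" "nmem s1 ''orient'' = R" "nmem s1 ''n'' 0 = n"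
    "nmem s1 ''lev'' = nmem s ''lev''" "nmem s1 ''K'' = nmem s ''K''" "nmem s1 ''deg'' = nmem s ''deg''"
    "nmem s1 ''rem'' = nmem s ''rem''"
    by (simp_all add: s1_def R_def nn)
  have xb: "u \<le> b" "v \<le> b" "e \<le> b" using uv' e word_bounds(3,4) by simp_all
  have 1: "runs b (IfThen (NLess (NLit 0) (NGet ''orient'' (NAdd (NMul (V ''u'') (V ''n'')) (V ''v''))))
       (Sequ (assign ''c'' (V ''v'')) (assign ''x'' (V ''u'')))
       (Sequ (assign ''c'' (V ''u'')) (assign ''x'' (V ''v'')))) s
     (\<lambda>t s'. t = 3 \<and> s' = nput ''x'' 0 x (nput ''c'' 0 c s))"
    using xb by (simp add: runs_simps reg nn R_def[symmetric] c_def x_def)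
  have 2: "runs b (assign ''e'' (NAdd (NMul (V ''x'') (V ''n'')) (V ''c''))) (nput ''x'' 0 x (nput ''c'' 0 c s))
     (\<lambda>t s'. t = 1 \<and> s' = s1)"
    using xb by (simp add: runs_NPut nn e_def[symmetric] s1_def)
  have core: "core n w sc R (nmem s ''K'') (nmem s ''lev'') (nmem s ''deg'') (nmem s ''rem'')"
    using rep by (simp add: rep_def R_def)
  have "nmem s ''K'' e \<le> nmem s ''lev'' c + 2"
    using core e Re by (auto simp: core_def edge_inv_def)
  then have Kb: "nmem s1 ''K'' e \<le> M + 2" using bds(1)[OF cx(1)] by (simp add: s1)
  have Rb: "R e \<le> b" using R_le_ind[OF e(1), of R] bds(2)[OF cx(1)] by (simp add: e(3) R_def)
  have ea: "e \<in> active n R" using e Re by (simp add: active_def)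
  have lk1: "linked n (active n R) s1" using rep1 by (simp add: rep_def s1)
  have 3: "runs b del_edge s1 (\<lambda>t s'. t \<le> 10 \<and> nmem s' ''orient'' = R(e := R e - 1) \<and>
    linked n (active n (nmem s' ''orient'')) s' \<and> frame ({''orient''} \<union> link_arrays) {} s1 s')"
    by (rule runs_del_edge[OF s1(4,2) ea s1(3)[symmetric] lk1 Kb word_bounds(1) Rb])
  have 4: "pre_dec (G - {#{u, v}#}) c s2 \<and> budget s2 = budget s"
    if s2: "nmem s2 ''orient'' = R(e := R e - 1)" "linked n (active n (nmem s2 ''orient'')) s2"
      and fr2: "frame ({''orient''} \<union> link_arrays) {} s1 s2" for s2
  proof
    have eqs: "nmem s2 ''lev'' = nmem s ''lev''" "nmem s2 ''deg'' = nmem s ''deg''" "nmem s2 ''K'' = nmem s ''K''"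
      "nmem s2 ''rem'' = nmem s ''rem''" "nmem s2 ''c'' 0 = c"
      using fr2 s1 by (simp_all add: frame_def)
    show "budget s2 = budget s" by (simp add: budget_def eqs)
    have "core n w sc (R(e := R e - 1)) (nmem s ''K'') (nmem s ''lev'') (nmem s ''deg'') (nmem s ''rem'')"
      by (rule core_remove[OF core])
    moreover have "stat s2" by (rule stat_frame[OF _ fr2]) (use rep1 in \<open>auto simp: rep_def\<close>)
    ultimately have "rep s2" using s2 by (simp add: rep_def eqs)
    moreover have "oriented (G - {#{u, v}#}) s2"
      using orientation_delete[of n G R x c] o cx Re by (simp add: oriented_def s2(1) R_def e_def)
    moreover have "ind n (R(e := R e - 1)) y + of_bool (y = c) = nmem s ''deg'' y" if "y < n" for y
    proof -
      have "ind n R y = nmem s ''deg'' y" using con that by (simp add: consistent_def R_def)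
      then show ?thesis using ind_remove[of e n R y] e Re by (auto split: if_splits)
    qed
    ultimately show "pre_dec (G - {#{u, v}#}) c s2"
      using cx by (simp add: pre_dec_def eqs s2(1))
  qed
  show ?thesis
    unfolding delete_prefix_def block.simps
  proof (rule runs_SequI[OF 1], elim conjE, hypsubst, rule runs_SequI[OF 2], elim conjE, hypsubst,
      rule runs_mono[OF 3], elim conjE)
    fix t s2
    assume "t \<le> (10 :: nat)" and A: "nmem s2 ''orient'' = R(e := R e - 1)"
      "linked n (active n (nmem s2 ''orient'')) s2" "frame ({''orient''} \<union> link_arrays) {} s1 s2"
    then show "3 + (1 + t) \<le> 14 \<and> (\<exists>c. pre_dec (G - {#{u, v}#}) c s2) \<and> budget s2 = budget s"
      using 4[OF A] by auto
  qed
qed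

lemma runs_delete_main:
  assumes con: "consistent G s" and G: "bounded G" "bounded (G - {#{u, v}#})" and gr: "graph_on n G"
    and uv: "{u, v} \<in># G" and reg: "nmem s ''u'' 0 = u" "nmem s ''v'' 0 = v"
  shows "runs b delete_main s (\<lambda>t s'. consistent (G - {#{u, v}#}) s' \<and>
    t \<le> 25 * M + 18 * sc + 40 \<and> budget s' = budget s)"
  unfolding delete_main_def block.simps
proof (rule runs_SequI[OF runs_delete_prefix[OF con G(1) gr uv reg]], elim conjE exE)
  let ?G = "G - {#{u, v}#}"
  fix t1 s1 c1
  assume t1: "t1 \<le> (14 :: nat)" and pre1: "pre_dec ?G c1 s1" and b1: "budget s1 = budget s"
  show "runs b (Sequ (WhileDo dec_guard dec_body)
      (Sequ (Sequ (assign ''i'' (V ''s'')) (assign ''j'' (NGet ''lev'' (V ''c''))))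
      (Sequ (WhileDo scan_guard scan_body) dec_accept))) s1
    (\<lambda>t2 s'. consistent ?G s' \<and> t1 + t2 \<le> 25 * M + 18 * sc + 40 \<and> budget s' = budget s)"
  proof (rule runs_SequI[OF runs_dec_loop[OF pre1 G(2)]], elim conjE exE)
    fix t2 s2 c
    assume pre2: "pre_dec ?G c s2" and q2: "quiet_out c s2" and t2: "t2 \<le> 25 * M + 1" and b2: "budget s2 = budget s1"
    have c: "c < n" "nmem s2 ''c'' 0 = c" and rep2: "rep s2" and ss: "nmem s2 ''s'' 0 = sc"
      using pre2 by (simp_all add: pre_dec_def rep_def stat_def)
    define s3 where "s3 = nput ''j'' 0 (nmem s2 ''lev'' c) (nput ''i'' 0 sc s2)"
    have fr3: "frame {''i'', ''j''} {} s2 s3" by (simp add: s3_def frame_nput frame_refl)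
    have s3: "nmem s3 ''j'' 0 = nmem s3 ''lev'' c" "nmem s3 ''i'' 0 = sc" "nmem s3 ''c'' 0 = c"
      "nmem s3 ''orient'' = nmem s2 ''orient''" "nmem s3 ''deg'' = nmem s2 ''deg''" "nmem s3 ''lev'' = nmem s2 ''lev''"
      "nmem s3 ''K'' = nmem s2 ''K''" "nmem s3 ''rem'' = nmem s2 ''rem''"
      by (simp_all add: s3_def c)
    have "rep s3" by (rule rep_frame[OF rep2 fr3]) auto
    then have pre3: "pre_dec ?G c s3" using pre2 by (simp add: pre_dec_def oriented_def s3)
    have q3: "quiet_out c s3" using q2 by (simp add: quiet_out_def s3)
    have lb: "nmem s2 ''lev'' c \<le> b" using pre_dec_bounds(1)[OF pre2 G(2) c(1)] word_bounds(2) by simp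
    have b3: "budget s3 = budget s2" by (simp add: budget_def s3)
    have 3: "runs b (Sequ (assign ''i'' (V ''s'')) (assign ''j'' (NGet ''lev'' (V ''c'')))) s2 (\<lambda>t s'. t = 2 \<and> s' = s3)"
      using lb sc by (simp add: runs_simps c ss s3_def)
    show "runs b (Sequ (Sequ (assign ''i'' (V ''s'')) (assign ''j'' (NGet ''lev'' (V ''c''))))
        (Sequ (WhileDo scan_guard scan_body) dec_accept)) s2
      (\<lambda>t3 s'. consistent ?G s' \<and> t1 + (t2 + t3) \<le> 25 * M + 18 * sc + 40 \<and> budget s' = budget s)"
    proof (rule runs_SequI[OF 3], elim conjE, hypsubst, rule runs_SequI[OF runs_scan_loop[OF pre3 G(2) q3 s3(1,2)]], elim conjE)
      fix t4 s4
      assume pre4: "pre_dec ?G c s4" and q4: "quiet_out c s4" and t4: "t4 \<le> 18 * sc + 1" and b4: "budget s4 = budget s3"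
        and h4: "high_set s4 c = {} \<or> real (card (high_set s4 c)) + real sc \<le> slack s4 c"
      show "runs b dec_accept s4 (\<lambda>t5 s'. consistent ?G s' \<and>
        t1 + (t2 + (2 + (t4 + t5))) \<le> 25 * M + 18 * sc + 40 \<and> budget s' = budget s)"
        by (rule runs_mono[OF runs_dec_accept[OF pre4 G(2) q4 h4]]) (use t1 t2 t4 b1 b2 b3 b4 in auto)
    qed
  qed
qed

end


subsection \<open>The reported subgraph\<close>

definition find_top :: com where
  "find_top = Sequ (assign ''t'' (NLit 0))
     (WhileDo (NLess (NLit 0) (NGet ''cge'' (NAdd (V ''t'') (NLit 1)))) (assign ''t'' (NAdd (V ''t'') (NLit 1))))"

text \<open>The weight test is scaled by 4, as it compares with the factor 1 + \<epsilon> /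
  4.\<close>

definition descend_guard :: bexp where
  "descend_guard = Conj (Neg (NLess (V ''t'') (NLit 5)))
     (RLess (RMul (RAdd (ROfNat (NLit 4)) (RGet ''eps'' (NLit 0))) (RGet ''wge'' (V ''t'')))
       (RMul (ROfNat (NLit 4)) (RGet ''wge'' (NSub (V ''t'') (NLit 5)))))"

text \<open>The chosen set is a prefix of \<open>ord\<close>, so its size \<open>cnt\<close>
  represents it implicitly. For \<open>t\<close> below 5 the subtraction truncates and all vertices
  are chosen.\<close>

definition choose_level :: com where
  "choose_level = block
    [find_top,
     WhileDo descend_guard (assign ''t'' (NSub (V ''t'') (NLit 5))),
     assign ''cnt'' (NGet ''cge'' (NSub (V ''t'') (NLit 5)))]"

definition report :: com where
  "report = Sequ (assign ''i'' (NLit 0))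
     (WhileDo (NLess (V ''i'') (V ''cnt''))
       (Sequ (Emit (NGet ''ord'' (V ''i''))) (assign ''i'' (NAdd (V ''i'') (NLit 1)))))"

lemma ordered_level_set:
  assumes "ordered n lev ord pos cge"
  shows "ord ` {..<cge j} = level_set n lev j" "inj_on ord {..<cge j}"
proof -
  have 1: "ord i < n" "pos (ord i) = i" if "i < n" for i using assms that by (auto simp: ordered_def)
  have 2: "pos v < n" "ord (pos v) = v" if "v < n" for v using assms that by (auto simp: ordered_def)
  have 3: "pos v < cge j \<longleftrightarrow> j \<le> lev v" if "v < n" for v using assms that by (auto simp: ordered_def)
  have 4: "cge j \<le> n" using assms by (auto simp: ordered_def)
  show "inj_on ord {..<cge j}"
    using 1 4 by (intro inj_on_inverseI[of _ pos]) auto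
  show "ord ` {..<cge j} = level_set n lev j"
  proof (intro set_eqI iffI)
    fix v assume "v \<in> ord ` {..<cge j}"
    then obtain i where "i < cge j" "v = ord i" by auto
    then show "v \<in> level_set n lev j" using 1[of i] 3[of v] 4 by (simp add: level_set_def)
  next
    fix v assume "v \<in> level_set n lev j"
    then show "v \<in> ord ` {..<cge j}" using 2[of v] 3[of v] by (force simp: level_set_def)
  qed
qed

context machine
begin

text \<open>The outcome of the descent in the form that \<open>chosen_level_guarantee\<close> needs.
  The level is quantified because register \<open>t\<close> is scratch space; only
  \<open>cnt\<close> has to last until the next report.\<close>

definition chosen :: "state \<Rightarrow> bool" where
  "chosen s \<longleftrightarrow> (let lev = nmem s ''lev''; W = level_weight n w lev in
     \<exists>T t i. t + 5 * i = T \<and> (\<forall>v<n. lev v \<le> T) \<and> level_set n lev T \<noteq> {} \<and>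
       (1 + \<epsilon> / 4) ^ i * W T \<le> W t \<and> (t < 5 \<or> W (t - 5) \<le> (1 + \<epsilon> / 4) * W t) \<and>
       nmem s ''cnt'' 0 = nmem s ''cge'' (t - 5))"

definition ready :: "graph \<Rightarrow> state \<Rightarrow> bool" where
  "ready G s \<longleftrightarrow> consistent G s \<and> chosen s"

lemma consistent_frame:
  assumes "consistent G s" "frame X {} s s'" "X \<subseteq> {''u'', ''v'', ''c'', ''x'', ''e'', ''j'', ''i'', ''l'', ''t'', ''cnt''}"
  shows "consistent G s'" "budget s' = budget s"
proof -
  have eqs: "nmem s' x = nmem s x" if "x \<in> {''orient'', ''deg'', ''rem''}" for x
    using assms(2,3) that by (intro frame_nmem[OF assms(2)]) auto
  show "consistent G s'"
    using assms rep_frame[OF _ assms(2,3)] by (simp add: consistent_def oriented_def eqs)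
  show "budget s' = budget s" by (simp add: budget_def eqs)
qed

text \<open>Level sets are nested and the one for level 0 is nonempty, so the search stops at the
  highest occupied level.\<close>

lemma runs_find_top:
  assumes con: "consistent G s" and G: "bounded G"
  shows "runs b find_top s (\<lambda>t s'. \<exists>T. t \<le> 2 * M + 2 \<and> frame {''t''} {} s s' \<and> nmem s' ''t'' 0 = T \<and> T \<le> M \<and>
    (\<forall>v<n. nmem s ''lev'' v \<le> T) \<and> level_set n (nmem s ''lev'') T \<noteq> {})"
proof -
  define lev where "lev = nmem s ''lev''"
  have ord: "ordered n lev (nmem s ''ord'') (nmem s ''pos'') (nmem s ''cge'')"
    using con by (simp add: consistent_def rep_def stat_def levels_rep_def lev_def)
  have cge: "0 < nmem s ''cge'' j \<longleftrightarrow> level_set n lev j \<noteq> {}" for j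
    using ordered_level_set(1)[OF ord, of j] by auto
  have lM: "lev v \<le> M" if "v < n" for v
    using consistent_bounds(1)[OF con G that] by (simp add: lev_def)
  define I where "I = (\<lambda>t s'. frame {''t''} {} s s' \<and> nmem s' ''t'' 0 \<le> M \<and>
    level_set n lev (nmem s' ''t'' 0) \<noteq> {} \<and> t + 2 * (M - nmem s' ''t'' 0) \<le> 2 * M)"
  define s1 where "s1 = nput ''t'' 0 0 s"
  have 1: "runs b (assign ''t'' (NLit 0)) s (\<lambda>t s'. t = 1 \<and> s' = s1)"
    by (simp add: runs_NPut s1_def)
  have 2: "runs b (WhileDo (NLess (NLit 0) (NGet ''cge'' (NAdd (V ''t'') (NLit 1)))) (assign ''t'' (NAdd (V ''t'') (NLit 1)))) s1
    (\<lambda>t'. (\<lambda>t s'. \<exists>T. t \<le> 2 * M + 1 \<and> frame {''t''} {} s s' \<and> nmem s' ''t'' 0 = T \<and> T \<le> M \<and>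
    (\<forall>v<n. lev v \<le> T) \<and> level_set n lev T \<noteq> {}) (0 + t'))"
  proof (rule runs_While[where I = I and f = "\<lambda>s'. M - nmem s' ''t'' 0"])
    show "I 0 s1" using n by (simp add: I_def s1_def frame_nput frame_refl lessThan_empty_iff)
  next
    fix t s2 assume I: "I t s2" and g: "bval (NLess (NLit 0) (NGet ''cge'' (NAdd (V ''t'') (NLit 1)))) s2"
    define T where "T = nmem s2 ''t'' 0"
    have fr: "frame {''t''} {} s s2" and T: "t + 2 * (M - T) \<le> 2 * M" using I by (simp_all add: I_def T_def)
    have "nmem s2 ''cge'' = nmem s ''cge''" using fr by (simp add: frame_def)
    then have ne: "level_set n lev (T + 1) \<noteq> {}" using g cge[of "T + 1"] by (simp add: T_def)
    then have TM: "T + 1 \<le> M" using lM by (force simp: level_set_def)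
    have "I (1 + t + 1) (nput ''t'' 0 (T + 1) s2)"
      using fr T TM ne by (simp add: I_def frame_nput)
    then show "runs b (assign ''t'' (NAdd (V ''t'') (NLit 1))) s2
      (\<lambda>t' s'. I (1 + t + t') s' \<and> M - nmem s' ''t'' 0 < M - nmem s2 ''t'' 0)"
      using TM word_bounds(2) by (simp add: runs_NPut T_def[symmetric])
  next
    fix t s2 assume I: "I t s2" and g: "\<not> bval (NLess (NLit 0) (NGet ''cge'' (NAdd (V ''t'') (NLit 1)))) s2"
    define T where "T = nmem s2 ''t'' 0"
    have fr: "frame {''t''} {} s s2" and T: "t \<le> 2 * M" "T \<le> M" "level_set n lev T \<noteq> {}"
      using I by (simp_all add: I_def T_def)
    have "nmem s2 ''cge'' = nmem s ''cge''" using fr by (simp add: frame_def)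
    then have "level_set n lev (T + 1) = {}" using g cge[of "T + 1"] by (simp add: T_def)
    then have "\<forall>v<n. lev v \<le> T" by (force simp: level_set_def)
    then show "\<exists>T. t + 1 \<le> 2 * M + 1 \<and> frame {''t''} {} s s2 \<and> nmem s2 ''t'' 0 = T \<and> T \<le> M \<and>
      (\<forall>v<n. lev v \<le> T) \<and> level_set n lev T \<noteq> {}"
      using fr T by (simp add: T_def)
  qed
  show ?thesis
    unfolding find_top_def lev_def[symmetric]
    by (rule runs_SequI[OF 1], elim conjE, hypsubst, rule runs_mono[OF 2], auto)
qed

lemma runs_choose_level:
  assumes con: "consistent G s" and G: "bounded G"
  shows "runs b choose_level s (\<lambda>t s'. t \<le> 4 * M + 10 \<and> ready G s' \<and> budget s' = budget s)"
proof -
  define lev where "lev = nmem s ''lev''"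
  define W where "W = level_weight n w lev"
  have ord: "ordered n lev (nmem s ''ord'') (nmem s ''pos'') (nmem s ''cge'')"
    and wge: "\<And>j. rmem s ''wge'' j = W j" and ep: "rmem s ''eps'' 0 = \<epsilon>"
    using con by (simp_all add: consistent_def rep_def stat_def levels_rep_def lev_def W_def)
  have cge: "nmem s ''cge'' j \<le> b" for j using ord word_bounds(3) unfolding ordered_def by (meson le_trans)
  show ?thesis
    unfolding choose_level_def block.simps
  proof (rule runs_SequI[OF runs_find_top[OF con G]], elim exE conjE, fold lev_def)
    fix t1 s1 T
    assume t1: "t1 \<le> 2 * M + 2" and fr1: "frame {''t''} {} s s1" and T1: "nmem s1 ''t'' 0 = T" "T \<le> M"
      and T: "\<forall>v<n. lev v \<le> T" "level_set n lev T \<noteq> {}"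
    define I where "I = (\<lambda>t s'. frame {''t''} {} s s' \<and> (\<exists>i. nmem s' ''t'' 0 + 5 * i = T \<and>
      (1 + \<epsilon> / 4) ^ i * W T \<le> W (nmem s' ''t'' 0)) \<and> t + 2 * nmem s' ''t'' 0 \<le> 2 * T)"
    have rw: "rval (RMul (RAdd (ROfNat (NLit 4)) (RGet ''eps'' (NLit 0))) (RGet ''wge'' (V ''t''))) s2 = (4 + \<epsilon>) * W (nmem s2 ''t'' 0)"
      "rval (RMul (ROfNat (NLit 4)) (RGet ''wge'' (NSub (V ''t'') (NLit 5)))) s2 = 4 * W (nmem s2 ''t'' 0 - 5)"
      if "frame {''t''} {} s s2" for s2
      using frame_rmem[OF that] by (simp_all add: wge ep)
    have 2: "runs b (WhileDo descend_guard (assign ''t'' (NSub (V ''t'') (NLit 5)))) s1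
      (\<lambda>t'. (\<lambda>t s'. t \<le> 2 * M + 1 \<and> frame {''t''} {} s s' \<and> (\<exists>i. nmem s' ''t'' 0 + 5 * i = T \<and>
      (1 + \<epsilon> / 4) ^ i * W T \<le> W (nmem s' ''t'' 0)) \<and>
      (nmem s' ''t'' 0 < 5 \<or> W (nmem s' ''t'' 0 - 5) \<le> (1 + \<epsilon> / 4) * W (nmem s' ''t'' 0))) (0 + t'))"
    proof (rule runs_While[where I = I and f = "\<lambda>s'. nmem s' ''t'' 0"])
      show "I 0 s1" using fr1 T1 by (auto simp: I_def intro!: exI[of _ 0])
    next
      fix t s2 assume I: "I t s2" and g: "bval descend_guard s2"
      define r where "r = nmem s2 ''t'' 0"
      obtain i where fr: "frame {''t''} {} s s2" and i: "r + 5 * i = T" "(1 + \<epsilon> / 4) ^ i * W T \<le> W r"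
        and t: "t + 2 * r \<le> 2 * T" using I by (auto simp: I_def r_def)
      have r: "5 \<le> r" "(4 + \<epsilon>) * W r < 4 * W (r - 5)"
        using g unfolding descend_guard_def bval.simps rw[OF fr] by (simp_all add: r_def)
      have "(1 + \<epsilon> / 4) ^ Suc i * W T \<le> W (r - 5)"
      proof -
        have "(1 + \<epsilon> / 4) * ((1 + \<epsilon> / 4) ^ i * W T) \<le> (1 + \<epsilon> / 4) * W r"
          using i(2) eps by (intro mult_left_mono) auto
        also have "\<dots> \<le> W (r - 5)" using r(2) by (simp add: algebra_simps)
        finally show ?thesis by (simp add: mult.assoc)
      qed
      moreover have "r - 5 + 5 * Suc i = T" using i(1) r(1) by simp
      ultimately have "\<exists>i. r - 5 + 5 * i = T \<and> (1 + \<epsilon> / 4) ^ i * W T \<le> W (r - 5)" by blast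
      then have "I (1 + t + 1) (nput ''t'' 0 (r - 5) s2)"
        using fr t r(1) by (simp add: I_def frame_nput)
      moreover have "r \<le> b" using i(1) T1 word_bounds(2) by simp
      ultimately show "runs b (assign ''t'' (NSub (V ''t'') (NLit 5))) s2
        (\<lambda>t' s'. I (1 + t + t') s' \<and> nmem s' ''t'' 0 < nmem s2 ''t'' 0)"
        using r(1) by (simp add: runs_NPut r_def[symmetric])
    next
      fix t s2 assume I: "I t s2" and g: "\<not> bval descend_guard s2"
      have fr: "frame {''t''} {} s s2" using I by (simp add: I_def)
      have "nmem s2 ''t'' 0 < 5 \<or> W (nmem s2 ''t'' 0 - 5) \<le> (1 + \<epsilon> / 4) * W (nmem s2 ''t'' 0)"
        using g unfolding descend_guard_def bval.simps rw[OF fr] by (auto simp: algebra_simps)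
      then show "t + 1 \<le> 2 * M + 1 \<and> frame {''t''} {} s s2 \<and> (\<exists>i. nmem s2 ''t'' 0 + 5 * i = T \<and>
        (1 + \<epsilon> / 4) ^ i * W T \<le> W (nmem s2 ''t'' 0)) \<and>
        (nmem s2 ''t'' 0 < 5 \<or> W (nmem s2 ''t'' 0 - 5) \<le> (1 + \<epsilon> / 4) * W (nmem s2 ''t'' 0))"
        using I T1(2) by (simp add: I_def)
    qed
    note 2 = 2[unfolded add_0]
    show "runs b (Sequ (WhileDo descend_guard (assign ''t'' (NSub (V ''t'') (NLit 5))))
        (assign ''cnt'' (NGet ''cge'' (NSub (V ''t'') (NLit 5))))) s1
      (\<lambda>t2 s'. t1 + t2 \<le> 4 * M + 10 \<and> ready G s' \<and> budget s' = budget s)"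
    proof (rule runs_SequI[OF 2], elim conjE exE)
      fix t2 s2 i
      assume t2: "t2 \<le> 2 * M + 1" and fr: "frame {''t''} {} s s2"
        and A: "nmem s2 ''t'' 0 + 5 * i = T" "(1 + \<epsilon> / 4) ^ i * W T \<le> W (nmem s2 ''t'' 0)"
          "nmem s2 ''t'' 0 < 5 \<or> W (nmem s2 ''t'' 0 - 5) \<le> (1 + \<epsilon> / 4) * W (nmem s2 ''t'' 0)"
      define r where "r = nmem s2 ''t'' 0"
      define s3 where "s3 = nput ''cnt'' 0 (nmem s ''cge'' (r - 5)) s2"
      have cge2: "nmem s2 ''cge'' = nmem s ''cge''" "nmem s2 ''lev'' = lev" using fr by (simp_all add: frame_def lev_def)
      have fr3: "frame {''t'', ''cnt''} {} s s3" using fr by (auto simp: s3_def frame_def)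
      have s3: "nmem s3 ''lev'' = lev" "nmem s3 ''cge'' = nmem s ''cge''" "nmem s3 ''cnt'' 0 = nmem s ''cge'' (r - 5)"
        by (simp_all add: s3_def cge2)
      have "chosen s3"
        unfolding chosen_def Let_def s3 W_def[symmetric]
        by (rule exI[of _ T], rule exI[of _ r], rule exI[of _ i]) (use A T in \<open>simp add: r_def\<close>)
      moreover have "consistent G s3" "budget s3 = budget s"
        using consistent_frame[OF con fr3] by simp_all
      ultimately have "ready G s3" "budget s3 = budget s" by (simp_all add: ready_def)
      then show "runs b (assign ''cnt'' (NGet ''cge'' (NSub (V ''t'') (NLit 5)))) s2
        (\<lambda>t3 s'. t1 + (t2 + t3) \<le> 4 * M + 10 \<and> ready G s' \<and> budget s' = budget s)"
        using t1 t2 cge by (simp add: runs_NPut cge2 r_def[symmetric] s3_def[symmetric])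
    qed
  qed
qed

end


subsection \<open>The data structure\<close>

text \<open>
  Reals cannot be rounded, so \<open>log\<^sub>2 (n W)\<close> is found by repeated doubling and \<open>s\<close>, about
  \<open>1000 log\<^sub>2 (n W) / \<epsilon>\<^sup>2\<close>, by counting upwards.
\<close>

definition initialize :: com where
  "initialize = block
    [WhileDo (NLess (V ''i'') (V ''n''))
      (block
        [NPut ''ord'' (V ''i'') (V ''i''),
         NPut ''pos'' (V ''i'') (V ''i''),
         RPut ''hi'' (V ''i'') (ROfNat (NLit 2)),
         RPut ''wge'' (NLit 0) (RAdd (RGet ''wge'' (NLit 0)) (RGet ''w'' (V ''i''))),
         IfThen (RLess (RGet ''W'' (NLit 0)) (RGet ''w'' (V ''i''))) (RPut ''W'' (NLit 0) (RGet ''w'' (V ''i''))) Skip,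
         assign ''i'' (NAdd (V ''i'') (NLit 1))]),
     Sequ (NPut ''cge'' (NLit 0) (V ''n''))
       (Sequ (assign ''cnt'' (V ''n'')) (RPut ''p'' (NLit 0) (ROfNat (NLit 1)))),
     WhileDo (RLess (RGet ''p'' (NLit 0)) (RMul (ROfNat (V ''n'')) (RGet ''W'' (NLit 0))))
      (Sequ (RPut ''p'' (NLit 0) (RMul (ROfNat (NLit 2)) (RGet ''p'' (NLit 0)))) (assign ''j'' (NAdd (V ''j'') (NLit 1)))),
     IfThen (NLess (V ''j'') (NLit 1)) (assign ''j'' (NLit 1)) Skip,
     assign ''s'' (NLit 2),
     WhileDo (RLess (RMul (RMul (ROfNat (V ''s'')) (RGet ''eps'' (NLit 0))) (RGet ''eps'' (NLit 0)))
        (RMul (ROfNat (NLit 1000)) (ROfNat (V ''j''))))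
      (assign ''s'' (NAdd (V ''s'') (NLit 1)))]"

definition algorithm :: data_structure where
  "algorithm = \<lparr>init_code = initialize, insert_code = Sequ insert_main choose_level,
     delete_code = Sequ delete_main choose_level, report_code = report\<rparr>"

section \<open>Correctness and cost of single operations\<close>

context machine
begin

lemma consistent_written: "consistent G (s\<lparr>written := xs\<rparr>) = consistent G s"
  by (simp add: consistent_def rep_def stat_def oriented_def linked_def levels_rep_def)

lemma ready_written: "ready G (s\<lparr>written := xs\<rparr>) = ready G s"
  by (simp add: ready_def consistent_written chosen_def)

lemma budget_written: "budget (s\<lparr>written := xs\<rparr>) = budget s"
  by (simp add: budget_def)

lemma ready_chosen_level:
  assumes "ready G s"
  obtains t T i where "t + 5 * i = T" "\<forall>v<n. nmem s ''lev'' v \<le> T" "level_set n (nmem s ''lev'') T \<noteq> {}"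
    "(1 + \<epsilon> / 4) ^ i * level_weight n w (nmem s ''lev'') T \<le> level_weight n w (nmem s ''lev'') t"
    "t < 5 \<or> level_weight n w (nmem s ''lev'') (t - 5) \<le> (1 + \<epsilon> / 4) * level_weight n w (nmem s ''lev'') t"
    "set (map (nmem s ''ord'') [0..<nmem s ''cnt'' 0]) = level_set n (nmem s ''lev'') (t - 5)"
    "distinct (map (nmem s ''ord'') [0..<nmem s ''cnt'' 0])"
proof -
  obtain t T i where *: "t + 5 * i = T" "\<forall>v<n. nmem s ''lev'' v \<le> T" "level_set n (nmem s ''lev'') T \<noteq> {}"
    "(1 + \<epsilon> / 4) ^ i * level_weight n w (nmem s ''lev'') T \<le> level_weight n w (nmem s ''lev'') t"
    "t < 5 \<or> level_weight n w (nmem s ''lev'') (t - 5) \<le> (1 + \<epsilon> / 4) * level_weight n w (nmem s ''lev'') t"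
    "nmem s ''cnt'' 0 = nmem s ''cge'' (t - 5)"
    using assms unfolding ready_def chosen_def Let_def by blast
  have ord: "ordered n (nmem s ''lev'') (nmem s ''ord'') (nmem s ''pos'') (nmem s ''cge'')"
    using assms by (simp add: ready_def consistent_def rep_def stat_def levels_rep_def)
  have "set (map (nmem s ''ord'') [0..<nmem s ''cnt'' 0]) = level_set n (nmem s ''lev'') (t - 5)"
    "distinct (map (nmem s ''ord'') [0..<nmem s ''cnt'' 0])"
    using ordered_level_set[OF ord, of "t - 5"] *(6) by (simp_all add: distinct_map atLeast_upt)
  with * show ?thesis using that by blast
qed

text \<open>A report touches only register \<open>i\<close> and the output, so the states of its
  loop can be named explicitly and the structure remains usable.\<close>

lemma runs_report:
  assumes rd: "ready G s" and wr: "written s = []"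
  shows "runs b report s (\<lambda>t s'. t \<le> 3 * nmem s ''cnt'' 0 + 2 \<and> ready G s' \<and> budget s' = budget s \<and>
    written s' = map (nmem s ''ord'') [0..<nmem s ''cnt'' 0])"
proof -
  define m where "m = nmem s ''cnt'' 0"
  define st where "st = (\<lambda>k. (nput ''i'' 0 k s)\<lparr>written := map (nmem s ''ord'') [0..<k]\<rparr>)"
  have ord: "ordered n (nmem s ''lev'') (nmem s ''ord'') (nmem s ''pos'') (nmem s ''cge'')"
    using rd by (simp add: ready_def consistent_def rep_def stat_def levels_rep_def)
  have mn: "m \<le> n" using rd ord unfolding m_def ready_def chosen_def Let_def ordered_def by metis
  have ordb: "nmem s ''ord'' k \<le> b" if "k < m" for k
    using ord mn that word_bounds(3) unfolding ordered_def by (meson le_trans less_imp_le order_less_le_trans)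
  have 1: "runs b (assign ''i'' (NLit 0)) s (\<lambda>t s'. t = 1 \<and> s' = st 0)"
    using wr by (simp add: runs_NPut st_def nput_def)
  define I where "I = (\<lambda>t s'. \<exists>k\<le>m. s' = st k \<and> t = 3 * k)"
  have 2: "runs b (WhileDo (NLess (V ''i'') (V ''cnt''))
       (Sequ (Emit (NGet ''ord'' (V ''i''))) (assign ''i'' (NAdd (V ''i'') (NLit 1))))) (st 0)
     (\<lambda>t'. (\<lambda>t s'. t \<le> 3 * m + 1 \<and> s' = st m) (0 + t'))"
  proof (rule runs_While[where I = I and f = "\<lambda>s'. m - nmem s' ''i'' 0"])
    show "I 0 (st 0)" by (auto simp: I_def)
  next
    fix t s2 assume I: "I t s2" and g: "bval (NLess (V ''i'') (V ''cnt'')) s2"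
    then obtain k where k: "s2 = st k" "t = 3 * k" "k < m" by (auto simp: I_def st_def m_def)
    have "I (1 + t + 2) (st (Suc k))" unfolding I_def by (rule exI[of _ "Suc k"]) (use k in simp)
    moreover have "nput ''i'' 0 (Suc k) ((st k)\<lparr>written := written (st k) @ [nmem s ''ord'' k]\<rparr>) = st (Suc k)"
      by (simp add: st_def nput_def)
    ultimately show "runs b (Sequ (Emit (NGet ''ord'' (V ''i''))) (assign ''i'' (NAdd (V ''i'') (NLit 1)))) s2
      (\<lambda>t' s'. I (1 + t + t') s' \<and> m - nmem s' ''i'' 0 < m - nmem s2 ''i'' 0)"
      using ordb[OF k(3)] k(3) mn word_bounds(3)
      by (simp add: runs_Sequ runs_Emit runs_NPut k(1)) (simp add: st_def)
  next
    fix t s2 assume I: "I t s2" and g: "\<not> bval (NLess (V ''i'') (V ''cnt'')) s2"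
    then show "t + 1 \<le> 3 * m + 1 \<and> s2 = st m" by (auto simp: I_def st_def m_def)
  qed
  have "frame {''i''} {} s (nput ''i'' 0 m s)" by (simp add: frame_nput frame_refl)
  then have "consistent G (nput ''i'' 0 m s)" "budget (nput ''i'' 0 m s) = budget s"
    using consistent_frame[of G s "{''i''}"] rd by (simp_all add: ready_def)
  then have fin: "ready G (st m)" "budget (st m) = budget s" "written (st m) = map (nmem s ''ord'') [0..<m]"
    using rd by (simp_all add: st_def consistent_written budget_written ready_def chosen_def)
  show ?thesis
    unfolding report_def m_def[symmetric]
    by (rule runs_SequI[OF 1], elim conjE, hypsubst, rule runs_mono[OF 2[unfolded add_0]]) (use fin in auto)
qed

lemma ready_call_state:
  assumes "ready G s"
  shows "ready G (call_state p s)" "budget (call_state p s) = budget s" "written (call_state p s) = []"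
proof -
  have *: "ready G (nput ''u'' 0 u (nput ''v'' 0 v (s\<lparr>written := []\<rparr>)))"
    "budget (nput ''u'' 0 u (nput ''v'' 0 v (s\<lparr>written := []\<rparr>))) = budget s" for u v
  proof -
    let ?s = "s\<lparr>written := []\<rparr>" and ?s' = "nput ''u'' 0 u (nput ''v'' 0 v (s\<lparr>written := []\<rparr>))"
    have "frame {''u'', ''v''} {} ?s ?s'" by (simp add: frame_nput frame_refl)
    then have "consistent G ?s'" "budget ?s' = budget ?s"
      using consistent_frame[of G ?s "{''u'', ''v''}" ?s'] assms by (simp_all add: ready_def consistent_written)
    then show "ready G ?s'" "budget ?s' = budget s"
      using assms by (simp_all add: ready_def chosen_def budget_written)
  qed
  show "ready G (call_state p s)" "budget (call_state p s) = budget s" "written (call_state p s) = []"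
    using * assms by (cases p; simp add: ready_written budget_written)+
qed

lemma graph_on_insert: "graph_on n G \<Longrightarrow> u < n \<Longrightarrow> v < n \<Longrightarrow> u \<noteq> v \<Longrightarrow> graph_on n (add_mset {u, v} G)"
  by (auto simp: graph_on_def)

lemma graph_on_delete: "graph_on n G \<Longrightarrow> graph_on n (G - {#e#})"
  by (auto simp: graph_on_def dest: in_diffD)

text \<open>31 is the cost of one iteration of the insertion loop, so 31 times \<open>budget\<close>
  is the potential. The choice of the level adds 4 M to both bounds. Reports leave the potential
  unchanged and may be interleaved freely.\<close>

lemma runs_operation:
  assumes rd: "ready G s" and gr: "graph_on n G" and G: "bounded G" and ok: "operation_ok n G p"
    and G': "bounded (apply_operation G p)"
  shows "graph_on n (apply_operation G p)"
    and "runs b (code_of algorithm p) (call_state p s) (\<lambda>t s'. ready (apply_operation G p) s' \<and>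
      (p = Report \<longrightarrow> budget s' = budget s) \<and>
      (p \<noteq> Report \<longrightarrow> t \<le> 31 * ((M + 1) * (sc + 1)) + 29 * M + 18 * sc + 60 \<and>
         t + 31 * budget s' \<le> 35 * M + 31 * sc + 60 + 31 * budget s))"
proof -
  define c where "c = call_state p s"
  have c: "ready G c" "budget c = budget s" "written c = []"
    using ready_call_state[OF rd, of p] by (simp_all add: c_def)
  have con: "consistent G c" using c by (simp add: ready_def)
  show "graph_on n (apply_operation G p)"
    using gr ok graph_on_insert graph_on_delete by (cases p) auto
  have choose: "runs b (Sequ pr choose_level) c (\<lambda>t s'. ready (apply_operation G p) s' \<and>
      (p = Report \<longrightarrow> budget s' = budget s) \<and>
      (p \<noteq> Report \<longrightarrow> t \<le> 31 * ((M + 1) * (sc + 1)) + 29 * M + 18 * sc + 60 \<and>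
         t + 31 * budget s' \<le> 35 * M + 31 * sc + 60 + 31 * budget s))"
    if "p \<noteq> Report" and pr: "runs b pr c (\<lambda>t s'. consistent (apply_operation G p) s' \<and>
      t \<le> 31 * ((M + 1) * (sc + 1)) + 25 * M + 18 * sc + 40 \<and> t + 31 * budget s' \<le> 31 * M + 31 * sc + 31 * budget s + 40)" for pr
  proof (rule runs_SequI[OF pr], elim conjE)
    fix t1 s1
    assume A: "consistent (apply_operation G p) s1" "t1 \<le> 31 * ((M + 1) * (sc + 1)) + 25 * M + 18 * sc + 40"
      "t1 + 31 * budget s1 \<le> 31 * M + 31 * sc + 31 * budget s + 40"
    show "runs b choose_level s1 (\<lambda>t2 s'. ready (apply_operation G p) s' \<and>
      (p = Report \<longrightarrow> budget s' = budget s) \<and>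
      (p \<noteq> Report \<longrightarrow> t1 + t2 \<le> 31 * ((M + 1) * (sc + 1)) + 29 * M + 18 * sc + 60 \<and>
         t1 + t2 + 31 * budget s' \<le> 35 * M + 31 * sc + 60 + 31 * budget s))"
      by (rule runs_mono[OF runs_choose_level[OF A(1) G']]) (use A that(1) in auto)
  qed
  have "runs b (code_of algorithm p) c (\<lambda>t s'. ready (apply_operation G p) s' \<and>
      (p = Report \<longrightarrow> budget s' = budget s) \<and>
      (p \<noteq> Report \<longrightarrow> t \<le> 31 * ((M + 1) * (sc + 1)) + 29 * M + 18 * sc + 60 \<and>
         t + 31 * budget s' \<le> 35 * M + 31 * sc + 60 + 31 * budget s))"
  proof (cases p)
    case (Insert u v)
    have reg: "nmem c ''u'' 0 = u" "nmem c ''v'' 0 = v" by (simp_all add: c_def Insert)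
    have G'': "bounded (add_mset {u, v} G)" using G' Insert by simp
    have "runs b insert_main c (\<lambda>t s'. consistent (apply_operation G p) s' \<and>
      t \<le> 31 * ((M + 1) * (sc + 1)) + 25 * M + 18 * sc + 40 \<and> t + 31 * budget s' \<le> 31 * M + 31 * sc + 31 * budget s + 40)"
      by (rule runs_mono[OF runs_insert_main[OF con G G'' _ _ _ reg]]) (use ok c(2) Insert in auto)
    moreover have "code_of algorithm p = Sequ insert_main choose_level"
      using Insert by (simp add: algorithm_def)
    ultimately show ?thesis
      using choose[of insert_main] Insert by simp
  next
    case (Delete u v)
    have reg: "nmem c ''u'' 0 = u" "nmem c ''v'' 0 = v" by (simp_all add: c_def Delete)
    have G'': "bounded (G - {#{u, v}#})" using G' Delete by simp
    have "runs b delete_main c (\<lambda>t s'. consistent (apply_operation G p) s' \<and>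
      t \<le> 31 * ((M + 1) * (sc + 1)) + 25 * M + 18 * sc + 40 \<and> t + 31 * budget s' \<le> 31 * M + 31 * sc + 31 * budget s + 40)"
      by (rule runs_mono[OF runs_delete_main[OF con G G'' gr _ reg]]) (use ok c(2) Delete in auto)
    moreover have "code_of algorithm p = Sequ delete_main choose_level"
      using Delete by (simp add: algorithm_def)
    ultimately show ?thesis
      using choose[of delete_main] Delete by simp
  next
    case Report
    show ?thesis
      unfolding Report algorithm_def code_of.simps data_structure.simps
      by (rule runs_mono[OF runs_report[OF c(1,3)]]) (use c in auto)
  qed
  then show "runs b (code_of algorithm p) (call_state p s) (\<lambda>t s'. ready (apply_operation G p) s' \<and>
      (p = Report \<longrightarrow> budget s' = budget s) \<and>
      (p \<noteq> Report \<longrightarrow> t \<le> 31 * ((M + 1) * (sc + 1)) + 29 * M + 18 * sc + 60 \<and>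
         t + 31 * budget s' \<le> 35 * M + 31 * sc + 60 + 31 * budget s))"
    by (simp only: c_def)
qed

text \<open>Without edges all vertices are at level 0, between the thresholds 0 and 2; this is where
  the initial content 2 of \<open>hi\<close> comes from.\<close>

lemma ready_initial:
  assumes "nmem s ''n'' 0 = n" "nmem s ''s'' 0 = sc" "\<And>v. v < n \<Longrightarrow> rmem s ''w'' v = w v" "rmem s ''eps'' 0 = \<epsilon>"
    and "nmem s ''orient'' = (\<lambda>_. 0)" "nmem s ''oc'' = (\<lambda>_. 0)" "nmem s ''ic'' = (\<lambda>_. 0)"
    and "nmem s ''lev'' = (\<lambda>_. 0)" "nmem s ''deg'' = (\<lambda>_. 0)" "nmem s ''rem'' = (\<lambda>_. 0)"
    and "nmem s ''cge'' = (\<lambda>_. 0)(0 := n)" "nmem s ''cnt'' 0 = n"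
    and "\<And>v. v < n \<Longrightarrow> nmem s ''ord'' v = v \<and> nmem s ''pos'' v = v \<and> rmem s ''lo'' v = 0 \<and> rmem s ''hi'' v = 2"
    and "rmem s ''wge'' = (\<lambda>_. 0)(0 := \<Sum>v<n. w v)"
  shows "ready {#} s" "budget s = 0"
proof -
  have ls: "level_set n (\<lambda>_. 0) j = (if j = 0 then {..<n} else {})" for j
    by (auto simp: level_set_def)
  have "ordered n (\<lambda>_. 0) (nmem s ''ord'') (nmem s ''pos'') ((\<lambda>_. 0)(0 := n))"
    using assms(13) by (auto simp: ordered_def)
  moreover have "((\<lambda>_. 0)(0 := \<Sum>v<n. w v)) j = level_weight n w (\<lambda>_. 0) j" for j
    by (simp add: level_weight_def ls)
  ultimately have st: "stat s"
    using assms by (simp add: stat_def levels_rep_def)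
  have lk: "linked n (active n (nmem s ''orient'')) s"
    by (simp add: linked_def assms bucket_rep_def active_def)
  have "core n w sc (\<lambda>_. 0) (nmem s ''K'') (\<lambda>_. 0) (\<lambda>_. 0) (\<lambda>_. 0)"
    using w by (auto simp: core_def edge_inv_def vertex_inv_def lows_def highs_def intro: order_less_le_trans[of 0 1])
  then have "rep s" using st lk by (simp add: rep_def assms)
  moreover have "oriented {#} s" by (simp add: oriented_def orientation_def assms)
  ultimately have "consistent {#} s" by (simp add: consistent_def assms ind_def)
  moreover have "chosen s"
    unfolding chosen_def Let_def assms(8,11,12)
    by (rule exI[of _ 0], rule exI[of _ 0], rule exI[of _ 0]) (use n in \<open>simp add: lessThan_empty_iff\<close>)
  ultimately show "ready {#} s" by (simp add: ready_def)
  show "budget s = 0" by (simp add: budget_def assms)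
qed

end

section \<open>Sequences of operations\<close>

lemma filter_index_Cons:
  "{i. i < length (p # ps) \<and> P ((p # ps) ! i)} =
    (if P p then {0} else {}) \<union> Suc ` {i. i < length ps \<and> P (ps ! i)}"
proof (intro set_eqI)
  fix i show "i \<in> {i. i < length (p # ps) \<and> P ((p # ps) ! i)} \<longleftrightarrow>
    i \<in> (if P p then {0} else {}) \<union> Suc ` {i. i < length ps \<and> P (ps ! i)}"
    by (cases i) (auto simp: image_iff)
qed

lemma sum_index_Cons:
  "(\<Sum>i | i < length (p # ps) \<and> P ((p # ps) ! i). f i) =
    (if P p then f 0 else 0) + (\<Sum>i | i < length ps \<and> P (ps ! i). f (Suc i))"
proof -
  have "(\<Sum>i\<in>(if P p then {0} else {}) \<union> Suc ` {i. i < length ps \<and> P (ps ! i)}. f i) =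
    (\<Sum>i\<in>(if P p then {0} else {}). f i) + (\<Sum>i\<in>Suc ` {i. i < length ps \<and> P (ps ! i)}. f i)"
    by (intro sum.union_disjoint) auto
  also have "(\<Sum>i\<in>Suc ` {i. i < length ps \<and> P (ps ! i)}. f i) = (\<Sum>i | i < length ps \<and> P (ps ! i). f (Suc i))"
    by (simp add: sum.reindex)
  finally show ?thesis unfolding filter_index_Cons by simp
qed

lemma executes_mono: "executes B D s ps ts s' \<Longrightarrow> B \<le> B' \<Longrightarrow> executes B' D s ps ts s'"
proof (induction ps arbitrary: s ts)
  case (Cons p ps)
  from Cons.prems(1) obtain t ts' s1 where 1: "ts = t # ts'" "exec B (code_of D p) (call_state p s) t s1"
    "executes B D s1 ps ts' s'" by auto
  show ?case using 1(1) exec_mono[OF 1(2) Cons.prems(2)] Cons.IH[OF 1(3) Cons.prems(2)] by auto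
qed simp

context machine
begin

text \<open>The potential differences telescope over the updates.\<close>

lemma executes_algorithm:
  assumes "ready G s" "graph_on n G"
    and "\<And>i. i < length ps \<Longrightarrow> operation_ok n (foldl apply_operation G (take i ps)) (ps ! i)"
    and "\<And>i. i \<le> length ps \<Longrightarrow> bounded (foldl apply_operation G (take i ps))"
  shows "\<exists>ts s'. executes (real b) algorithm s ps ts s' \<and> ready (foldl apply_operation G ps) s' \<and>
    graph_on n (foldl apply_operation G ps) \<and>
    (\<Sum>i | i < length ps \<and> ps ! i \<noteq> Report. ts ! i) + 31 * budget s' \<le>
      (35 * M + 31 * sc + 60) * card {i. i < length ps \<and> ps ! i \<noteq> Report} + 31 * budget s \<and>
    (\<forall>i<length ps. ps ! i \<noteq> Report \<longrightarrow> ts ! i \<le> 31 * ((M + 1) * (sc + 1)) + 29 * M + 18 * sc + 60)"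
  using assms
proof (induction ps arbitrary: G s)
  case Nil
  then show ?case by auto
next
  case (Cons p ps)
  let ?G = "apply_operation G p" and ?A = "35 * M + 31 * sc + 60"
  let ?W = "31 * ((M + 1) * (sc + 1)) + 29 * M + 18 * sc + 60"
  have ok: "operation_ok n G p" and bd: "bounded G" "bounded ?G"
    using Cons.prems(3)[of 0] Cons.prems(4)[of 0] Cons.prems(4)[of 1] by simp_all
  note op = runs_operation[OF Cons.prems(1,2) bd(1) ok bd(2)]
  obtain t s1 where ex: "exec (real b) (code_of algorithm p) (call_state p s) t s1" and rd: "ready ?G s1"
    and rep: "p = Report \<longrightarrow> budget s1 = budget s"
    and upd: "p \<noteq> Report \<longrightarrow> t \<le> ?W \<and> t + 31 * budget s1 \<le> ?A + 31 * budget s"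
    using op(2) unfolding runs_def by blast
  have "\<exists>ts s'. executes (real b) algorithm s1 ps ts s' \<and> ready (foldl apply_operation ?G ps) s' \<and>
    graph_on n (foldl apply_operation ?G ps) \<and>
    (\<Sum>i | i < length ps \<and> ps ! i \<noteq> Report. ts ! i) + 31 * budget s' \<le>
      ?A * card {i. i < length ps \<and> ps ! i \<noteq> Report} + 31 * budget s1 \<and>
    (\<forall>i<length ps. ps ! i \<noteq> Report \<longrightarrow> ts ! i \<le> ?W)"
  proof (rule Cons.IH[OF rd op(1)])
    show "operation_ok n (foldl apply_operation ?G (take i ps)) (ps ! i)" if "i < length ps" for i
      using Cons.prems(3)[of "Suc i"] that by simp
    show "bounded (foldl apply_operation ?G (take i ps))" if "i \<le> length ps" for i
      using Cons.prems(4)[of "Suc i"] that by simp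
  qed
  then obtain ts s' where ts: "executes (real b) algorithm s1 ps ts s'" "ready (foldl apply_operation ?G ps) s'"
    "graph_on n (foldl apply_operation ?G ps)"
    and am: "(\<Sum>i | i < length ps \<and> ps ! i \<noteq> Report. ts ! i) + 31 * budget s' \<le>
      ?A * card {i. i < length ps \<and> ps ! i \<noteq> Report} + 31 * budget s1"
    and wc: "\<forall>i<length ps. ps ! i \<noteq> Report \<longrightarrow> ts ! i \<le> ?W" by blast
  have "executes (real b) algorithm s (p # ps) (t # ts) s'"
    using ex ts(1) by auto
  moreover have "ready (foldl apply_operation G (p # ps)) s'" "graph_on n (foldl apply_operation G (p # ps))"
    using ts by simp_all
  moreover have "(\<Sum>i | i < length (p # ps) \<and> (p # ps) ! i \<noteq> Report. (t # ts) ! i) + 31 * budget s' \<le>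
      ?A * card {i. i < length (p # ps) \<and> (p # ps) ! i \<noteq> Report} + 31 * budget s"
  proof -
    have c: "card {i. i < length (p # ps) \<and> (p # ps) ! i \<noteq> Report} =
      (if p \<noteq> Report then 1 else 0) + card {i. i < length ps \<and> ps ! i \<noteq> Report}"
      using sum_index_Cons[where p = p and ps = ps and P = "\<lambda>x. x \<noteq> Report" and f = "\<lambda>_. 1 :: nat"] by simp
    have s: "(\<Sum>i | i < length (p # ps) \<and> (p # ps) ! i \<noteq> Report. (t # ts) ! i) =
      (if p \<noteq> Report then t else 0) + (\<Sum>i | i < length ps \<and> ps ! i \<noteq> Report. ts ! i)"
      using sum_index_Cons[where p = p and ps = ps and P = "\<lambda>x. x \<noteq> Report" and f = "\<lambda>i. (t # ts) ! i"] by simp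
    show ?thesis
      unfolding c s using am rep upd by (cases "p = Report") (simp_all add: distrib_left)
  qed
  moreover have "\<forall>i<length (p # ps). (p # ps) ! i \<noteq> Report \<longrightarrow> (t # ts) ! i \<le> ?W"
    using wc upd by (auto simp: nth_Cons split: nat.splits)
  ultimately show ?case by blast
qed

end

lemma runs_initialize:
  fixes w :: "nat \<Rightarrow> real" and \<epsilon> :: real
  assumes n: "1 \<le> n" and w: "\<And>v. v < n \<Longrightarrow> 1 \<le> w v" and eps: "0 < \<epsilon>" "\<epsilon> < 1"
    and L_def: "L = lg (real n * max_weight n w)"
    and b: "n \<le> b" "2000 * L / \<epsilon>\<^sup>2 + 3 \<le> real b"
  shows "runs b initialize (input_state n w \<epsilon>) (\<lambda>t s. \<exists>sc\<ge>2. 1000 * L / \<epsilon>\<^sup>2 \<le> real sc \<and>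
    real sc \<le> 2000 * L / \<epsilon>\<^sup>2 + 2 \<and> real t \<le> 8 * real n + 3 * L + 4000 * L / \<epsilon>\<^sup>2 + 30 \<and>
    nmem s ''s'' 0 = sc \<and> nmem s ''cge'' = (\<lambda>_. 0)(0 := n) \<and> nmem s ''cnt'' 0 = n \<and>
    (\<forall>v<n. nmem s ''ord'' v = v \<and> nmem s ''pos'' v = v \<and> rmem s ''hi'' v = 2) \<and>
    rmem s ''wge'' = (\<lambda>_. 0)(0 := \<Sum>v<n. w v) \<and>
    frame {''i'', ''ord'', ''pos'', ''cge'', ''cnt'', ''j'', ''s''} {''hi'', ''wge'', ''W'', ''p''} (input_state n w \<epsilon>) s)"
proof -
  define s0 where "s0 = input_state n w \<epsilon>"
  define X where "X = real n * max_weight n w"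
  have s0: "nmem s0 ''n'' 0 = n" "rmem s0 ''eps'' 0 = \<epsilon>" "nmem s0 ''i'' 0 = 0" "nmem s0 ''j'' 0 = 0"
    "nmem s0 ''cge'' = (\<lambda>_. 0)" "rmem s0 ''wge'' = (\<lambda>_. 0)" "rmem s0 ''W'' 0 = 0"
    "\<And>v. v < n \<Longrightarrow> rmem s0 ''w'' v = w v"
    by (auto simp: s0_def input_state_def)
  have L1: "1 \<le> L" by (simp add: L_def lg_def)
  have e2: "0 < \<epsilon>\<^sup>2" "\<epsilon>\<^sup>2 \<le> 1" using eps by (simp_all add: power_le_one)
  have Le: "L \<le> L / \<epsilon>\<^sup>2" using e2 L1 by (simp add: pos_le_divide_eq mult_left_le)

  \<comment> \<open>0 is the initial content of register \<open>W\<close>. Weights are at least 1,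
    so it no longer matters once a vertex has been read.\<close>
  define mx where "mx = (\<lambda>k. Max (insert 0 (w ` {..<k})))"
  have mx: "mx (Suc k) = max (mx k) (w k)" for k
  proof -
    have "insert 0 (w ` {..<Suc k}) = insert (w k) (insert 0 (w ` {..<k}))" by (auto simp: less_Suc_eq)
    then show ?thesis by (simp add: mx_def max.commute)
  qed
  have mxn: "mx n = max_weight n w"
  proof -
    have "0 \<le> max_weight n w"
      using w[of 0] n unfolding max_weight_def by (intro order_trans[OF _ Max_ge[of _ "w 0"]]) auto
    then show ?thesis using n by (simp add: mx_def max_weight_def lessThan_empty_iff)
  qed
  let ?FA = "frame {''i'', ''ord'', ''pos''} {''hi'', ''wge'', ''W''}"
  define PA where "PA = (\<lambda>k s. nmem s ''i'' 0 = k \<and>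
    (\<forall>v<k. nmem s ''ord'' v = v \<and> nmem s ''pos'' v = v \<and> rmem s ''hi'' v = 2) \<and>
    rmem s ''wge'' = (\<lambda>_. 0)(0 := \<Sum>v<k. w v) \<and> rmem s ''W'' 0 = mx k \<and> ?FA s0 s)"
  define bodyA where "bodyA = (block
        [NPut ''ord'' (V ''i'') (V ''i''),
         NPut ''pos'' (V ''i'') (V ''i''),
         RPut ''hi'' (V ''i'') (ROfNat (NLit 2)),
         RPut ''wge'' (NLit 0) (RAdd (RGet ''wge'' (NLit 0)) (RGet ''w'' (V ''i''))),
         IfThen (RLess (RGet ''W'' (NLit 0)) (RGet ''w'' (V ''i''))) (RPut ''W'' (NLit 0) (RGet ''w'' (V ''i''))) Skip,
         assign ''i'' (NAdd (V ''i'') (NLit 1))])"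
  have A: "runs b (WhileDo (NLess (V ''i'') (V ''n'')) bodyA) s0 (\<lambda>t'. (\<lambda>t s. t = 8 * n + 1 \<and> PA n s) (0 + t'))"
  proof (rule runs_While[where I = "\<lambda>t s. \<exists>k\<le>n. t = 8 * k \<and> PA k s" and f = "\<lambda>s. n - nmem s ''i'' 0"])
    show "\<exists>k\<le>n. 0 = 8 * k \<and> PA k s0"
      by (rule exI[of _ 0]) (simp add: PA_def s0 mx_def frame_refl fun_eq_iff)
  next
    fix t s assume I: "\<exists>k\<le>n. t = 8 * k \<and> PA k s" and g: "bval (NLess (V ''i'') (V ''n'')) s"
    then obtain k where k: "t = 8 * k" "PA k s" by blast
    have fr: "?FA s0 s" and ik: "nmem s ''i'' 0 = k" and wg: "rmem s ''wge'' = (\<lambda>_. 0)(0 := \<Sum>v<k. w v)"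
      and W: "rmem s ''W'' 0 = mx k" and arr: "\<And>v. v < k \<Longrightarrow> nmem s ''ord'' v = v \<and> nmem s ''pos'' v = v \<and> rmem s ''hi'' v = 2"
      using k(2) by (simp_all add: PA_def)
    have eqs: "nmem s ''n'' 0 = n" "rmem s ''w'' = rmem s0 ''w''" using fr s0 by (simp_all add: frame_def)
    have kn: "k < n" using g ik eqs by simp
    define s2 where "s2 = rput ''wge'' 0 ((\<Sum>v<k. w v) + w k) (rput ''hi'' k 2 (nput ''pos'' k k (nput ''ord'' k k s)))"
    define s3 where "s3 = (if mx k < w k then rput ''W'' 0 (w k) s2 else s2)"
    define s4 where "s4 = nput ''i'' 0 (Suc k) s3"
    have "PA (Suc k) s4"
      unfolding PA_def
    proof (intro conjI allI impI)
      show "?FA s0 s4" using fr by (simp add: s4_def s3_def s2_def frame_nput frame_rput)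
      show "rmem s4 ''W'' 0 = mx (Suc k)" by (simp add: s4_def s3_def s2_def mx W)
      show "rmem s4 ''wge'' = (\<lambda>_. 0)(0 := \<Sum>v<Suc k. w v)" by (simp add: s4_def s3_def s2_def wg fun_eq_iff)
      show "nmem s4 ''ord'' v = v" "nmem s4 ''pos'' v = v" "rmem s4 ''hi'' v = 2" if "v < Suc k" for v
        using arr[of v] that by (auto simp: s4_def s3_def s2_def less_Suc_eq)
    qed (simp add: s4_def)
    then have step: "(\<exists>k'\<le>n. 1 + t + 7 = 8 * k' \<and> PA k' s4) \<and> n - nmem s4 ''i'' 0 < n - nmem s ''i'' 0"
      using kn k(1) ik by (auto simp: s4_def intro!: exI[of _ "Suc k"])
    have "rmem s ''w'' k = w k" using eqs s0 kn by simp
    then have "runs b bodyA s (\<lambda>t' s'. t' = 7 \<and> s' = s4)"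
      using kn b(1) W wg
      by (cases "mx k < w k") (simp_all add: bodyA_def runs_simps ik s4_def s3_def s2_def)
    then show "runs b bodyA s (\<lambda>t' s'. (\<exists>k\<le>n. 1 + t + t' = 8 * k \<and> PA k s') \<and> n - nmem s' ''i'' 0 < n - nmem s ''i'' 0)"
      by (rule runs_mono) (use step in blast)
  next
    fix t s assume I: "\<exists>k\<le>n. t = 8 * k \<and> PA k s" and g: "\<not> bval (NLess (V ''i'') (V ''n'')) s"
    then obtain k where k: "k \<le> n" "t = 8 * k" "PA k s" by blast
    then have "nmem s ''n'' 0 = n" "nmem s ''i'' 0 = k" using s0 by (simp_all add: PA_def frame_def)
    then show "t + 1 = 8 * n + 1 \<and> PA n s" using g k by simp
  qed
  define F where "F = (\<lambda>s. nmem s ''cge'' = (\<lambda>_. 0)(0 := n) \<and> nmem s ''cnt'' 0 = n \<and>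
    (\<forall>v<n. nmem s ''ord'' v = v \<and> nmem s ''pos'' v = v \<and> rmem s ''hi'' v = 2) \<and>
    rmem s ''wge'' = (\<lambda>_. 0)(0 := \<Sum>v<n. w v) \<and> rmem s ''W'' 0 = max_weight n w \<and>
    frame {''i'', ''ord'', ''pos'', ''cge'', ''cnt'', ''j'', ''s''} {''hi'', ''wge'', ''W'', ''p''} s0 s)"
  have F_stable: "F s'" if F: "F s" and fr: "frame {''j'', ''s''} {''p''} s s'" for s s'
  proof -
    have "frame {''i'', ''ord'', ''pos'', ''cge'', ''cnt'', ''j'', ''s''} {''hi'', ''wge'', ''W'', ''p''} s0 s'"
      by (rule frame_trans[OF _ fr]) (use F in \<open>auto simp: F_def\<close>)
    moreover have "nmem s' x = nmem s x" if "x \<in> {''cge'', ''cnt'', ''ord'', ''pos''}" for x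
      using that by (intro frame_nmem[OF fr]) auto
    moreover have "rmem s' x = rmem s x" if "x \<in> {''wge'', ''W'', ''hi''}" for x
      using that by (intro frame_rmem[OF fr]) auto
    ultimately show ?thesis using F by (simp add: F_def)
  qed
  have F_reg: "nmem s ''n'' 0 = n" "rmem s ''eps'' 0 = \<epsilon>" "rmem s ''W'' 0 = max_weight n w" if "F s" for s
    using that s0 by (auto simp: F_def frame_def)
  have X: "0 < X"
  proof -
    have "1 \<le> max_weight n w"
      using w[of 0] n unfolding max_weight_def by (intro order_trans[OF _ Max_ge[of _ "w 0"]]) auto
    then show ?thesis using n by (simp add: X_def)
  qed
  define B where "B = WhileDo (RLess (RGet ''p'' (NLit 0)) (RMul (ROfNat (V ''n'')) (RGet ''W'' (NLit 0))))
      (Sequ (RPut ''p'' (NLit 0) (RMul (ROfNat (NLit 2)) (RGet ''p'' (NLit 0)))) (assign ''j'' (NAdd (V ''j'') (NLit 1))))"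
  have Lb: "L + 1 \<le> real b" using Le b(2) e2 L1 by simp
  have 3: "runs b B s (\<lambda>t'. (\<lambda>t s. F s \<and> (\<exists>J. nmem s ''j'' 0 = J \<and> X \<le> 2 ^ J \<and> real J \<le> L + 1 \<and> t = 3 * J + 1)) (0 + t'))"
    if "F s" "nmem s ''j'' 0 = 0" "rmem s ''p'' 0 = 1" for s
    unfolding B_def
  proof (rule runs_While[where I = "\<lambda>t s. F s \<and> (\<exists>J. nmem s ''j'' 0 = J \<and> rmem s ''p'' 0 = 2 ^ J \<and> real J \<le> L + 1 \<and> t = 3 * J)"
        and f = "\<lambda>s. nat \<lfloor>L + 1\<rfloor> - nmem s ''j'' 0"])
    show "F s \<and> (\<exists>J. nmem s ''j'' 0 = J \<and> rmem s ''p'' 0 = 2 ^ J \<and> real J \<le> L + 1 \<and> 0 = 3 * J)"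
      using that L1 by simp
  next
    fix t s assume I: "F s \<and> (\<exists>J. nmem s ''j'' 0 = J \<and> rmem s ''p'' 0 = 2 ^ J \<and> real J \<le> L + 1 \<and> t = 3 * J)"
      and g: "bval (RLess (RGet ''p'' (NLit 0)) (RMul (ROfNat (V ''n'')) (RGet ''W'' (NLit 0)))) s"
    then obtain J where F: "F s" and J: "nmem s ''j'' 0 = J" "rmem s ''p'' 0 = 2 ^ J" "t = 3 * J" by blast
    \<comment> \<open>The loop ends at the first power of 2 that reaches nW: until then J is below
      log (nW), so the final exponent is at most L + 1.\<close>
    have "2 ^ J < X" using g J F_reg[OF F] by (simp add: X_def)
    then have "2 powr real J < X" by (simp add: powr_realpow)
    then have "real J < log 2 X" using X by (simp add: less_log_iff)
    then have JL: "real (Suc J) \<le> L + 1" by (simp add: L_def X_def[symmetric] lg_def)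
    then have JN: "Suc J \<le> nat \<lfloor>L + 1\<rfloor>" by (rule le_nat_floor)
    define s' where "s' = nput ''j'' 0 (Suc J) (rput ''p'' 0 (2 * 2 ^ J) s)"
    have "F s'" by (rule F_stable[OF F]) (simp add: s'_def frame_nput frame_rput frame_refl)
    then have "(F s' \<and> (\<exists>J. nmem s' ''j'' 0 = J \<and> rmem s' ''p'' 0 = 2 ^ J \<and> real J \<le> L + 1 \<and> 1 + t + 2 = 3 * J)) \<and>
      nat \<lfloor>L + 1\<rfloor> - nmem s' ''j'' 0 < nat \<lfloor>L + 1\<rfloor> - nmem s ''j'' 0"
      using JL JN J by (simp add: s'_def)
    moreover have "Suc J \<le> b" using JL Lb by linarith
    ultimately show "runs b (Sequ (RPut ''p'' (NLit 0) (RMul (ROfNat (NLit 2)) (RGet ''p'' (NLit 0)))) (assign ''j'' (NAdd (V ''j'') (NLit 1)))) s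
      (\<lambda>t' s'. (F s' \<and> (\<exists>J. nmem s' ''j'' 0 = J \<and> rmem s' ''p'' 0 = 2 ^ J \<and> real J \<le> L + 1 \<and> 1 + t + t' = 3 * J)) \<and>
        nat \<lfloor>L + 1\<rfloor> - nmem s' ''j'' 0 < nat \<lfloor>L + 1\<rfloor> - nmem s ''j'' 0)"
      by (simp add: runs_Sequ runs_RPut runs_NPut J(1,2) s'_def)
  next
    fix t s assume I: "F s \<and> (\<exists>J. nmem s ''j'' 0 = J \<and> rmem s ''p'' 0 = 2 ^ J \<and> real J \<le> L + 1 \<and> t = 3 * J)"
      and g: "\<not> bval (RLess (RGet ''p'' (NLit 0)) (RMul (ROfNat (V ''n'')) (RGet ''W'' (NLit 0)))) s"
    then show "F s \<and> (\<exists>J. nmem s ''j'' 0 = J \<and> X \<le> 2 ^ J \<and> real J \<le> L + 1 \<and> t + 1 = 3 * J + 1)"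
      using F_reg[of s] by (auto simp: X_def)
  qed
  note 3 = 3[unfolded add_0]
  define Ccom where "Ccom = WhileDo (RLess (RMul (RMul (ROfNat (V ''s'')) (RGet ''eps'' (NLit 0))) (RGet ''eps'' (NLit 0)))
        (RMul (ROfNat (NLit 1000)) (ROfNat (V ''j''))))
      (assign ''s'' (NAdd (V ''s'') (NLit 1)))"
  have 4: "runs b Ccom s (\<lambda>t'. (\<lambda>t s. F s \<and> (\<exists>S. nmem s ''s'' 0 = S \<and> 2 \<le> S \<and> 1000 * L / \<epsilon>\<^sup>2 \<le> real S \<and>
      real S \<le> 2000 * L / \<epsilon>\<^sup>2 + 2 \<and> t = 2 * (S - 2) + 1)) (0 + t'))"
    if "F s" "nmem s ''j'' 0 = J" "nmem s ''s'' 0 = 2" "L \<le> real J" "real J \<le> L + 1" for s J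
    unfolding Ccom_def
  proof (rule runs_While[where I = "\<lambda>t s. F s \<and> nmem s ''j'' 0 = J \<and> (\<exists>S. nmem s ''s'' 0 = S \<and> 2 \<le> S \<and>
        real S \<le> 2000 * L / \<epsilon>\<^sup>2 + 2 \<and> t = 2 * (S - 2))" and f = "\<lambda>s. nat \<lfloor>2000 * L / \<epsilon>\<^sup>2 + 2\<rfloor> - nmem s ''s'' 0"])
    show "F s \<and> nmem s ''j'' 0 = J \<and> (\<exists>S. nmem s ''s'' 0 = S \<and> 2 \<le> S \<and> real S \<le> 2000 * L / \<epsilon>\<^sup>2 + 2 \<and> 0 = 2 * (S - 2))"
      using that L1 e2 by simp
  next
    fix t s assume I: "F s \<and> nmem s ''j'' 0 = J \<and> (\<exists>S. nmem s ''s'' 0 = S \<and> 2 \<le> S \<and>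
        real S \<le> 2000 * L / \<epsilon>\<^sup>2 + 2 \<and> t = 2 * (S - 2))"
      and g: "bval (RLess (RMul (RMul (ROfNat (V ''s'')) (RGet ''eps'' (NLit 0))) (RGet ''eps'' (NLit 0)))
        (RMul (ROfNat (NLit 1000)) (ROfNat (V ''j'')))) s"
    then obtain S where F: "F s" and S: "nmem s ''s'' 0 = S" "2 \<le> S" "t = 2 * (S - 2)" "nmem s ''j'' 0 = J" by blast
    have "real S * \<epsilon>\<^sup>2 < 1000 * real J" using g S F_reg[OF F] by (simp add: power2_eq_square mult.assoc)
    \<comment> \<open>J is at most L + 1, hence at most 2 L. Thus the rounding of the logarithm
      costs a factor of 2 in \<open>s\<close>.\<close>
    also have "\<dots> \<le> 2000 * L" using that(5) L1 by simp
    finally have "real S < 2000 * L / \<epsilon>\<^sup>2" using e2 by (simp add: pos_less_divide_eq)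
    then have SL: "real (Suc S) \<le> 2000 * L / \<epsilon>\<^sup>2 + 2" by simp
    then have SN: "Suc S \<le> nat \<lfloor>2000 * L / \<epsilon>\<^sup>2 + 2\<rfloor>" by (rule le_nat_floor)
    define s' where "s' = nput ''s'' 0 (Suc S) s"
    have "F s'" by (rule F_stable[OF F]) (simp add: s'_def frame_nput frame_refl)
    moreover have "1 + t + 1 = 2 * (Suc S - 2)" using S(2,3) by linarith
    moreover have s': "nmem s' ''s'' 0 = Suc S" "nmem s' ''j'' 0 = J" using S(4) by (simp_all add: s'_def)
    ultimately have "F s' \<and> nmem s' ''j'' 0 = J \<and> (\<exists>S. nmem s' ''s'' 0 = S \<and> 2 \<le> S \<and>
        real S \<le> 2000 * L / \<epsilon>\<^sup>2 + 2 \<and> 1 + t + 1 = 2 * (S - 2))"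
      using SL S(2) by simp
    moreover have "nat \<lfloor>2000 * L / \<epsilon>\<^sup>2 + 2\<rfloor> - nmem s' ''s'' 0 < nat \<lfloor>2000 * L / \<epsilon>\<^sup>2 + 2\<rfloor> - nmem s ''s'' 0"
      unfolding s' S(1) using SN by linarith
    moreover have "Suc S \<le> b" using SL b(2) by linarith
    ultimately show "runs b (assign ''s'' (NAdd (V ''s'') (NLit 1))) s (\<lambda>t' s'. (F s' \<and> nmem s' ''j'' 0 = J \<and>
       (\<exists>S. nmem s' ''s'' 0 = S \<and> 2 \<le> S \<and> real S \<le> 2000 * L / \<epsilon>\<^sup>2 + 2 \<and> 1 + t + t' = 2 * (S - 2))) \<and>
      nat \<lfloor>2000 * L / \<epsilon>\<^sup>2 + 2\<rfloor> - nmem s' ''s'' 0 < nat \<lfloor>2000 * L / \<epsilon>\<^sup>2 + 2\<rfloor> - nmem s ''s'' 0)"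
      unfolding runs_NPut nval.simps S(1) add_Suc_right add_0_right One_nat_def
      unfolding One_nat_def[symmetric] s'_def[symmetric] by simp
  next
    fix t s assume I: "F s \<and> nmem s ''j'' 0 = J \<and> (\<exists>S. nmem s ''s'' 0 = S \<and> 2 \<le> S \<and>
        real S \<le> 2000 * L / \<epsilon>\<^sup>2 + 2 \<and> t = 2 * (S - 2))"
      and g: "\<not> bval (RLess (RMul (RMul (ROfNat (V ''s'')) (RGet ''eps'' (NLit 0))) (RGet ''eps'' (NLit 0)))
        (RMul (ROfNat (NLit 1000)) (ROfNat (V ''j'')))) s"
    then have F: "F s" by blast
    have "1000 * L \<le> 1000 * real J" using that(4) by simp
    also have "\<dots> \<le> real (nmem s ''s'' 0) * \<epsilon>\<^sup>2"
      using g I F_reg[OF F] by (simp add: power2_eq_square mult.assoc)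
    finally have "1000 * L / \<epsilon>\<^sup>2 \<le> real (nmem s ''s'' 0)" using e2 by (simp add: pos_divide_le_eq)
    then show "F s \<and> (\<exists>S. nmem s ''s'' 0 = S \<and> 2 \<le> S \<and> 1000 * L / \<epsilon>\<^sup>2 \<le> real S \<and>
      real S \<le> 2000 * L / \<epsilon>\<^sup>2 + 2 \<and> t + 1 = 2 * (S - 2) + 1)"
      using I by auto
  qed
  note 4 = 4[unfolded add_0]
  have 2: "runs b (Sequ (NPut ''cge'' (NLit 0) (V ''n''))
       (Sequ (assign ''cnt'' (V ''n'')) (RPut ''p'' (NLit 0) (ROfNat (NLit 1))))) s
     (\<lambda>t s. t = 3 \<and> F s \<and> nmem s ''j'' 0 = 0 \<and> rmem s ''p'' 0 = 1)"
    if PA: "PA n s" for s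
  proof -
    have fr: "?FA s0 s" using PA by (simp add: PA_def)
    have eqs: "nmem s ''n'' 0 = n" "nmem s ''j'' 0 = 0" "nmem s ''cge'' = (\<lambda>_. 0)"
      using fr s0 by (simp_all add: frame_def)
    define s3 where "s3 = rput ''p'' 0 1 (nput ''cnt'' 0 n (nput ''cge'' 0 n s))"
    have "frame {''i'', ''ord'', ''pos'', ''cge'', ''cnt'', ''j'', ''s''} {''hi'', ''wge'', ''W'', ''p''} s0 s3"
      using fr by (auto simp: frame_def s3_def)
    then have "F s3" using PA by (simp add: F_def PA_def s3_def eqs mxn)
    then have "F s3 \<and> nmem s3 ''j'' 0 = 0 \<and> rmem s3 ''p'' 0 = 1" by (simp add: s3_def eqs)
    then show ?thesis using b(1) by (simp add: runs_Sequ runs_NPut runs_RPut eqs s3_def)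
  qed
  have fin: "runs b (Sequ (IfThen (NLess (V ''j'') (NLit 1)) (assign ''j'' (NLit 1)) Skip)
      (Sequ (assign ''s'' (NLit 2)) Ccom)) s
    (\<lambda>t s. F s \<and> (\<exists>S. nmem s ''s'' 0 = S \<and> 2 \<le> S \<and> 1000 * L / \<epsilon>\<^sup>2 \<le> real S \<and>
      real S \<le> 2000 * L / \<epsilon>\<^sup>2 + 2 \<and> t = 2 * (S - 2) + 4))"
    if F: "F s" and J: "nmem s ''j'' 0 = J" "X \<le> 2 ^ J" "real J \<le> L + 1" for s J
  proof -
    \<comment> \<open>The maximum with 1 matches the convention in \<open>lg\<close>, so that
      \<open>L\<close> is at most \<open>J'\<close>.\<close>
    define J' where "J' = max 1 J"
    define s1 where "s1 = nput ''s'' 0 2 (if J < 1 then nput ''j'' 0 1 s else s)"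
    have "log 2 X \<le> real J"
      using J(2) X by (simp add: log_le_iff powr_realpow)
    then have J': "L \<le> real J'" "real J' \<le> L + 1" using J(3) L1 by (auto simp: J'_def L_def X_def[symmetric] lg_def)
    have "F s1" by (rule F_stable[OF F]) (simp add: s1_def frame_nput frame_refl)
    moreover have "nmem s1 ''j'' 0 = J'" "nmem s1 ''s'' 0 = 2" using J(1) by (auto simp: s1_def J'_def)
    ultimately have C: "runs b Ccom s1 (\<lambda>t s. F s \<and> (\<exists>S. nmem s ''s'' 0 = S \<and> 2 \<le> S \<and> 1000 * L / \<epsilon>\<^sup>2 \<le> real S \<and>
      real S \<le> 2000 * L / \<epsilon>\<^sup>2 + 2 \<and> t = 2 * (S - 2) + 1))"
      using 4 J' by blast
    have b2: "2 \<le> b" using b(2) L1 e2 Lb by linarith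
    have i1: "runs b (IfThen (NLess (V ''j'') (NLit 1)) (assign ''j'' (NLit 1)) Skip) s
      (\<lambda>t s'. t = 2 \<and> s' = (if J < 1 then nput ''j'' 0 1 s else s))"
      using b2 by (simp add: runs_IfThen runs_NPut runs_Skip J(1))
    have i2: "runs b (assign ''s'' (NLit 2)) (if J < 1 then nput ''j'' 0 1 s else s) (\<lambda>t s'. t = 1 \<and> s' = s1)"
      using b2 by (simp add: runs_NPut s1_def)
    show ?thesis
      by (rule runs_SequI[OF i1], elim conjE, hypsubst, rule runs_SequI[OF i2], elim conjE, hypsubst,
          rule runs_mono[OF C]) auto
  qed
  have main: "runs b (Sequ B (Sequ (IfThen (NLess (V ''j'') (NLit 1)) (assign ''j'' (NLit 1)) Skip)
      (Sequ (assign ''s'' (NLit 2)) Ccom))) s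
    (\<lambda>t s. F s \<and> (\<exists>S. nmem s ''s'' 0 = S \<and> 2 \<le> S \<and> 1000 * L / \<epsilon>\<^sup>2 \<le> real S \<and>
      real S \<le> 2000 * L / \<epsilon>\<^sup>2 + 2 \<and> real t \<le> 3 * L + 4000 * L / \<epsilon>\<^sup>2 + 20))"
    if "F s" "nmem s ''j'' 0 = 0" "rmem s ''p'' 0 = 1" for s
  proof (rule runs_SequI[OF 3[OF that]], elim conjE exE)
    fix t s1 J
    assume A: "F s1" "nmem s1 ''j'' 0 = J" "X \<le> 2 ^ J" "real J \<le> L + 1" and t: "t = 3 * J + 1"
    show "runs b (Sequ (IfThen (NLess (V ''j'') (NLit 1)) (assign ''j'' (NLit 1)) Skip)
      (Sequ (assign ''s'' (NLit 2)) Ccom)) s1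
      (\<lambda>t2 s. F s \<and> (\<exists>S. nmem s ''s'' 0 = S \<and> 2 \<le> S \<and> 1000 * L / \<epsilon>\<^sup>2 \<le> real S \<and>
        real S \<le> 2000 * L / \<epsilon>\<^sup>2 + 2 \<and> real (t + t2) \<le> 3 * L + 4000 * L / \<epsilon>\<^sup>2 + 20))"
      by (rule runs_mono[OF fin[OF A]]) (use A(4) t in \<open>auto simp: of_nat_diff\<close>)
  qed
  show ?thesis
    unfolding initialize_def bodyA_def[symmetric]
    unfolding block.simps s0_def[symmetric] B_def[symmetric] Ccom_def[symmetric]
  proof (rule runs_SequI[OF A[unfolded add_0]], elim conjE, rule runs_SequI[OF 2], assumption, elim conjE,
      rule runs_mono[OF main], assumption+, elim conjE exE)
    fix t1 s1 t2 s2 t3 s3 S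
    assume "t1 = 8 * n + 1" "t2 = (3 :: nat)" "F s3" "nmem s3 ''s'' 0 = S" "2 \<le> S"
      "1000 * L / \<epsilon>\<^sup>2 \<le> real S" "real S \<le> 2000 * L / \<epsilon>\<^sup>2 + 2" "real t3 \<le> 3 * L + 4000 * L / \<epsilon>\<^sup>2 + 20"
    then show "\<exists>sc\<ge>2. 1000 * L / \<epsilon>\<^sup>2 \<le> real sc \<and>
      real sc \<le> 2000 * L / \<epsilon>\<^sup>2 + 2 \<and> real (t1 + (t2 + t3)) \<le> 8 * real n + 3 * L + 4000 * L / \<epsilon>\<^sup>2 + 30 \<and>
      nmem s3 ''s'' 0 = sc \<and> nmem s3 ''cge'' = (\<lambda>_. 0)(0 := n) \<and> nmem s3 ''cnt'' 0 = n \<and>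
      (\<forall>v<n. nmem s3 ''ord'' v = v \<and> nmem s3 ''pos'' v = v \<and> rmem s3 ''hi'' v = 2) \<and>
      rmem s3 ''wge'' = (\<lambda>_. 0)(0 := \<Sum>v<n. w v) \<and>
      frame {''i'', ''ord'', ''pos'', ''cge'', ''cnt'', ''j'', ''s''} {''hi'', ''wge'', ''W'', ''p''} s0 s3"
      by (intro exI[of _ S]) (simp add: F_def)
  qed
qed


subsection \<open>Choice of the parameters\<close>

text \<open>A constant c is absorbed into the exponent by c <= 2^c <= Z^c.\<close>

lemma const_power_le:
  fixes Z :: real
  assumes "2 \<le> Z" "c + p \<le> C"
  shows "real c * Z ^ p \<le> Z ^ C"
proof -
  have "real c \<le> 2 ^ c" by (rule less_imp_le) (rule of_nat_less_two_power)
  also have "\<dots> \<le> Z ^ c" using assms by (intro power_mono) auto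
  finally have "real c * Z ^ p \<le> Z ^ c * Z ^ p" using assms by (intro mult_right_mono) auto
  also have "\<dots> = Z ^ (c + p)" by (simp add: power_add)
  also have "\<dots> \<le> Z ^ C" using assms by (intro power_increasing) auto
  finally show ?thesis .
qed

text \<open>Thresholds grow geometrically with ratio 1 + 2 / s, so loads up to \<Lambda> occupy O(s
  log \<Lambda>) levels. With \<Lambda> = (nW)^k this is the origin of the number
  \<open>M\<close>.\<close>

lemma tau_le_imp_level_le:
  assumes s: "4 \<le> s" and \<Lambda>: "1 \<le> \<Lambda>" "ln \<Lambda> \<le> y" and i: "tau s i \<le> \<Lambda> + 1"
  shows "real i \<le> real s * (1 + y)"
proof -
  define q where "q = (1 + 2 / real s) ^ i"
  have "tau s i = real s * (q - 1)"
    using tau_add[of s 0 i] s by (simp add: q_def)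
  then have "real s * (q - 1) \<le> \<Lambda> + 1" using i by simp
  then have "q - 1 \<le> (\<Lambda> + 1) / real s" using s by (simp add: pos_le_divide_eq mult.commute)
  also have "\<dots> \<le> (\<Lambda> + 1) / 2" using s \<Lambda> by (intro divide_left_mono) auto
  also have "\<dots> \<le> \<Lambda>" using \<Lambda> by simp
  finally have "q \<le> 2 * \<Lambda>" using \<Lambda> by simp
  then have "real i * (2 / real s) / 2 \<le> ln (2 * \<Lambda>)"
    unfolding q_def using s by (intro of_nat_le_ln_ratio) auto
  also have "\<dots> = ln 2 + ln \<Lambda>" using \<Lambda> by (simp add: ln_mult)
  also have "\<dots> \<le> 1 + y" using ln_2_less_1 \<Lambda> by linarith
  finally show ?thesis using s by (simp add: field_simps)
qed

lemma loads_bounded_ind: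
  assumes lb: "loads_bounded n w k G" and w: "\<And>v. v < n \<Longrightarrow> 1 \<le> w v"
    and o: "orientation n G (orient_of n R)" and v: "v < n"
  shows "real (ind n R v) \<le> (real n * max_weight n w) ^ k * w v"
proof -
  have "load n w (orient_of n R) v \<le> max_load n w (orient_of n R)"
    unfolding max_load_def using v by (intro Max_ge) auto
  also have "\<dots> \<le> (real n * max_weight n w) ^ k"
    using lb o unfolding loads_bounded_def by blast
  finally show ?thesis
    using w[OF v] by (simp add: load_def ind_eq_in_degree[OF v] pos_divide_le_eq order_less_le_trans[of 0 1])
qed

text \<open>With Z = 2 n W / \<epsilon>, each of n, W, L and 1 / \<epsilon> is at most Z. All words
  and addresses are then at most a constant times a power of Z, and \<open>const_power_le\<close>
  moves the constants into the exponent, which is why \<open>C\<close> grows linearly with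
  them.\<close>

lemma machine_exists:
  fixes w :: "nat \<Rightarrow> real" and \<epsilon> :: real and k :: nat
  assumes n: "1 \<le> n" and w: "\<And>v. v < n \<Longrightarrow> 1 \<le> w v" and eps: "0 < \<epsilon>" "\<epsilon> < 1"
    and W_def: "W = max_weight n w" and L_def: "L = lg (real n * W)"
    and C: "2008 * (k + 1) + k + 6 \<le> C"
  obtains sc M b t0 s0 where "machine n w \<epsilon> sc M b ((real n * W) ^ k)"
    "real b \<le> (2 * real n * W / \<epsilon>) ^ C"
    "exec (real b) initialize (input_state n w \<epsilon>) t0 s0"
    "real t0 \<le> 8 * real n + 3 * L + 4000 * L / \<epsilon>\<^sup>2 + 30"
    "machine.ready n w \<epsilon> sc {#} s0" "machine.budget n s0 = 0"
    "1000 * L / \<epsilon>\<^sup>2 \<le> real sc" "real sc \<le> 2002 * (L / \<epsilon>\<^sup>2)"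
    "real M \<le> 2002 * (real k + 1) * L * (L / \<epsilon>\<^sup>2)"
proof -
  have W1: "1 \<le> W"
    using w[of 0] n unfolding W_def max_weight_def by (intro order_trans[OF _ Max_ge[of _ "w 0"]]) auto
  have wW: "w v \<le> W" if "v < n" for v
    unfolding W_def max_weight_def using that by (intro Max_ge) auto
  define X where "X = real n * W"
  have "1 * 1 \<le> X" unfolding X_def using n W1 by (intro mult_mono) auto
  then have X1: "1 \<le> X" by simp
  have nX: "real n \<le> X" "W \<le> X"
    unfolding X_def using n W1 mult_left_mono[of 1 W "real n"] mult_right_mono[of 1 "real n" W] by simp_all
  have L1: "1 \<le> L" by (simp add: L_def lg_def)
  \<comment> \<open>An elementary bound log X <= X, from m + 1 <= 2^m for the integer part m of
    X.\<close>
  have LX: "L \<le> 2 * X"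
  proof -
    define m where "m = nat \<lfloor>X\<rfloor>"
    have "X \<le> real m + 1" using X1 floor_correct[of X] by (simp add: m_def)
    also have "real m + 1 \<le> 2 ^ m"
      using less_exp[of m] by (metis Suc_leI of_nat_Suc of_nat_le_iff of_nat_numeral of_nat_power add.commute)
    also have "(2 :: real) ^ m = 2 powr real m" by (simp add: powr_realpow)
    also have "\<dots> \<le> 2 powr X" using X1 by (intro powr_mono) (simp_all add: m_def)
    finally have "log 2 X \<le> X" using X1 by (simp add: log_le_iff)
    then show ?thesis using X1 by (simp add: L_def lg_def X_def[symmetric])
  qed
  define Z where "Z = 2 * X / \<epsilon>"
  have "2 * X * 1 \<le> 2 * X * (1 / \<epsilon>)" using eps X1 by (intro mult_left_mono) auto
  then have XZ: "2 * X \<le> Z" by (simp add: Z_def)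
  have Z2: "2 \<le> Z" using XZ X1 by linarith
  have "1 * (1 / \<epsilon>) \<le> 2 * X * (1 / \<epsilon>)" using eps X1 by (intro mult_right_mono) auto
  then have eZ: "1 / \<epsilon> \<le> Z" by (simp add: Z_def)
  define q where "q = L / \<epsilon>\<^sup>2"
  have e2: "0 < \<epsilon>\<^sup>2" "\<epsilon>\<^sup>2 \<le> 1" using eps by (simp_all add: power_le_one)
  have q1: "1 \<le> q" "L \<le> q" using e2 L1 by (simp_all add: q_def pos_le_divide_eq mult_left_le)
  have LZ: "L \<le> Z" using LX XZ by linarith
  have qZ: "q \<le> Z ^ 3"
  proof -
    have "q = L * (1 / \<epsilon>) * (1 / \<epsilon>)" by (simp add: q_def power2_eq_square)
    also have "\<dots> \<le> Z * Z * Z" using LZ eZ L1 eps Z2 by (intro mult_mono) auto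
    finally show ?thesis by (simp add: power3_eq_cube)
  qed
  define b where "b = nat \<lfloor>Z ^ C\<rfloor>"
  have "0 \<le> Z ^ C" using Z2 by simp
  then have bZ: "real b \<le> Z ^ C" "Z ^ C - 1 \<le> real b"
    unfolding b_def using floor_correct[of "Z ^ C"] by linarith+
  have le_b: "x \<le> b" if "real x \<le> real c * Z ^ p" "c + p \<le> C" for x c p
    unfolding b_def by (rule le_nat_floor) (rule order_trans[OF that(1) const_power_le[OF Z2 that(2)]])
  have nb: "n \<le> b" by (rule le_b[of _ 1 1]) (use nX XZ X1 C in auto)
  have "2000 * q + 4 \<le> real 2004 * Z ^ 3" using qZ q1 by simp
  also have "\<dots> \<le> Z ^ C" by (rule const_power_le[OF Z2]) (use C in simp)
  finally have ib: "2000 * L / \<epsilon>\<^sup>2 + 3 \<le> real b" using bZ by (simp add: q_def)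
  have LL: "L = lg (real n * max_weight n w)" by (simp add: L_def W_def)
  obtain t0 s0 sc where ex: "exec (real b) initialize (input_state n w \<epsilon>) t0 s0" and sc2: "2 \<le> sc"
    and scl: "1000 * L / \<epsilon>\<^sup>2 \<le> real sc" and scu: "real sc \<le> 2000 * L / \<epsilon>\<^sup>2 + 2"
    and t0: "real t0 \<le> 8 * real n + 3 * L + 4000 * L / \<epsilon>\<^sup>2 + 30"
    and s0: "nmem s0 ''s'' 0 = sc" "nmem s0 ''cge'' = (\<lambda>_. 0)(0 := n)" "nmem s0 ''cnt'' 0 = n"
    "\<forall>v<n. nmem s0 ''ord'' v = v \<and> nmem s0 ''pos'' v = v \<and> rmem s0 ''hi'' v = 2"
    "rmem s0 ''wge'' = (\<lambda>_. 0)(0 := \<Sum>v<n. w v)"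
    "frame {''i'', ''ord'', ''pos'', ''cge'', ''cnt'', ''j'', ''s''} {''hi'', ''wge'', ''W'', ''p''} (input_state n w \<epsilon>) s0"
    using runs_initialize[OF n w eps LL nb ib] unfolding runs_def by blast
  have scq: "real sc \<le> 2002 * q" using scu q1 by (simp add: q_def)
  have sc4: "4 \<le> sc" using scl q1 by (simp add: q_def)
  define M where "M = nat \<lfloor>real sc * ((real k + 1) * L)\<rfloor>"
  have "real M \<le> real sc * ((real k + 1) * L)" using L1 by (simp add: M_def)
  also have "\<dots> \<le> 2002 * q * ((real k + 1) * L)" using scq L1 by (intro mult_right_mono) auto
  finally have Mq: "real M \<le> 2002 * (real k + 1) * L * q" by (simp add: ac_simps)
  interpret machine n w \<epsilon> sc M b "X ^ k"
  proof
    show "0 < n" "0 < \<epsilon>" "2 \<le> sc" using n eps sc2 by simp_all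
    show "1 \<le> w v" if "v < n" for v using w that .
    show "sc \<le> b" by (rule le_b[of _ 2002 3]) (use scq qZ C in auto)
    show "i \<le> M" if "tau sc i \<le> X ^ k + 1" for i
    proof -
      have "ln (X ^ k) \<le> real k * L"
        using ln_le_lg[OF X1] X1 by (simp add: ln_realpow L_def X_def mult_left_mono)
      then have "real i \<le> real sc * (1 + real k * L)"
        using X1 that sc4 by (intro tau_le_imp_level_le) (auto simp: one_le_power)
      also have "\<dots> \<le> real sc * ((real k + 1) * L)"
        using L1 by (intro mult_left_mono) (auto simp: algebra_simps)
      finally show ?thesis unfolding M_def by (rule le_nat_floor)
    qed
    show "(M + 6) * n * n \<le> b"
    proof (rule le_b)
      \<comment> \<open>From L <= Z and L / \<epsilon>^2 <= Z^3, the level count satisfies M + 6 <=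
        2008 (k + 1) Z^4. The two factors \<open>n\<close> raise the exponent to 6; this is the main
        demand on \<open>C\<close>.\<close>
      have LqZ: "L * q \<le> Z * Z ^ 3" using LZ qZ L1 q1 Z2 by (intro mult_mono) auto
      have "real M \<le> 2002 * (real k + 1) * (L * q)" using Mq by (simp only: mult.assoc)
      also have "\<dots> \<le> 2002 * (real k + 1) * (Z * Z ^ 3)" using LqZ by (intro mult_left_mono) auto
      finally have MZ: "real M \<le> 2002 * (real k + 1) * (Z * Z ^ 3)" .
      have Z4: "1 \<le> Z * Z ^ 3" using Z2 one_le_power[of Z 4] by (simp add: eval_nat_numeral)
      have "1 * 1 \<le> (real k + 1) * (Z * Z ^ 3)" using Z4 by (intro mult_mono) auto
      then have M6: "real M + 6 \<le> 2008 * (real k + 1) * (Z * Z ^ 3)"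
        using MZ unfolding mult.assoc by linarith
      have nZ: "real n \<le> Z" using nX XZ X1 by linarith
      have "real ((M + 6) * n * n) = (real M + 6) * real n * real n" by simp
      also have "\<dots> \<le> (2008 * (real k + 1) * (Z * Z ^ 3)) * Z * Z"
        using M6 nZ Z2 by (intro mult_mono) auto
      also have "\<dots> = 2008 * (real k + 1) * ((Z * Z ^ 3) * Z * Z)" by (simp only: mult.assoc)
      also have "(Z * Z ^ 3) * Z * Z = Z ^ 6" by (simp add: eval_nat_numeral)
      also have "2008 * (real k + 1) = real (2008 * (k + 1))" by simp
      finally show "real ((M + 6) * n * n) \<le> real (2008 * (k + 1)) * Z ^ 6" .
    qed (use C in simp)
    show "d + 2 \<le> b" if v: "v < n" and d: "real d \<le> X ^ k * w v" for v d
    proof (rule le_b)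
      have "X ^ k * w v \<le> Z ^ k * Z"
        using wW[OF v] w[OF v] nX XZ X1 Z2 by (intro mult_mono power_mono) auto
      moreover have "1 \<le> Z ^ Suc k" using Z2 by (intro one_le_power) simp
      ultimately show "real (d + 2) \<le> real 3 * Z ^ Suc k" using d by (simp add: mult.commute)
    qed (use C in simp)
  qed
  have inp: "nmem s0 ''n'' 0 = n" "\<And>v. v < n \<Longrightarrow> rmem s0 ''w'' v = w v" "rmem s0 ''eps'' 0 = \<epsilon>"
    "nmem s0 ''orient'' = (\<lambda>_. 0)" "nmem s0 ''oc'' = (\<lambda>_. 0)" "nmem s0 ''ic'' = (\<lambda>_. 0)"
    "nmem s0 ''lev'' = (\<lambda>_. 0)" "nmem s0 ''deg'' = (\<lambda>_. 0)" "nmem s0 ''rem'' = (\<lambda>_. 0)" "rmem s0 ''lo'' = (\<lambda>_. 0)"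
    using s0(6) by (simp_all add: frame_def input_state_def)
  have "ready {#} s0" "budget s0 = 0"
    using ready_initial[of s0] inp s0(1-5) by simp_all
  moreover have "real b \<le> (2 * real n * W / \<epsilon>) ^ C" using bZ(1) by (simp add: Z_def X_def mult.assoc)
  ultimately show ?thesis
    using that[OF _ _ ex t0 _ _ scl] machine_axioms scq Mq by (simp add: X_def q_def)
qed

text \<open>With q = L / \<epsilon>^2 and r = L q, \<open>sc\<close> is O(q) and \<open>M\<close> is
  O((k + 1) r). So the amortized time is linear in r = L^2 / \<epsilon>^2 and the worst case in r q
  = L^3 / \<epsilon>^4. \<open>l\<close> stands for lg (L / \<epsilon>).\<close>

lemma time_bounds:
  fixes L \<epsilon> T :: real
  assumes L: "1 \<le> L" and eps: "0 < \<epsilon>" "\<epsilon> < 1" and T: "1 \<le> l"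
    and sc: "real sc \<le> 2002 * (L / \<epsilon>\<^sup>2)" and M: "real M \<le> 2002 * (real k + 1) * L * (L / \<epsilon>\<^sup>2)"
    and C: "200000000 * (real k + 1) \<le> c"
  shows "real (35 * M + 31 * sc + 60) \<le> c * (L\<^sup>2 * l / \<epsilon>\<^sup>2)"
    and "real (31 * ((M + 1) * (sc + 1)) + 29 * M + 18 * sc + 60) \<le> c * (L ^ 3 * l / \<epsilon> ^ 4)"
    and "8 * real n + 3 * L + 4000 * L / \<epsilon>\<^sup>2 + 30 \<le> c * (real n + L\<^sup>2 * l / \<epsilon>\<^sup>2)"
proof -
  define q where "q = L / \<epsilon>\<^sup>2"
  define K where "K = real k + 1"
  have e2: "0 < \<epsilon>\<^sup>2" "\<epsilon>\<^sup>2 \<le> 1" using eps by (simp_all add: power_le_one)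
  have q1: "1 \<le> q" "L \<le> q" using e2 L by (simp_all add: q_def pos_le_divide_eq mult_left_le)
  have K1: "1 \<le> K" by (simp add: K_def)
  have c: "200000000 * K \<le> c" using C by (simp add: K_def)
  define r where "r = L * q"
  have r: "1 * q \<le> r" "1 * 1 \<le> r" unfolding r_def using L q1 by (intro mult_mono; simp)+
  have Kr: "1 * r \<le> K * r" "1 * 1 \<le> K * r" using K1 r by (intro mult_mono; simp)+
  have M': "real M \<le> 2002 * (K * r)" using M unfolding K_def[symmetric] q_def[symmetric] r_def by (simp add: mult.assoc)
  have sc': "real sc \<le> 2002 * q" using sc by (simp add: q_def)
  have c0: "0 \<le> c" using c K1 by linarith
  have rT: "r \<le> L\<^sup>2 * l / \<epsilon>\<^sup>2"
  proof -
    have "r = L\<^sup>2 * 1 / \<epsilon>\<^sup>2" by (simp add: r_def q_def power2_eq_square)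
    also have "\<dots> \<le> L\<^sup>2 * l / \<epsilon>\<^sup>2" using T by (intro divide_right_mono mult_left_mono) auto
    finally show ?thesis .
  qed
  have "200000000 * (K * r) \<le> c * r" using c r mult_right_mono[of "200000000 * K" c r] by (simp add: mult.assoc)
  also have "\<dots> \<le> c * (L\<^sup>2 * l / \<epsilon>\<^sup>2)" using rT c0 by (intro mult_left_mono)
  finally have big: "200000000 * (K * r) \<le> c * (L\<^sup>2 * l / \<epsilon>\<^sup>2)" .
  have "real (35 * M + 31 * sc + 60) = 35 * real M + 31 * real sc + 60" by simp
  also have "\<dots> \<le> 200000000 * (K * r)" using M' sc' r Kr by linarith
  finally show "real (35 * M + 31 * sc + 60) \<le> c * (L\<^sup>2 * l / \<epsilon>\<^sup>2)" using big by linarith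
  have "8 * real n \<le> c * real n" using c K1 by (intro mult_right_mono) auto
  moreover have "3 * L + 4000 * q + 30 \<le> 200000000 * (K * r)" using r Kr q1 by linarith
  ultimately show "8 * real n + 3 * L + 4000 * L / \<epsilon>\<^sup>2 + 30 \<le> c * (real n + L\<^sup>2 * l / \<epsilon>\<^sup>2)"
    using big by (simp add: q_def distrib_left)
  have "(real M + 1) * (real sc + 1) \<le> (2003 * (K * r)) * (2003 * q)"
    using M' sc' Kr q1 by (intro mult_mono) linarith+
  also have "\<dots> = 4012009 * (K * r * q)" by simp
  finally have a: "(real M + 1) * (real sc + 1) \<le> 4012009 * (K * r * q)" .
  have b: "K * r * 1 \<le> K * r * q" using q1 Kr by (intro mult_left_mono) linarith+
  have "real (31 * ((M + 1) * (sc + 1)) + 29 * M + 18 * sc + 60) =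
      31 * ((real M + 1) * (real sc + 1)) + 29 * real M + 18 * real sc + 60" by (simp add: algebra_simps)
  \<comment> \<open>The leading coefficient is 31 times 2003^2, about 1.25e8; the lower-order terms
    fit below 2e8.\<close>
  also have "\<dots> \<le> 200000000 * (K * r * q)" using a b M' sc' r Kr by linarith
  also have "\<dots> = (200000000 * K) * (L ^ 3 * 1 / \<epsilon> ^ 4)"
    by (simp add: r_def q_def eval_nat_numeral)
  also have "\<dots> \<le> c * (L ^ 3 * l / \<epsilon> ^ 4)"
    using c c0 L T by (intro mult_mono divide_right_mono mult_left_mono) auto
  finally show "real (31 * ((M + 1) * (sc + 1)) + 29 * M + 18 * sc + 60) \<le> c * (L ^ 3 * l / \<epsilon> ^ 4)" .
qed

context machine
begin

lemma ready_guarantees: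
  assumes rd: "ready G s" and gr: "graph_on n G" and e1: "\<epsilon> < 1"
    and L: "1 \<le> L" "ln (\<Sum>v<n. w v) \<le> L" and scL: "1000 * L / \<epsilon>\<^sup>2 \<le> real sc"
  shows "orientation n G (stored_orientation n s)"
    and "max_load n w (stored_orientation n s) \<le> (1 + \<epsilon>) * opt_lp n w G + 300 * L / \<epsilon>"
    and "\<exists>t s'. exec (real b) report (call_state Report s) t s' \<and> distinct (written s') \<and>
      set (written s') \<noteq> {} \<and> set (written s') \<subseteq> {..<n} \<and> t \<le> 5 * card (set (written s')) \<and>
      (1 - \<epsilon>) * opt_lp n w G - 300 * L / \<epsilon> \<le> density w G (set (written s'))"
proof -
  let ?lev = "nmem s ''lev''"
  define xs where "xs = map (nmem s ''ord'') [0..<nmem s ''cnt'' 0]"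
  obtain t T i where sel: "t + 5 * i = T" "\<forall>v<n. ?lev v \<le> T" "level_set n ?lev T \<noteq> {}"
    "(1 + \<epsilon> / 4) ^ i * level_weight n w ?lev T \<le> level_weight n w ?lev t"
    "t < 5 \<or> level_weight n w ?lev (t - 5) \<le> (1 + \<epsilon> / 4) * level_weight n w ?lev t"
    and xs_set: "set xs = level_set n ?lev (t - 5)" "distinct xs"
    using ready_chosen_level[OF rd] unfolding xs_def by metis
  have st: "stored_orientation n s = orient_of n (nmem s ''orient'')"
    by (intro ext) (simp add: stored_orientation_def)
  have con: "consistent G s" using rd by (simp add: ready_def)
  have core: "core n w sc (nmem s ''orient'') (nmem s ''K'') ?lev (nmem s ''deg'') (nmem s ''rem'')"
    and o: "orientation n G (orient_of n (nmem s ''orient''))"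
    and deg: "\<forall>v<n. ind n (nmem s ''orient'') v = nmem s ''deg'' v"
    using con by (simp_all add: consistent_def rep_def oriented_def)
  have L0: "ln (level_weight n w ?lev 0) \<le> L" using L by (simp add: level_weight_def)
  have w': "\<forall>v<n. 1 \<le> w v" using w by blast
  note guar = chosen_level_guarantee[OF core o gr w' deg eps e1 L(1) L0 scL sel]
  show "orientation n G (stored_orientation n s)" using o st by simp
  show "max_load n w (stored_orientation n s) \<le> (1 + \<epsilon>) * opt_lp n w G + 300 * L / \<epsilon>"
    using guar(1) st by simp
  have cs: "nmem (call_state Report s) = nmem s" by simp
  note rc = ready_call_state[OF rd, of Report]
  obtain t' s' where ex: "exec (real b) report (call_state Report s) t' s'"
    and t': "t' \<le> 3 * nmem s ''cnt'' 0 + 2" and wr: "written s' = xs"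
    using runs_report[OF rc(1,3)] unfolding runs_def cs xs_def by blast
  have "level_set n ?lev T \<subseteq> level_set n ?lev (t - 5)" using sel(1) by (auto simp: level_set_def)
  then have ne: "set xs \<noteq> {}" using sel(3) xs_set(1) by (metis subset_empty)
  have cd: "card (set xs) = nmem s ''cnt'' 0" by (simp add: distinct_card[OF xs_set(2)]) (simp add: xs_def)
  \<comment> \<open>The set has at least one vertex, so the constant start-up cost of the report is
    also linear in its size.\<close>
  have "card (set xs) \<noteq> 0" using ne by simp
  then have "t' \<le> 5 * card (set xs)" using t' cd by linarith
  moreover have "set xs \<subseteq> {..<n}" using xs_set(1) by (auto simp: level_set_def)
  ultimately show "\<exists>t s'. exec (real b) report (call_state Report s) t s' \<and> distinct (written s') \<and>
      set (written s') \<noteq> {} \<and> set (written s') \<subseteq> {..<n} \<and> t \<le> 5 * card (set (written s')) \<and>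
      (1 - \<epsilon>) * opt_lp n w G - 300 * L / \<epsilon> \<le> density w G (set (written s'))"
    using ex wr ne xs_set guar(2) by metis
qed

end

theorem theorem5p1:
  fixes k :: nat
  shows "\<exists>(D :: data_structure) (C :: nat).
    \<forall>(n :: nat) (w :: nat \<Rightarrow> real) (\<epsilon> :: real).
      n \<ge> 1 \<and> (\<forall>v<n. w v \<ge> 1) \<and> 0 < \<epsilon> \<and> \<epsilon> < 1 \<longrightarrow>
      (let W = max_weight n w;
           L = lg (real n * W);
           T_amortized = L ^ 2 * lg (L / \<epsilon>) / \<epsilon> ^ 2;
           T_worst = L ^ 3 * lg (L / \<epsilon>) / \<epsilon> ^ 4;
           B = (2 * real n * W / \<epsilon>) ^ C
       in \<exists>t0 s0. exec B (init_code D) (input_state n w \<epsilon>) t0 s0 \<and>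
            real t0 \<le> real C * (real n + T_amortized) \<and>
            (\<forall>ops. admissible n w k ops \<longrightarrow>
              (\<exists>ts s. executes B D s0 ops ts s \<and>
                 (let G = graph_after ops; R = stored_orientation n s; OPT = opt_lp n w G in
                    orientation n G R \<and>
                    max_load n w R \<le> (1 + \<epsilon>) * OPT + real C * L / \<epsilon> \<and>
                    (\<exists>t s'. exec B (report_code D) (call_state Report s) t s' \<and>
                       (let S = set (written s') in
                          distinct (written s') \<and> S \<noteq> {} \<and> S \<subseteq> {..<n} \<and>
                          real t \<le> real C * real (card S) \<and>
                          density w G S \<ge> (1 - \<epsilon>) * OPT - real C * L / \<epsilon>))) \<and>
                 real (\<Sum>i | i < length ops \<and> ops ! i \<noteq> Report. ts ! i)
                   \<le> real C * real (card {i. i < length ops \<and> ops ! i \<noteq> Report}) * T_amortized \<and>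
                 (\<forall>i<length ops. ops ! i \<noteq> Report \<longrightarrow> real (ts ! i) \<le> real C * T_worst))))"
proof -
  \<comment> \<open>One constant serves as exponent of the word bound and as factor in the error
    terms and all times. The worst-case time makes the largest demand.\<close>
  obtain C :: nat where C: "C = 200000000 * (k + 1)" by blast
  have C_bounds: "2008 * (k + 1) + k + 6 \<le> C" "300 \<le> C" "200000000 * (real k + 1) \<le> real C"
    by (simp_all add: C)
  show ?thesis
  proof (rule exI[of _ algorithm], rule exI[of _ C], intro allI impI, unfold Let_def, elim conjE)
    fix n :: nat and w :: "nat \<Rightarrow> real" and \<epsilon> :: real
    assume n1: "1 \<le> n" and w: "\<forall>v<n. 1 \<le> w v" and eps1: "0 < \<epsilon>" "\<epsilon> < 1"
    define W where "W = max_weight n w"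
    define L where "L = lg (real n * W)"
    define T_amortized where "T_amortized = L ^ 2 * lg (L / \<epsilon>) / \<epsilon> ^ 2"
    define T_worst where "T_worst = L ^ 3 * lg (L / \<epsilon>) / \<epsilon> ^ 4"
    define B where "B = (2 * real n * W / \<epsilon>) ^ C"
    have w1: "1 \<le> w v" if "v < n" for v using w that by blast
    obtain sc M b t0 s0 where m: "machine n w \<epsilon> sc M b ((real n * W) ^ k)" and bB: "real b \<le> B"
      and init: "exec (real b) initialize (input_state n w \<epsilon>) t0 s0"
      and t0: "real t0 \<le> 8 * real n + 3 * L + 4000 * L / \<epsilon>\<^sup>2 + 30"
      and s0: "machine.ready n w \<epsilon> sc {#} s0" "machine.budget n s0 = 0"
      and scL: "1000 * L / \<epsilon>\<^sup>2 \<le> real sc" and scu: "real sc \<le> 2002 * (L / \<epsilon>\<^sup>2)"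
      and Mu: "real M \<le> 2002 * (real k + 1) * L * (L / \<epsilon>\<^sup>2)"
      unfolding B_def by (rule machine_exists[OF n1 w1 eps1 W_def L_def C_bounds(1)])
    interpret machine n w \<epsilon> sc M b "(real n * W) ^ k" by (rule m)
    have L1: "1 \<le> L" by (simp add: L_def lg_def)
    have l1: "1 \<le> lg (L / \<epsilon>)" by (simp add: lg_def)
    note times = time_bounds[OF L1 eps1 l1 scu Mu C_bounds(3), folded T_amortized_def T_worst_def]
    have w_le: "w v \<le> W" if "v < n" for v
      unfolding W_def max_weight_def using that by (intro Max_ge) auto
    \<comment> \<open>The descent is measured against the total weight, which lies between 1 and nW;
      so \<open>L\<close> bounds its logarithm.\<close>
    have "real n * 1 \<le> (\<Sum>v<n. w v)"
      using sum_mono[of "{..<n}" "\<lambda>_. 1" w] w1 by simp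
    moreover have "(\<Sum>v<n. w v) \<le> real n * W" using sum_mono[of "{..<n}" w "\<lambda>_. W"] w_le by simp
    ultimately have "1 \<le> (\<Sum>v<n. w v)" "(\<Sum>v<n. w v) \<le> real n * W" using n1 by linarith+
    then have L_sum: "ln (\<Sum>v<n. w v) \<le> L"
      using ln_le_lg[of "real n * W"] ln_le_cancel_iff[of "\<Sum>v<n. w v" "real n * W"] unfolding L_def by linarith
    have C_term: "300 * L / \<epsilon> \<le> real C * L / \<epsilon>"
      using L1 eps1 C_bounds(2) by (intro divide_right_mono mult_right_mono) auto
    have run: "\<exists>ts s. executes B algorithm s0 ops ts s \<and>
        (orientation n (graph_after ops) (stored_orientation n s) \<and>
         max_load n w (stored_orientation n s) \<le> (1 + \<epsilon>) * opt_lp n w (graph_after ops) + real C * L / \<epsilon> \<and>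
         (\<exists>t s'. exec B (report_code algorithm) (call_state Report s) t s' \<and>
            distinct (written s') \<and> set (written s') \<noteq> {} \<and> set (written s') \<subseteq> {..<n} \<and>
            real t \<le> real C * real (card (set (written s'))) \<and>
            (1 - \<epsilon>) * opt_lp n w (graph_after ops) - real C * L / \<epsilon> \<le> density w (graph_after ops) (set (written s')))) \<and>
        real (\<Sum>i | i < length ops \<and> ops ! i \<noteq> Report. ts ! i)
          \<le> real C * real (card {i. i < length ops \<and> ops ! i \<noteq> Report}) * T_amortized \<and>
        (\<forall>i<length ops. ops ! i \<noteq> Report \<longrightarrow> real (ts ! i) \<le> real C * T_worst)"
      if adm: "admissible n w k ops" for ops
    proof -
      define m where "m = card {i. i < length ops \<and> ops ! i \<noteq> Report}"
      have ok: "operation_ok n (foldl apply_operation {#} (take i ops)) (ops ! i)" if "i < length ops" for i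
        using adm that by (simp add: admissible_def graph_after_def)
      have bd: "bounded (foldl apply_operation {#} (take i ops))" if "i \<le> length ops" for i
      proof -
        have "loads_bounded n w k (foldl apply_operation {#} (take i ops))"
          using adm that by (simp add: admissible_def graph_after_def)
        from loads_bounded_ind[OF this w1] show ?thesis
          unfolding bounded_def unfolding W_def by blast
      qed
      have "graph_on n {#}" by (simp add: graph_on_def)
      from executes_algorithm[OF s0(1) this ok bd] obtain ts s where
        ex: "executes (real b) algorithm s0 ops ts s" and rd: "ready (graph_after ops) s"
        and gr: "graph_on n (graph_after ops)"
        and sum: "(\<Sum>i | i < length ops \<and> ops ! i \<noteq> Report. ts ! i) + 31 * budget s \<le>
          (35 * M + 31 * sc + 60) * m + 31 * budget s0"
        and worst: "\<forall>i<length ops. ops ! i \<noteq> Report \<longrightarrow>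
          ts ! i \<le> 31 * ((M + 1) * (sc + 1)) + 29 * M + 18 * sc + 60"
        unfolding graph_after_def m_def by blast
      note guar = ready_guarantees[OF rd gr eps1(2) L1 L_sum scL]
      obtain t s' where rep: "exec (real b) report (call_state Report s) t s'" "distinct (written s')"
        "set (written s') \<noteq> {}" "set (written s') \<subseteq> {..<n}" "t \<le> 5 * card (set (written s'))"
        "(1 - \<epsilon>) * opt_lp n w (graph_after ops) - 300 * L / \<epsilon> \<le> density w (graph_after ops) (set (written s'))"
        using guar(3) by blast
      have "exec B (report_code algorithm) (call_state Report s) t s'"
        using exec_mono[OF rep(1) bB] by (simp add: algorithm_def)
      moreover have "t \<le> C * card (set (written s'))"
        using rep(5) C_bounds(2) mult_le_mono1[of 5 C "card (set (written s'))"] by linarith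
      then have "real t \<le> real C * real (card (set (written s')))"
        by (simp only: of_nat_le_iff of_nat_mult[symmetric])
      moreover have "(1 - \<epsilon>) * opt_lp n w (graph_after ops) - real C * L / \<epsilon> \<le> density w (graph_after ops) (set (written s'))"
        using rep(6) C_term by linarith
      ultimately have report: "\<exists>t s'. exec B (report_code algorithm) (call_state Report s) t s' \<and>
            distinct (written s') \<and> set (written s') \<noteq> {} \<and> set (written s') \<subseteq> {..<n} \<and>
            real t \<le> real C * real (card (set (written s'))) \<and>
            (1 - \<epsilon>) * opt_lp n w (graph_after ops) - real C * L / \<epsilon> \<le> density w (graph_after ops) (set (written s'))"
        using rep(2-4) by blast
      \<comment> \<open>The potential starts at 0 and is never negative.\<close>
      have "(\<Sum>i | i < length ops \<and> ops ! i \<noteq> Report. ts ! i) \<le> (35 * M + 31 * sc + 60) * m"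
        using sum s0(2) by linarith
      then have "real (\<Sum>i | i < length ops \<and> ops ! i \<noteq> Report. ts ! i) \<le> real ((35 * M + 31 * sc + 60) * m)"
        by (simp only: of_nat_le_iff)
      also have "\<dots> = real (35 * M + 31 * sc + 60) * real m" by (simp only: of_nat_mult)
      also have "\<dots> \<le> (real C * T_amortized) * real m" using times(1) by (intro mult_right_mono) auto
      finally have amortized: "real (\<Sum>i | i < length ops \<and> ops ! i \<noteq> Report. ts ! i)
          \<le> real C * real m * T_amortized" by (simp only: ac_simps)
      have "real (ts ! i) \<le> real C * T_worst" if "i < length ops" "ops ! i \<noteq> Report" for i
        by (rule order_trans[OF _ times(2)]) (simp only: of_nat_le_iff worst[rule_format, OF that])
      moreover have "max_load n w (stored_orientation n s) \<le> (1 + \<epsilon>) * opt_lp n w (graph_after ops) + real C * L / \<epsilon>"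
        using guar(2) C_term by linarith
      ultimately show ?thesis
        using executes_mono[OF ex bB] guar(1) report amortized unfolding m_def by blast
    qed
    have "exec B (init_code algorithm) (input_state n w \<epsilon>) t0 s0"
      using exec_mono[OF init bB] by (simp add: algorithm_def)
    moreover have "real t0 \<le> real C * (real n + T_amortized)" by (rule order_trans[OF t0 times(3)])
    ultimately show "\<exists>t0 s0. exec ((2 * real n * max_weight n w / \<epsilon>) ^ C) (init_code algorithm) (input_state n w \<epsilon>) t0 s0 \<and>
      real t0 \<le> real C * (real n + lg (real n * max_weight n w) ^ 2 * lg (lg (real n * max_weight n w) / \<epsilon>) / \<epsilon> ^ 2) \<and>
      (\<forall>ops. admissible n w k ops \<longrightarrow>
         (\<exists>ts s. executes ((2 * real n * max_weight n w / \<epsilon>) ^ C) algorithm s0 ops ts s \<and>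
        (orientation n (graph_after ops) (stored_orientation n s) \<and>
         max_load n w (stored_orientation n s) \<le> (1 + \<epsilon>) * opt_lp n w (graph_after ops) + real C * lg (real n * max_weight n w) / \<epsilon> \<and>
         (\<exists>t s'. exec ((2 * real n * max_weight n w / \<epsilon>) ^ C) (report_code algorithm) (call_state Report s) t s' \<and>
            distinct (written s') \<and> set (written s') \<noteq> {} \<and> set (written s') \<subseteq> {..<n} \<and>
            real t \<le> real C * real (card (set (written s'))) \<and>
            (1 - \<epsilon>) * opt_lp n w (graph_after ops) - real C * lg (real n * max_weight n w) / \<epsilon> \<le> density w (graph_after ops) (set (written s')))) \<and>
        real (\<Sum>i | i < length ops \<and> ops ! i \<noteq> Report. ts ! i)
          \<le> real C * real (card {i. i < length ops \<and> ops ! i \<noteq> Report}) *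
            (lg (real n * max_weight n w) ^ 2 * lg (lg (real n * max_weight n w) / \<epsilon>) / \<epsilon> ^ 2) \<and>
        (\<forall>i<length ops. ops ! i \<noteq> Report \<longrightarrow> real (ts ! i) \<le> real C *
          (lg (real n * max_weight n w) ^ 3 * lg (lg (real n * max_weight n w) / \<epsilon>) / \<epsilon> ^ 4))))"
      using run unfolding T_amortized_def T_worst_def B_def L_def W_def by blast
  qed
qed

end
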